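(* If a system $\dot x=f(x)$, with $x\in\mathbb{R}^n$ and $f\in C^2$, admits a stable hyperbolic limit cycle $\Gamma$ (with independent eigenvectors of the monodromy matrix), then it is strictly differentially positive in the basin of attraction $\mathcal{B}(\Gamma)\subseteq\mathbb{R}^n$ of $\Gamma$.
   Context: Setting. The system $\dot x=f(x)$ is assumed forward and backward complete, with flow $\psi^t$ defined for all $t\in\mathbb{R}$. A limit cycle $\Gamma$ of period $T_\Gamma>0$ is a (nonconstant) periodic orbit; its monodromy matrix is $\partial\psi^{T_\Gamma}(x)$ for $x\in\Gamma$. It is stable hyperbolic when, apart from the trivial simple Floquet multiplier $1$, all Floquet multipliers have modulus less than $1$ (equivalently, the $n-1$ nontrivial Floquet exponents have negative real part). The basin of attraction $\mathcal{B}(\Gamma)$ is the set of points whose trajectories converge to $\Gamma$ as $t\to+\infty$. The definitions below are applied with $\mathcal{X}=\mathcal{B}(\Gamma)$, $T_x\mathcal{X}=\mathbb{R}^n$; $\mathcal{X}$ is endowed with a Riemannian metric and $|\delta x|$ is the associated norm. $\partial\psi^t(x)$ is the differential of $\psi^t$ at $x$, and $\partial\psi^t(x)A=\{\partial\psi^t(x)\delta x:\delta x\in A\}$. Cone fields. A cone field on $\mathcal{X}$ assigns to each $x\in\mathcal{X}$ a closed, solid (nonempty interior) set $\mathcal{K}(x)\subseteq T_x\mathcal{X}$ with $\mathcal{K}(x)+\mathcal{K}(x)\subseteq\mathcal{K}(x)$, $\alpha\mathcal{K}(x)\subseteq\mathcal{K}(x)$ for all $\alpha\in\mathbb{R}^+$,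 and $\mathcal{K}(x)\cap-\mathcal{K}(x)=\{0\}$. Differential positivity. The system is differentially positive with respect to $\mathcal{K}$ if $\partial\psi^t(x)\mathcal{K}(x)\subseteq\mathcal{K}(\psi^t(x))$ for all $x\in\mathcal{X}$ and $t>0$. It is (uniformly) strictly differentially positive with respect to $\mathcal{K}$ if in addition there exist a constant $T>0$ and a cone field $\mathcal{R}(x)\subset\mathrm{int}\,\mathcal{K}(x)\cup\{0\}$ such that $\partial\psi^t(x)\mathcal{K}(x)\subseteq\mathcal{R}(\psi^t(x))$ for all $x\in\mathcal{X}$ and $t\geq T$. The system is called strictly differentially positive in $\mathcal{B}(\Gamma)$ if it is so with respect to some cone field on $\mathcal{X}=\mathcal{B}(\Gamma)$. Standing conventions on cone fields in the paper: to avoid pathological cases, it is assumed that for every $x_1,x_2\in\mathcal{X}$ there is a linear invertible map $L(x_1,x_2):T_{x_1}\mathcal{X}\to T_{x_2}\mathcal{X}$ with $L(x_1,x_2)\mathcal{K}(x_1)=\mathcal{K}(x_2)$ and $L(x_1,x_2)\mathcal{R}(x_1)=\mathcal{R}(x_2)$; and one considers representations $\mathcal{K}(x)=\{\delta x: k_i(x,\delta x)\geq 0,\ i=1,\dots,m\}$, $\mathcal{R}(x)=\{\delta x: k_i(x,\delta x/|\delta x|)\geq\varepsilon,\ i=1,\dots,m\}$ for some $m\in\mathbb{N}$, $\varepsilon>0$ and smooth functions $k_i:T\mathcal{X}\to\mathbb{R}$. *)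

theory Defs
  imports
    "HOL-Analysis.Analysis"
    "HOL-Computational_Algebra.Polynomial"
begin

section \<open>Maps of class C^k\<close>

text \<open>
  Meant for open \<open>S\<close>. On an open subset of a Euclidean space, continuity of all directional
  derivatives of order at most \<open>k\<close> is the usual notion of class C^k.
\<close>

fun Ck_on :: "nat \<Rightarrow> ('a::euclidean_space \<Rightarrow> 'b::real_normed_vector) \<Rightarrow> 'a set \<Rightarrow> bool" where
  "Ck_on 0 f S \<longleftrightarrow> continuous_on S f"
| "Ck_on (Suc k) f S \<longleftrightarrow>
     (\<forall>x\<in>S. f differentiable (at x)) \<and> (\<forall>v. Ck_on k (\<lambda>x. frechet_derivative f (at x) v) S)"

definition smooth_on :: "('a::euclidean_space \<Rightarrow> 'b::real_normed_vector) \<Rightarrow> 'a set \<Rightarrow> bool" where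
  "smooth_on f S \<longleftrightarrow> (\<forall>k. Ck_on k f S)"

section \<open>Flows and limit cycles\<close>

text \<open>
  \<open>\<psi> t x\<close> is the solution at time \<open>t\<close> starting from \<open>x\<close>. Its existence for all real \<open>t\<close>
  expresses forward and backward completeness. For locally Lipschitz \<open>f\<close> these conditions
  determine \<open>\<psi>\<close> uniquely; the group law and the regularity in \<open>x\<close> are consequences.
\<close>

definition complete_flow :: "('a::real_normed_vector \<Rightarrow> 'a) \<Rightarrow> (real \<Rightarrow> 'a \<Rightarrow> 'a) \<Rightarrow> bool" where
  "complete_flow f \<psi> \<longleftrightarrow>
     (\<forall>x. \<psi> 0 x = x \<and> (\<forall>t. ((\<lambda>s. \<psi> s x) has_vector_derivative f (\<psi> t x)) (at t)))"

text \<open>The period is the least positive one; its existence makes the orbit nonconstant.\<close>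

definition limit_cycle :: "(real \<Rightarrow> 'a \<Rightarrow> 'a) \<Rightarrow> 'a set \<Rightarrow> real \<Rightarrow> bool" where
  "limit_cycle \<psi> \<Gamma> T \<longleftrightarrow> 0 < T \<and>
     (\<exists>p. \<Gamma> = range (\<lambda>t. \<psi> t p) \<and> \<psi> T p = p \<and> (\<forall>t. 0 < t \<and> t < T \<longrightarrow> \<psi> t p \<noteq> p))"

definition basin :: "(real \<Rightarrow> 'a::metric_space \<Rightarrow> 'a) \<Rightarrow> 'a set \<Rightarrow> 'a set" where
  "basin \<psi> \<Gamma> = {x. ((\<lambda>t. infdist (\<psi> t x) \<Gamma>) \<longlongrightarrow> 0) at_top}"

abbreviation flow_differential ::
  "(real \<Rightarrow> 'a::real_normed_vector \<Rightarrow> 'a) \<Rightarrow> real \<Rightarrow> 'a \<Rightarrow> 'a \<Rightarrow> 'a" where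
  "flow_differential \<psi> t x \<equiv> frechet_derivative (\<psi> t) (at x)"

section \<open>Floquet multipliers\<close>

definition eigvec :: "'a::field^'n^'n \<Rightarrow> 'a \<Rightarrow> 'a^'n \<Rightarrow> bool" where
  "eigvec A z v \<longleftrightarrow> v \<noteq> 0 \<and> A *v v = z *s v"

definition charpoly :: "'a::comm_ring_1^'n^'n \<Rightarrow> 'a poly" where
  "charpoly A = det (mat [:0, 1:] - map_matrix (\<lambda>a. [:a:]) A)"

text \<open>Complexified, since Floquet multipliers and their eigenvectors may be nonreal.\<close>

definition monodromy_matrix ::
  "(real \<Rightarrow> real^'n \<Rightarrow> real^'n) \<Rightarrow> real \<Rightarrow> real^'n \<Rightarrow> complex^'n^'n" where
  "monodromy_matrix \<psi> T x = map_matrix complex_of_real (jacobian (\<psi> T) (at x))"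

definition floquet_multiplier ::
  "(real \<Rightarrow> real^'n \<Rightarrow> real^'n) \<Rightarrow> real \<Rightarrow> real^'n \<Rightarrow> complex \<Rightarrow> bool" where
  "floquet_multiplier \<psi> T x z \<longleftrightarrow> (\<exists>v. eigvec (monodromy_matrix \<psi> T x) z v)"

text \<open>
  Different points of the cycle have conjugate monodromy matrices, so the quantification over
  \<open>\<Gamma>\<close> in the next two definitions expresses independence of the base point.
\<close>

definition stable_hyperbolic_limit_cycle ::
  "(real \<Rightarrow> real^'n \<Rightarrow> real^'n) \<Rightarrow> (real^'n) set \<Rightarrow> real \<Rightarrow> bool" where
  "stable_hyperbolic_limit_cycle \<psi> \<Gamma> T \<longleftrightarrow> limit_cycle \<psi> \<Gamma> T \<and>
     (\<forall>x\<in>\<Gamma>. order 1 (charpoly (monodromy_matrix \<psi> T x)) = 1 \<and>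
            (\<forall>z. floquet_multiplier \<psi> T x z \<and> z \<noteq> 1 \<longrightarrow> cmod z < 1))"

definition independent_monodromy_eigenvectors ::
  "(real \<Rightarrow> real^'n \<Rightarrow> real^'n) \<Rightarrow> (real^'n) set \<Rightarrow> real \<Rightarrow> bool" where
  "independent_monodromy_eigenvectors \<psi> \<Gamma> T \<longleftrightarrow>
     (\<forall>x\<in>\<Gamma>. \<exists>B. vec.independent B \<and> card B = CARD('n) \<and>
              (\<forall>v\<in>B. \<exists>z. eigvec (monodromy_matrix \<psi> T x) z v))"

section \<open>Cone fields\<close>

text \<open>
  The state space is an open set \<open>X\<close> of a Euclidean space, so that the tangent space at every point
  is the whole space and the tangent bundle is \<open>X \<times> UNIV\<close>.
\<close>

definition riemannian_metric_on ::
  "'a::euclidean_space set \<Rightarrow> ('a \<Rightarrow> 'a \<Rightarrow> 'a \<Rightarrow> real) \<Rightarrow> bool" where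
  "riemannian_metric_on X g \<longleftrightarrow>
     (\<forall>x\<in>X. bilinear (g x) \<and> (\<forall>u v. g x u v = g x v u) \<and> (\<forall>v. v \<noteq> 0 \<longrightarrow> 0 < g x v v)) \<and>
     (\<forall>u v. smooth_on (\<lambda>x. g x u v) X)"

definition metric_norm :: "('a \<Rightarrow> 'a \<Rightarrow> 'a \<Rightarrow> real) \<Rightarrow> 'a \<Rightarrow> 'a \<Rightarrow> real" where
  "metric_norm g x v = sqrt (g x v v)"

definition cone_field :: "'a::euclidean_space set \<Rightarrow> ('a \<Rightarrow> 'a set) \<Rightarrow> bool" where
  "cone_field X K \<longleftrightarrow>
     (\<forall>x\<in>X. closed (K x) \<and> interior (K x) \<noteq> {} \<and>
            (\<forall>u\<in>K x. \<forall>v\<in>K x. u + v \<in> K x) \<and>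
            (\<forall>\<alpha>\<ge>0. \<forall>v\<in>K x. \<alpha> *\<^sub>R v \<in> K x) \<and>
            K x \<inter> uminus ` K x = {0})"

definition linearly_equivalent_cones ::
  "'a::euclidean_space set \<Rightarrow> ('a \<Rightarrow> 'a set) \<Rightarrow> ('a \<Rightarrow> 'a set) \<Rightarrow> bool" where
  "linearly_equivalent_cones X K R \<longleftrightarrow>
     (\<forall>x1\<in>X. \<forall>x2\<in>X. \<exists>L. linear L \<and> bij L \<and> L ` K x1 = K x2 \<and> L ` R x1 = R x2)"

text \<open>
  The direction \<open>v / |v|\<close> is undefined at \<open>v = 0\<close>, while a cone contains \<open>0\<close>; hence the separate
  disjunct \<open>v = 0\<close> in the representation of \<open>R\<close>.
\<close>

definition smoothly_represented_cones ::
  "'a::euclidean_space set \<Rightarrow> ('a \<Rightarrow> 'a \<Rightarrow> 'a \<Rightarrow> real) \<Rightarrow>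
   ('a \<Rightarrow> 'a set) \<Rightarrow> ('a \<Rightarrow> 'a set) \<Rightarrow> bool" where
  "smoothly_represented_cones X g K R \<longleftrightarrow>
     (\<exists>(m::nat) (\<epsilon>::real) (k :: nat \<Rightarrow> 'a \<times> 'a \<Rightarrow> real).
        0 < \<epsilon> \<and> (\<forall>i<m. smooth_on (k i) (X \<times> UNIV)) \<and>
        (\<forall>x\<in>X. K x = {v. \<forall>i<m. 0 \<le> k i (x, v)} \<and>
               R x = {v. v = 0 \<or> (\<forall>i<m. \<epsilon> \<le> k i (x, v /\<^sub>R metric_norm g x v))}))"

section \<open>Differential positivity\<close>

definition differentially_positive ::
  "(real \<Rightarrow> 'a::euclidean_space \<Rightarrow> 'a) \<Rightarrow> 'a set \<Rightarrow> ('a \<Rightarrow> 'a set) \<Rightarrow> bool" where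
  "differentially_positive \<psi> X K \<longleftrightarrow>
     (\<forall>x\<in>X. \<forall>t>0. flow_differential \<psi> t x ` K x \<subseteq> K (\<psi> t x))"

definition strictly_differentially_positive_wrt ::
  "(real \<Rightarrow> 'a::euclidean_space \<Rightarrow> 'a) \<Rightarrow> 'a set \<Rightarrow> ('a \<Rightarrow> 'a \<Rightarrow> 'a \<Rightarrow> real) \<Rightarrow>
   ('a \<Rightarrow> 'a set) \<Rightarrow> bool" where
  "strictly_differentially_positive_wrt \<psi> X g K \<longleftrightarrow>
     differentially_positive \<psi> X K \<and>
     (\<exists>T>0. \<exists>R. cone_field X R \<and>
        linearly_equivalent_cones X K R \<and> smoothly_represented_cones X g K R \<and>
        (\<forall>x\<in>X. R x \<subseteq> interior (K x) \<union> {0}) \<and>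
        (\<forall>x\<in>X. \<forall>t\<ge>T. flow_differential \<psi> t x ` K x \<subseteq> R (\<psi> t x)))"

definition strictly_differentially_positive ::
  "(real \<Rightarrow> 'a::euclidean_space \<Rightarrow> 'a) \<Rightarrow> 'a set \<Rightarrow> ('a \<Rightarrow> 'a \<Rightarrow> 'a \<Rightarrow> real) \<Rightarrow> bool" where
  "strictly_differentially_positive \<psi> X g \<longleftrightarrow>
     (\<exists>K. cone_field X K \<and> strictly_differentially_positive_wrt \<psi> X g K)"

end

theory Submission
  imports Defs
begin

text \<open>
  Only two facts about a trajectory in the basin matter. Directions transverse to the flow contract
  exponentially, because near \<open>\<Gamma>\<close> the return map contracts them by hyperbolicity. The direction
  of the vector field is transported to itself, because the flow commutes with its own time shifts.
  A cone around the vector field is therefore mapped into itself, and after a while strictly so,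
  once its axis and its width are measured in a way that is adapted to the flow.

  For the axis, let \<open>phase x v\<close> be the coefficient of the vector field in the limit of the
  transported vector: the difference between \<open>D\<psi> t x v\<close> and
  \<open>phase x v *\<^sub>R f (\<psi> t x)\<close> tends to zero. The limit exists because successive changes of this
  coefficient are controlled by the transverse part, which decays geometrically. The covector
  \<open>phase x\<close> is the differential of the asymptotic phase: it is invariant under the flow and takes
  the value one on \<open>f x\<close>. For the width, integrating \<open>exp (c * t)\<close> times the squared
  length of the transported stable part over all \<open>t \<ge> 0\<close> gives a quadratic form that shrinks at
  least by the factor \<open>exp (- c * s)\<close> in every time \<open>s\<close>. This rate holds throughout the basin, although the basin is not compact and the
  constants in the contraction estimates are only locally uniform. Hence the cones
  \<open>stable_form x v v \<le> r * (phase x v)\<^sup>2\<close>, \<open>0 \<le> phase x v\<close>, are invariant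
  for every \<open>r > 0\<close>, and one time \<open>T\<close> serves at all points for the passage from a larger \<open>r\<close>
  to a smaller one. The sum of the squared covector and of the form is a metric \<open>adapted_metric\<close> in
  which \<open>f\<close> has length one, and the cones are round cones about \<open>f\<close>.

  What remains is to meet the requirements on the cones. Round cones with the same opening in different
  tangent spaces are linearly equivalent (\<open>linearly_equivalent_axis_cones\<close>). The adapted metric is
  merely continuous in \<open>x\<close>, yet a smooth representation exists: every open set of a Euclidean space is
  the positivity set of a smooth nonnegative function (\<open>open_set_smooth_positivity_set\<close>), and three
  such functions combine to one that describes both cones (\<open>smoothly_represented_axis_cones\<close>).

  The regularity of the flow is derived from its defining equation. The difference quotients of
  the flow satisfy the variational equation up to a small error, hence form a Cauchy family by
  Gronwall's estimate, and their limit is the differential of the flow. Stability of \<open>\<Gamma>\<close>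
  and openness of its basin follow from the linear approximation of the return map (\<open>return_map_halves\<close>, \<open>orbital_stability\<close>).
\<close>

section \<open>Smooth functions with a prescribed positivity set\<close>

lemma frechet_derivative_cong_open:
  assumes "open S" "x \<in> S" "\<And>y. y \<in> S \<Longrightarrow> f y = g y"
  shows "frechet_derivative f (at x) = frechet_derivative g (at x)"
proof -
  have "(f has_derivative F) (at x) \<longleftrightarrow> (g has_derivative F) (at x)" for F
    using has_derivative_transform_within_open[OF _ assms(1,2)] assms(3) by metis
  then show ?thesis by (simp add: frechet_derivative_def)
qed

lemma differentiable_cong_open:
  assumes "open S" "x \<in> S" "\<And>y. y \<in> S \<Longrightarrow> f y = g y"
  shows "f differentiable (at x) \<longleftrightarrow> g differentiable (at x)"
  using has_derivative_transform_within_open[OF _ assms(1,2)] assms(3)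
  unfolding differentiable_def by metis

lemma Ck_on_cong:
  assumes "open S" "\<And>y. y \<in> S \<Longrightarrow> f y = g y"
  shows "Ck_on k f S \<longleftrightarrow> Ck_on k g S"
  using assms(2)
proof (induction k arbitrary: f g)
  case 0
  then show ?case by (simp cong: continuous_on_cong)
next
  case (Suc k)
  have "frechet_derivative f (at x) v = frechet_derivative g (at x) v" if "x \<in> S" for x v
    using frechet_derivative_cong_open[OF assms(1) that] Suc.prems by metis
  then have "Ck_on k (\<lambda>x. frechet_derivative f (at x) v) S \<longleftrightarrow>
    Ck_on k (\<lambda>x. frechet_derivative g (at x) v) S" for v
    by (intro Suc.IH) auto
  moreover have "f differentiable (at x) \<longleftrightarrow> g differentiable (at x)" if "x \<in> S" for x
    using differentiable_cong_open[OF assms(1) that] Suc.prems by metis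
  ultimately show ?case by auto
qed

lemma Ck_on_subset: "Ck_on k f S \<Longrightarrow> U \<subseteq> S \<Longrightarrow> Ck_on k f U"
  by (induction k arbitrary: f) (auto intro: continuous_on_subset)

lemma Ck_on_Suc_imp: "Ck_on (Suc k) f S \<Longrightarrow> Ck_on k f S"
proof (induction k arbitrary: f)
  case 0
  then show ?case
    by (auto intro!: continuous_at_imp_continuous_on differentiable_imp_continuous_within)
next
  case (Suc k)
  then show ?case by (metis Ck_on.simps(2))
qed

lemma frechet_derivative_add_at:
  assumes "f differentiable (at x)" "g differentiable (at x)"
  shows "frechet_derivative (\<lambda>x. f x + g x) (at x) v
      = frechet_derivative f (at x) v + frechet_derivative g (at x) v"
proof -
  have "((\<lambda>x. f x + g x) has_derivative
      (\<lambda>v. frechet_derivative f (at x) v + frechet_derivative g (at x) v)) (at x)"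
    using assms by (intro has_derivative_add) (simp_all add: frechet_derivative_works[symmetric])
  from frechet_derivative_at[OF this] show ?thesis by metis
qed

lemma Ck_on_add:
  fixes f g :: "'a::euclidean_space \<Rightarrow> 'b::real_normed_vector"
  assumes "open S"
  shows "Ck_on k f S \<Longrightarrow> Ck_on k g S \<Longrightarrow> Ck_on k (\<lambda>x. f x + g x) S"
proof (induction k arbitrary: f g)
  case 0
  then show ?case by (simp add: continuous_on_add)
next
  case (Suc k)
  have "frechet_derivative (\<lambda>x. f x + g x) (at x) v
      = frechet_derivative f (at x) v + frechet_derivative g (at x) v" if "x \<in> S" for x v
    using Suc.prems that by (intro frechet_derivative_add_at) auto
  then have "Ck_on k (\<lambda>x. frechet_derivative (\<lambda>x. f x + g x) (at x) v) S" for v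
    using Suc.prems Suc.IH by (subst Ck_on_cong[OF assms]) auto
  then show ?case using Suc.prems by auto
qed

lemma frechet_derivative_mult_real:
  fixes f g :: "'a::real_normed_vector \<Rightarrow> real"
  assumes "f differentiable (at x)" "g differentiable (at x)"
  shows "frechet_derivative (\<lambda>x. f x * g x) (at x) v
      = f x * frechet_derivative g (at x) v + frechet_derivative f (at x) v * g x"
proof -
  have "((\<lambda>x. f x * g x) has_derivative
      (\<lambda>v. f x * frechet_derivative g (at x) v + frechet_derivative f (at x) v * g x)) (at x)"
    using assms by (intro has_derivative_mult) (simp_all add: frechet_derivative_works[symmetric])
  from frechet_derivative_at[OF this] show ?thesis by metis
qed

lemma Ck_on_mult:
  fixes f g :: "'a::euclidean_space \<Rightarrow> real"
  assumes "open S"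
  shows "Ck_on k f S \<Longrightarrow> Ck_on k g S \<Longrightarrow> Ck_on k (\<lambda>x. f x * g x) S"
proof (induction k arbitrary: f g)
  case 0
  then show ?case by (simp add: continuous_on_mult)
next
  case (Suc k)
  have f: "Ck_on k f S" "Ck_on k g S"
    using Suc.prems Ck_on_Suc_imp by blast+
  have "Ck_on k (\<lambda>x. frechet_derivative (\<lambda>x. f x * g x) (at x) v) S" for v
  proof -
    have "Ck_on k (\<lambda>x. f x * frechet_derivative g (at x) v + frechet_derivative f (at x) v * g x) S"
      using Suc f by (intro Ck_on_add[OF assms] Suc.IH) auto
    then show ?thesis
      using Suc.prems by (subst Ck_on_cong[OF assms frechet_derivative_mult_real]) auto
  qed
  then show ?case using Suc.prems by auto
qed

lemma Ck_on_const: "Ck_on k (\<lambda>x. c) S"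
proof (induction k arbitrary: c)
  case (Suc k)
  have "frechet_derivative (\<lambda>x. c) (at x) v = 0" for x :: 'a and v
    using frechet_derivative_const by metis
  then show ?case using Suc[of 0] by simp
qed simp

lemma Ck_on_inverse:
  fixes f :: "'a::euclidean_space \<Rightarrow> real"
  assumes "open S" and nz: "\<And>x. x \<in> S \<Longrightarrow> f x \<noteq> 0"
  shows "Ck_on k f S \<Longrightarrow> Ck_on k (\<lambda>x. inverse (f x)) S"
proof (induction k)
  case 0
  then show ?case using nz by (simp add: continuous_on_inverse)
next
  case (Suc k)
  have D: "((\<lambda>x. inverse (f x)) has_derivative
     (\<lambda>v. - (inverse (f x) * frechet_derivative f (at x) v * inverse (f x)))) (at x)" if "x \<in> S" for x
    using nz[OF that] Suc.prems that
    by (intro Deriv.has_derivative_inverse) (simp_all add: frechet_derivative_works[symmetric])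
  have "Ck_on k (\<lambda>x. frechet_derivative (\<lambda>x. inverse (f x)) (at x) v) S" for v
  proof -
    have "Ck_on k (\<lambda>x. (-1) * (inverse (f x) * frechet_derivative f (at x) v * inverse (f x))) S"
      using Suc Ck_on_Suc_imp[OF Suc.prems]
      by (intro Ck_on_mult[OF assms(1)] Ck_on_const) auto
    moreover have "frechet_derivative (\<lambda>x. inverse (f x)) (at x) v
       = (-1) * (inverse (f x) * frechet_derivative f (at x) v * inverse (f x))" if "x \<in> S" for x
      using frechet_derivative_at[OF D[OF that]] by (metis mult_minus1)
    ultimately show ?thesis
      by (subst Ck_on_cong[OF assms(1)]) auto
  qed
  then show ?case using D by (auto simp: differentiable_def)
qed

text \<open>
  All iterated directional derivatives of order at most \<open>k\<close> are bounded on the whole space, by \<open>M\<close>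
  times the product of the norms of the directions. Homogeneity in the directions lets a single
  constant control all of them, which is what term-by-term differentiation of a series needs.
\<close>

fun deriv_bounded :: "nat \<Rightarrow> real \<Rightarrow> ('a::euclidean_space \<Rightarrow> real) \<Rightarrow> bool" where
  "deriv_bounded 0 M f \<longleftrightarrow> continuous_on UNIV f \<and> (\<forall>x. \<bar>f x\<bar> \<le> M)"
| "deriv_bounded (Suc k) M f \<longleftrightarrow> (\<forall>x. f differentiable (at x)) \<and> (\<forall>x. \<bar>f x\<bar> \<le> M) \<and>
     (\<forall>v. deriv_bounded k (M * norm v) (\<lambda>x. frechet_derivative f (at x) v))"

lemma deriv_bounded_bound: "deriv_bounded k M f \<Longrightarrow> \<bar>f x\<bar> \<le> M"
  by (cases k) auto

lemma deriv_bounded_mono: "deriv_bounded k M f \<Longrightarrow> M \<le> N \<Longrightarrow> deriv_bounded k N f"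
proof (induction k arbitrary: f M N)
  case (Suc k)
  have "deriv_bounded k (N * norm v) (\<lambda>x. frechet_derivative f (at x) v)" for v
    by (rule Suc.IH[OF _ mult_right_mono[OF Suc.prems(2) norm_ge_zero]]) (use Suc.prems(1) in simp)
  moreover have "\<bar>f x\<bar> \<le> N" for x
    using Suc.prems by (auto intro: order_trans)
  ultimately show ?case using Suc.prems by simp
qed (auto intro: order_trans)

lemma deriv_bounded_Suc: "deriv_bounded (Suc k) M f \<Longrightarrow> deriv_bounded k M f"
proof (induction k arbitrary: f M)
  case 0
  then show ?case
    by (auto intro!: continuous_at_imp_continuous_on differentiable_imp_continuous_within)
next
  case (Suc k)
  then show ?case by (metis deriv_bounded.simps(2))
qed

lemma deriv_bounded_add:
  "deriv_bounded k M f \<Longrightarrow> deriv_bounded k N g \<Longrightarrow> deriv_bounded k (M + N) (\<lambda>x. f x + g x)"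
proof (induction k arbitrary: f g M N)
  case 0
  have "\<bar>f x + g x\<bar> \<le> M + N" for x
    using 0 abs_triangle_ineq[of "f x" "g x"] by (smt (verit) deriv_bounded_bound)
  then show ?case using 0 by (simp add: continuous_on_add)
next
  case (Suc k)
  have "frechet_derivative (\<lambda>x. f x + g x) (at x) v
      = frechet_derivative f (at x) v + frechet_derivative g (at x) v" for x v
    using Suc.prems by (intro frechet_derivative_add_at) auto
  moreover have "deriv_bounded k (M * norm v + N * norm v)
      (\<lambda>x. frechet_derivative f (at x) v + frechet_derivative g (at x) v)" for v
    using Suc by simp
  moreover have "\<bar>f x + g x\<bar> \<le> M + N" for x
    using Suc.prems abs_triangle_ineq[of "f x" "g x"] by (smt (verit) deriv_bounded_bound)
  ultimately show ?case using Suc.prems by (auto simp: algebra_simps)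
qed

lemma deriv_bounded_mult:
  "deriv_bounded k M f \<Longrightarrow> deriv_bounded k N g \<Longrightarrow> deriv_bounded k (2 ^ k * M * N) (\<lambda>x. f x * g x)"
proof (induction k arbitrary: f g M N)
  case 0
  then show ?case
    by (auto simp: abs_mult intro!: continuous_on_mult mult_mono intro: order_trans[OF abs_ge_zero])
next
  case (Suc k)
  have M: "M \<ge> 0" "N \<ge> 0"
    using Suc.prems by (meson abs_ge_zero deriv_bounded_bound order_trans)+
  have "frechet_derivative (\<lambda>x. f x * g x) (at x) v
      = f x * frechet_derivative g (at x) v + frechet_derivative f (at x) v * g x" for x v
    using Suc.prems by (intro frechet_derivative_mult_real) auto
  moreover have "deriv_bounded k (2 ^ k * M * (N * norm v) + 2 ^ k * (M * norm v) * N)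
      (\<lambda>x. f x * frechet_derivative g (at x) v + frechet_derivative f (at x) v * g x)" for v
    using Suc.prems deriv_bounded_Suc[OF Suc.prems(1)] deriv_bounded_Suc[OF Suc.prems(2)]
    by (intro deriv_bounded_add Suc.IH) simp_all
  then have "deriv_bounded k (2 ^ Suc k * M * N * norm v)
      (\<lambda>x. f x * frechet_derivative g (at x) v + frechet_derivative f (at x) v * g x)" for v
    by (rule deriv_bounded_mono) (simp add: algebra_simps)
  moreover have "\<bar>f x * g x\<bar> \<le> 2 ^ Suc k * M * N" for x
  proof -
    have "\<bar>f x * g x\<bar> \<le> M * N"
      using Suc.prems M unfolding abs_mult by (intro mult_mono) auto
    also have "1 * (M * N) \<le> 2 ^ Suc k * (M * N)"
      using M by (intro mult_right_mono one_le_power) auto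
    then have "M * N \<le> 2 ^ Suc k * M * N" by (simp add: mult.assoc)
    finally show ?thesis .
  qed
  ultimately show ?case using Suc.prems by (auto simp del: power_Suc)
qed

lemma deriv_bounded_const: "deriv_bounded k \<bar>c\<bar> (\<lambda>x. c)"
proof (induction k arbitrary: c)
  case (Suc k)
  have "frechet_derivative (\<lambda>x. c) (at x) v = 0" for x :: 'a and v
    using frechet_derivative_const by metis
  moreover have "deriv_bounded k (\<bar>c\<bar> * norm v) (\<lambda>x::'a. 0)" for v :: 'a
    by (rule deriv_bounded_mono[OF Suc]) auto
  ultimately show ?case by simp
qed simp

lemma deriv_bounded_scale: "deriv_bounded k M f \<Longrightarrow> deriv_bounded k (\<bar>c\<bar> * M) (\<lambda>x. c * f x)"
proof (induction k arbitrary: f M)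
  case 0
  then show ?case by (auto simp: abs_mult intro!: mult_left_mono continuous_on_mult_left)
next
  case (Suc k)
  have "frechet_derivative (\<lambda>x. c * f x) (at x) v = c * frechet_derivative f (at x) v" for x v
    using Suc.prems frechet_derivative_mult_real[of "\<lambda>x. c" x f v]
      fun_cong[OF frechet_derivative_const[of c x], of v] by auto
  moreover have "deriv_bounded k (\<bar>c\<bar> * M * norm v) (\<lambda>x. c * frechet_derivative f (at x) v)" for v
    using Suc.prems Suc.IH[of "M * norm v" "\<lambda>x. frechet_derivative f (at x) v"] by (simp add: mult.assoc)
  ultimately show ?case
    using Suc.prems by (auto simp: abs_mult intro!: mult_left_mono)
qed

lemma deriv_bounded_prod:
  assumes "finite I" "\<And>i. i \<in> I \<Longrightarrow> \<exists>M. deriv_bounded k M (F i)"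
  shows "\<exists>M. deriv_bounded k M (\<lambda>x. \<Prod>i\<in>I. F i x)"
  using assms
proof (induction I rule: finite_induct)
  case empty
  then show ?case using deriv_bounded_const[of k 1] by auto
next
  case (insert i I)
  then obtain N where N: "deriv_bounded k N (\<lambda>x. \<Prod>i\<in>I. F i x)" by blast
  obtain M where M: "deriv_bounded k M (F i)" using insert.prems by blast
  show ?case using deriv_bounded_mult[OF M N] insert.hyps by auto
qed

text \<open>
  Differentiation term by term: the derivatives in direction \<open>v\<close> are again a series of the same
  kind with the summable bounds \<open>M i * norm v\<close>, so the order can be raised by induction.
\<close>

lemma Ck_on_suminf:
  fixes f :: "nat \<Rightarrow> 'a::euclidean_space \<Rightarrow> real"
  assumes "\<And>i. deriv_bounded k (M i) (f i)" "summable M"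
  shows "Ck_on k (\<lambda>x. \<Sum>i. f i x) UNIV"
  using assms
proof (induction k arbitrary: f M)
  case 0
  have "uniform_limit UNIV (\<lambda>n x. \<Sum>i<n. f i x) (\<lambda>x. \<Sum>i. f i x) sequentially"
    using 0 by (intro Weierstrass_m_test[of _ _ M]) auto
  then have "continuous_on UNIV (\<lambda>x. \<Sum>i. f i x)"
    using 0 by (intro uniform_limit_theorem) (auto intro!: continuous_on_sum always_eventually)
  then show ?case by simp
next
  case (Suc k)
  define f' where "f' i x = frechet_derivative (f i) (at x)" for i x
  define g' where "g' x h = (\<Sum>i. f' i x h)" for x h
  have b: "\<bar>f' i x h\<bar> \<le> M i * norm h" for i x h
    using Suc.prems(1)[of i] deriv_bounded_bound[of k "M i * norm h" "\<lambda>x. f' i x h"] by (auto simp: f'_def)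
  have sM: "summable (\<lambda>i. M i * norm h)" for h :: 'a
    using Suc.prems(2) by (rule summable_mult2)
  have s': "summable (\<lambda>i. f' i x h)" for x h
    using b by (intro summable_comparison_test'[OF sM]) auto
  have s: "summable (\<lambda>i. f i x)" for x
    using deriv_bounded_bound[OF Suc.prems(1)] by (intro summable_comparison_test'[OF Suc.prems(2)]) auto
  have D: "((\<lambda>x. \<Sum>i. f i x) has_derivative g' x) (at x)" for x
  proof -
    have "\<exists>g. \<forall>x\<in>UNIV. (\<lambda>n. f n x) sums (g x) \<and> (g has_derivative g' x) (at x within UNIV)"
    proof (rule has_derivative_series)
      show "(f n has_derivative f' n x) (at x within UNIV)" for n x
        using Suc.prems(1)[of n] by (simp add: f'_def frechet_derivative_works[symmetric])
      show "(\<lambda>n. f n 0) sums (\<Sum>i. f i 0)" using s by (rule summable_sums)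
      show "\<forall>\<^sub>F n in sequentially. \<forall>x\<in>UNIV. \<forall>h. norm ((\<Sum>i<n. f' i x h) - g' x h) \<le> e * norm h"
        if "e > 0" for e
      proof -
        have "(\<lambda>n. (\<Sum>i<n. M i)) \<longlonglongrightarrow> suminf M"
          using Suc.prems(2) by (rule summable_LIMSEQ)
        then have "\<forall>\<^sub>F n in sequentially. dist (\<Sum>i<n. M i) (suminf M) < e"
          using that by (rule tendstoD)
        then show ?thesis
        proof eventually_elim
          case (elim n)
          show ?case
          proof (intro ballI allI)
            fix x h
            have "g' x h - (\<Sum>i<n. f' i x h) = (\<Sum>i. f' (i + n) x h)"
              unfolding g'_def by (subst suminf_split_initial_segment[OF s', of _ _ n]) simp
            also have "norm \<dots> \<le> (\<Sum>i. M (i + n) * norm h)"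
              using b summable_ignore_initial_segment[OF sM] by (intro norm_suminf_le) auto
            also have "\<dots> = (\<Sum>i. M (i + n)) * norm h"
              using Suc.prems(2) by (intro suminf_mult2[symmetric]) (simp add: summable_iff_shift)
            also have "(\<Sum>i. M (i + n)) = suminf M - (\<Sum>i<n. M i)"
              using suminf_split_initial_segment[OF Suc.prems(2), of n] by simp
            also have "\<dots> * norm h \<le> e * norm h"
              using elim by (intro mult_right_mono) (auto simp: dist_real_def)
            finally show "norm ((\<Sum>i<n. f' i x h) - g' x h) \<le> e * norm h"
              by (simp add: norm_minus_commute)
          qed
        qed
      qed
    qed auto
    then obtain g where g: "\<And>x. (\<lambda>n. f n x) sums (g x)" "\<And>x. (g has_derivative g' x) (at x)"
      by auto
    then have "g = (\<lambda>x. \<Sum>i. f i x)" using sums_unique by blast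
    with g(2) show ?thesis by simp
  qed
  have "frechet_derivative (\<lambda>x. \<Sum>i. f i x) (at x) v = g' x v" for x v
    using frechet_derivative_at[OF D] by metis
  moreover have "Ck_on k (\<lambda>x. g' x v) UNIV" for v
    unfolding g'_def
    using Suc.prems(1) by (intro Suc.IH[OF _ sM[of v]]) (auto simp: f'_def)
  moreover have "(\<lambda>x. \<Sum>i. f i x) differentiable (at x)" for x
    using D[of x] by (rule differentiableI)
  ultimately show ?case by simp
qed

text \<open>
  For \<open>p = 1\<close> this is the classical function that is smooth but flat at zero. The polynomial factor
  makes the family closed under differentiation.
\<close>

definition flat_exp :: "real poly \<Rightarrow> real \<Rightarrow> real" where
  "flat_exp p t = (if t \<le> 0 then 0 else poly p (1 / t) * exp (- (1 / t)))"

lemma poly_exp_tendsto_0: "((\<lambda>s. poly p s * exp (- s)) \<longlongrightarrow> (0::real)) at_top"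
proof -
  have "((\<lambda>s. \<Sum>i\<le>degree p. coeff p i * (s ^ i / exp s)) \<longlongrightarrow> (\<Sum>i\<le>degree p. coeff p i * 0)) at_top"
    by (intro tendsto_intros tendsto_power_div_exp_0)
  moreover have "(\<Sum>i\<le>degree p. coeff p i * (s ^ i / exp s)) = poly p s * exp (- s)" for s
    by (simp add: poly_altdef sum_distrib_right exp_minus divide_inverse mult.assoc)
  ultimately show ?thesis by simp
qed

lemma flat_exp_DERIV:
  "(flat_exp p has_real_derivative flat_exp ([:0, 0, 1:] * (p - pderiv p)) t) (at t)"
proof -
  consider "t < 0" | "t = 0" | "t > 0" by linarith
  then show ?thesis
  proof cases
    case 1
    have "((\<lambda>t. 0) has_real_derivative 0) (at t)" by simp
    then have "(flat_exp p has_real_derivative 0) (at t)"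
      by (rule has_field_derivative_transform_within_open[where S = "{..<0}"])
        (use 1 in \<open>auto simp: flat_exp_def\<close>)
    with 1 show ?thesis by (simp add: flat_exp_def)
  next
    case 3
    have "((\<lambda>t. poly p (1 / t) * exp (- (1 / t))) has_real_derivative
      flat_exp ([:0, 0, 1:] * (p - pderiv p)) t) (at t)"
      using 3 by (auto intro!: derivative_eq_intros DERIV_chain2[OF poly_DERIV]
        simp: flat_exp_def field_simps power2_eq_square)
    then show ?thesis
      by (rule has_field_derivative_transform_within_open[where S = "{0<..}"])
        (use 3 in \<open>auto simp: flat_exp_def\<close>)
  next
    case 2
    have "((\<lambda>h. poly (p * [:0, 1:]) (inverse h) * exp (- inverse h)) \<longlongrightarrow> 0) (at_right 0)"
      by (rule filterlim_compose[OF poly_exp_tendsto_0 filterlim_inverse_at_top_right])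
    then have r: "((\<lambda>h. flat_exp p h / h) \<longlongrightarrow> 0) (at_right 0)"
      by (rule Lim_transform_eventually)
        (auto simp: eventually_at_right_less flat_exp_def field_simps
          intro: eventually_mono[OF eventually_at_right_less])
    have l: "((\<lambda>h. flat_exp p h / h) \<longlongrightarrow> 0) (at_left 0)"
      by (rule tendsto_eventually)
        (auto simp: flat_exp_def eventually_at_left_field intro!: exI[of _ "-1"])
    have "((\<lambda>h. flat_exp p h / h) \<longlongrightarrow> 0) (at 0)"
      using l r by (simp add: filterlim_split_at)
    then show ?thesis
      using 2 by (simp add: has_field_derivative_iff flat_exp_def)
  qed
qed

lemma flat_exp_bounded: "\<exists>B. \<forall>t. \<bar>flat_exp p t\<bar> \<le> B"
proof -
  define u where "u s = poly p s * exp (- s)" for s :: real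
  have "\<forall>\<^sub>F s in at_top. dist (u s) 0 < 1"
    unfolding u_def by (rule tendstoD[OF poly_exp_tendsto_0]) simp
  then obtain N where N: "\<And>s. s \<ge> N \<Longrightarrow> \<bar>u s\<bar> \<le> 1"
    by (force simp: eventually_at_top_linorder)
  have "compact (u ` {0..N})"
    unfolding u_def by (intro compact_continuous_image continuous_intros) auto
  then obtain C where C: "\<And>s. s \<in> {0..N} \<Longrightarrow> \<bar>u s\<bar> \<le> C"
    using compact_imp_bounded by (metis (no_types, lifting) bounded_iff imageI real_norm_def)
  have "\<bar>flat_exp p t\<bar> \<le> max 1 (max C 0)" for t
  proof (cases "t \<le> 0")
    case False
    then have "1 / t \<ge> N \<or> 1 / t \<in> {0..N}" by auto
    then have "\<bar>u (1 / t)\<bar> \<le> max 1 (max C 0)" using N C by fastforce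
    then show ?thesis using False by (simp add: flat_exp_def u_def)
  qed (simp add: flat_exp_def)
  then show ?thesis by blast
qed

text \<open>
  Composing with a linear functional of norm at most one does not increase derivatives, and each
  function of the family is bounded on the whole line.
\<close>

lemma deriv_bounded_flat_exp:
  fixes w :: "'a::euclidean_space"
  assumes "norm w \<le> 1"
  shows "\<exists>M. deriv_bounded k M (\<lambda>x. flat_exp p (x \<bullet> w + a))"
proof (induction k arbitrary: p)
  case 0
  have "continuous_on UNIV (flat_exp p)"
    using DERIV_isCont[OF flat_exp_DERIV] by (simp add: continuous_at_imp_continuous_on)
  then have "continuous_on UNIV (\<lambda>x. flat_exp p (x \<bullet> w + a))"
    by (rule continuous_on_compose2) (auto intro!: continuous_intros)
  then show ?case using flat_exp_bounded[of p] by auto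
next
  case (Suc k)
  define q where "q = [:0, 0, 1:] * (p - pderiv p)"
  obtain B where B: "\<And>t. \<bar>flat_exp p t\<bar> \<le> B" using flat_exp_bounded by blast
  obtain M where M: "deriv_bounded k M (\<lambda>x. flat_exp q (x \<bullet> w + a))" using Suc by blast
  have M0: "M \<ge> 0" using deriv_bounded_bound[OF M] by (meson abs_ge_zero order_trans)
  have D: "((\<lambda>x. flat_exp p (x \<bullet> w + a)) has_derivative (\<lambda>v. (v \<bullet> w) * flat_exp q (x \<bullet> w + a))) (at x)" for x
  proof -
    have "((\<lambda>x. x \<bullet> w + a) has_derivative (\<lambda>v. v \<bullet> w)) (at x)"
      by (auto intro!: derivative_eq_intros)
    from has_derivative_compose[OF this, of "flat_exp p" "(*) (flat_exp q (x \<bullet> w + a))"]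
    show ?thesis
      using flat_exp_DERIV[of p "x \<bullet> w + a"]
      by (simp add: q_def mult.commute has_field_derivative_def)
  qed
  have "frechet_derivative (\<lambda>x. flat_exp p (x \<bullet> w + a)) (at x) v = (v \<bullet> w) * flat_exp q (x \<bullet> w + a)" for x v
    using frechet_derivative_at[OF D] by metis
  moreover have "deriv_bounded k (max B M * norm v) (\<lambda>x. (v \<bullet> w) * flat_exp q (x \<bullet> w + a))" for v
  proof (rule deriv_bounded_mono[OF deriv_bounded_scale[OF M]])
    have "\<bar>v \<bullet> w\<bar> \<le> norm v * norm w" by (rule Cauchy_Schwarz_ineq2)
    also have "\<dots> \<le> norm v" using assms by (simp add: mult_left_le)
    finally have "\<bar>v \<bullet> w\<bar> * M \<le> norm v * M" using M0 by (rule mult_right_mono)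
    also have "\<dots> \<le> max B M * norm v" by (metis max.cobounded2 mult.commute mult_right_mono norm_ge_zero)
    finally show "\<bar>v \<bullet> w\<bar> * M \<le> max B M * norm v" .
  qed
  moreover have "\<bar>flat_exp p (x \<bullet> w + a)\<bar> \<le> max B M" for x using B by (meson max.coboundedI1)
  moreover have "(\<lambda>x. flat_exp p (x \<bullet> w + a)) differentiable (at x)" for x
    using D by (auto simp: differentiable_def)
  ultimately have "deriv_bounded (Suc k) (max B M) (\<lambda>x. flat_exp p (x \<bullet> w + a))" by simp
  then show ?case by blast
qed

text \<open>
  A product of one-sided bumps in the coordinates, two for each: its derivatives stay globally
  bounded because every factor is a function of a linear functional.
\<close>

lemma box_bump:
  fixes a b :: "'a::euclidean_space"
  shows "\<exists>\<phi>. (\<forall>k. \<exists>M. deriv_bounded k M \<phi>) \<and> (\<forall>x. 0 \<le> \<phi> x) \<and> (\<forall>x. 0 < \<phi> x \<longleftrightarrow> x \<in> box a b)"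
proof -
  define h where "h = flat_exp 1"
  have h: "0 \<le> h t" "0 < h t \<longleftrightarrow> 0 < t" for t by (auto simp: h_def flat_exp_def)
  define \<phi> where "\<phi> x = (\<Prod>e\<in>Basis. h (x \<bullet> e + - (a \<bullet> e)) * h (x \<bullet> (- e) + b \<bullet> e))" for x :: 'a
  have "\<exists>M. deriv_bounded k M \<phi>" for k
    unfolding \<phi>_def
  proof (rule deriv_bounded_prod)
    fix e :: 'a assume "e \<in> Basis"
    then obtain M N where "deriv_bounded k M (\<lambda>x. h (x \<bullet> e + - (a \<bullet> e)))"
      "deriv_bounded k N (\<lambda>x. h (x \<bullet> (- e) + b \<bullet> e))"
      unfolding h_def using deriv_bounded_flat_exp[of e k 1 "- (a \<bullet> e)"]
        deriv_bounded_flat_exp[of "- e" k 1 "b \<bullet> e"] by auto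
    then show "\<exists>M. deriv_bounded k M (\<lambda>x. h (x \<bullet> e + - (a \<bullet> e)) * h (x \<bullet> (- e) + b \<bullet> e))"
      using deriv_bounded_mult by blast
  qed simp
  moreover have nn: "0 \<le> \<phi> x" for x unfolding \<phi>_def by (intro prod_nonneg) (simp add: h)
  moreover have "0 < \<phi> x \<longleftrightarrow> x \<in> box a b" for x
  proof -
    have "0 < \<phi> x \<longleftrightarrow> \<phi> x \<noteq> 0" using nn[of x] by linarith
    also have "\<dots> \<longleftrightarrow> (\<forall>e\<in>Basis. h (x \<bullet> e + - (a \<bullet> e)) \<noteq> 0 \<and> h (x \<bullet> (- e) + b \<bullet> e) \<noteq> 0)"
      by (auto simp: \<phi>_def)
    also have "\<dots> \<longleftrightarrow> (\<forall>e\<in>Basis. a \<bullet> e < x \<bullet> e \<and> x \<bullet> e < b \<bullet> e)"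
      using h by (smt (verit) inner_minus_right)
    finally show ?thesis by (simp add: mem_box)
  qed
  ultimately show ?thesis by blast
qed

text \<open>
  Whitney's theorem on zero sets. An open set is a countable union of boxes, and the bumps of the boxes
  are added with weights that decrease so fast that for every order \<open>k\<close> almost all terms have
  derivatives up to order \<open>k\<close> bounded by \<open>(1/2) ^ i\<close>.
\<close>

lemma open_set_smooth_positivity_set:
  fixes O' :: "'a::euclidean_space set"
  assumes "open O'"
  obtains \<phi> :: "'a \<Rightarrow> real"
  where "smooth_on \<phi> UNIV" "\<And>x. 0 \<le> \<phi> x" "\<And>x. 0 < \<phi> x \<longleftrightarrow> x \<in> O'"
proof -
  obtain \<D> where D: "countable \<D>" "\<And>X. X \<in> \<D> \<Longrightarrow> \<exists>a b. X = box a b" "\<Union>\<D> = O'"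
    using open_countable_Union_open_box[OF assms] by metis
  \<comment> \<open>the empty box makes the family nonempty, so that it can be enumerated\<close>
  define \<D>' where "\<D>' = insert {} \<D>"
  have D': "countable \<D>'" "\<D>' \<noteq> {}" "\<Union>\<D>' = O'" using D by (auto simp: \<D>'_def)
  have "\<exists>a b. X = box a b" if "X \<in> \<D>'" for X
    using that D(2) box_idem[of "0::'a"] unfolding \<D>'_def by blast
  then have bump: "\<exists>\<phi>. (\<forall>k. \<exists>M. deriv_bounded k M \<phi>) \<and> (\<forall>x. 0 \<le> \<phi> x) \<and>
      (\<forall>x. 0 < \<phi> x \<longleftrightarrow> x \<in> from_nat_into \<D>' i)" for i
    using box_bump from_nat_into[OF D'(2)] by metis
  define b where "b i = (SOME \<phi>. (\<forall>k. \<exists>M. deriv_bounded k M \<phi>) \<and> (\<forall>x. 0 \<le> \<phi> x) \<and>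
      (\<forall>x. 0 < \<phi> x \<longleftrightarrow> x \<in> from_nat_into \<D>' i))" for i
  have b: "\<exists>M. deriv_bounded k M (b i)" "0 \<le> b i x" "0 < b i x \<longleftrightarrow> x \<in> from_nat_into \<D>' i" for i k x
    using someI_ex[OF bump[of i], folded b_def] by simp_all
  define C where "C i k = (SOME M. deriv_bounded k M (b i))" for i k
  have C: "deriv_bounded k (C i k) (b i)" for i k
    unfolding C_def using b(1) by (rule someI_ex)
  have C0: "0 \<le> C i k" for i k using deriv_bounded_bound[OF C] by (meson abs_ge_zero order_trans)
  define a where "a i = (1/2) ^ i / (1 + (\<Sum>k\<le>i. C i k))" for i
  have pos: "1 + (\<Sum>k\<le>i. C i k) > 0" for i by (smt (verit) C0 sum_nonneg)
  have a0: "a i > 0" for i using pos[of i] by (simp add: a_def)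
  have aC: "a i * C i k \<le> (1/2) ^ i" if "k \<le> i" for i k
  proof -
    have "C i k \<le> (\<Sum>k\<le>i. C i k)" using that C0 by (intro member_le_sum) auto
    then have "C i k / (1 + (\<Sum>k\<le>i. C i k)) \<le> 1" using pos[of i] by simp
    from mult_left_mono[OF this, of "(1/2) ^ i"] show ?thesis by (simp add: a_def)
  qed
  define \<phi> where "\<phi> x = (\<Sum>i. a i * b i x)" for x
  have db: "deriv_bounded k (a i * C i k) (\<lambda>x. a i * b i x)" for i k
    using deriv_bounded_scale[OF C[of k i], of "a i"] a0[of i] by simp
  have sm: "summable (\<lambda>i. a i * C i k)" for k
  proof (rule summable_comparison_test_ev)
    have "norm (a i * C i k) \<le> (1/2) ^ i" if "k \<le> i" for i
      using aC[OF that] a0[of i] C0[of i k] by (simp add: abs_mult)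
    then show "\<forall>\<^sub>F i in sequentially. norm (a i * C i k) \<le> (1/2) ^ i"
      by (rule eventually_sequentiallyI)
  qed simp
  have "Ck_on k \<phi> UNIV" for k
    unfolding \<phi>_def using db sm by (rule Ck_on_suminf)
  then have 1: "smooth_on \<phi> UNIV" by (simp add: smooth_on_def)
  have s: "summable (\<lambda>i. a i * b i x)" for x
    using deriv_bounded_bound[OF db] by (intro summable_comparison_test'[OF sm[of 0]]) auto
  have nn: "0 \<le> a i * b i x" for i x using a0[of i] b(2)[of i x] by simp
  have 2: "0 \<le> \<phi> x" for x unfolding \<phi>_def using nn by (intro suminf_nonneg s)
  have 3: "0 < \<phi> x \<longleftrightarrow> x \<in> O'" for x
  proof -
    have "0 < \<phi> x \<longleftrightarrow> (\<exists>i. 0 < a i * b i x)"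
      unfolding \<phi>_def using suminf_pos_iff[OF s] nn by blast
    also have "\<dots> \<longleftrightarrow> (\<exists>i. x \<in> from_nat_into \<D>' i)"
      using a0 b(3) by (metis zero_less_mult_pos mult_pos_pos)
    also have "\<dots> \<longleftrightarrow> x \<in> O'"
      using D' range_from_nat_into[OF D'(2,1)] by (metis UnionE UnionI rangeE rangeI)
    finally show ?thesis .
  qed
  from 1 2 3 show thesis by (rule that)
qed

section \<open>Round cones in a continuous metric\<close>

lemma bilinear_expand:
  fixes h :: "'a::euclidean_space \<Rightarrow> 'a \<Rightarrow> real"
  assumes "bilinear h"
  shows "h v w = (\<Sum>i\<in>Basis. \<Sum>j\<in>Basis. (v \<bullet> i) * (w \<bullet> j) * h i j)"
proof -
  have "h v w = h (\<Sum>i\<in>Basis. (v \<bullet> i) *\<^sub>R i) (\<Sum>j\<in>Basis. (w \<bullet> j) *\<^sub>R j)"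
    by (simp add: euclidean_representation)
  also have "\<dots> = (\<Sum>(i, j)\<in>Basis \<times> Basis. h ((v \<bullet> i) *\<^sub>R i) ((w \<bullet> j) *\<^sub>R j))"
    by (rule bilinear_sum[OF assms])
  also have "\<dots> = (\<Sum>i\<in>Basis. \<Sum>j\<in>Basis. (v \<bullet> i) * (w \<bullet> j) * h i j)"
    by (simp add: sum.cartesian_product bilinear_lmul[OF assms] bilinear_rmul[OF assms] mult.assoc mult.left_commute)
  finally show ?thesis .
qed

lemma continuous_on_bilinear_family:
  fixes h :: "'b::topological_space \<Rightarrow> 'a::euclidean_space \<Rightarrow> 'a \<Rightarrow> real"
  assumes "\<And>x. x \<in> X \<Longrightarrow> bilinear (h x)" "\<And>v w. continuous_on X (\<lambda>x. h x v w)"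
  shows "continuous_on (X \<times> UNIV) (\<lambda>(x, v). h x v v)"
proof -
  have "continuous_on (X \<times> UNIV) (\<lambda>p. \<Sum>i\<in>Basis. \<Sum>j\<in>Basis. (snd p \<bullet> i) * (snd p \<bullet> j) * h (fst p) i j)"
    by (intro continuous_intros continuous_on_compose2[OF assms(2)]) auto
  then show ?thesis
    by (rule continuous_on_eq) (auto simp: bilinear_expand[OF assms(1), symmetric])
qed

lemma continuous_on_linear_family:
  fixes l :: "'b::topological_space \<Rightarrow> 'a::euclidean_space \<Rightarrow> real"
  assumes "\<And>x. x \<in> X \<Longrightarrow> linear (l x)" "\<And>v. continuous_on X (\<lambda>x. l x v)"
  shows "continuous_on (X \<times> UNIV) (\<lambda>(x, v). l x v)"
proof -
  have cont: "continuous_on (X \<times> UNIV) (\<lambda>p. \<Sum>i\<in>Basis. (snd p \<bullet> i) * l (fst p) i)"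
    by (intro continuous_intros continuous_on_compose2[OF assms(2)]) auto
  have expand: "(\<Sum>i\<in>Basis. (v \<bullet> i) * l x i) = l x v" if "x \<in> X" for x v
  proof -
    have "l x v = l x (\<Sum>i\<in>Basis. (v \<bullet> i) *\<^sub>R i)" by (simp add: euclidean_representation)
    then show ?thesis by (simp add: linear_sum[OF assms(1)[OF that]] linear_cmul[OF assms(1)[OF that]])
  qed
  show ?thesis by (rule continuous_on_eq[OF cont]) (auto simp: expand)
qed

text \<open>
  A maximal orthonormal set is a basis, since otherwise one more vector could be split off; mapping it
  to the standard basis is the isometry.
\<close>

lemma inner_product_isometry:
  fixes G :: "'a::euclidean_space \<Rightarrow> 'a \<Rightarrow> real"
  assumes bil: "bilinear G" and sym: "\<And>v w. G v w = G w v" and pos: "\<And>v. v \<noteq> 0 \<Longrightarrow> 0 < G v v"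
  obtains S :: "'a \<Rightarrow> 'a" where "linear S" "bij S" "\<And>v w. G v w = S v \<bullet> S w"
proof -
  have lin1: "linear (\<lambda>v. G v w)" and lin2: "linear (G v)" for v w
    using bil by (simp_all add: bilinear_def)
  define orth where "orth B \<longleftrightarrow> finite B \<and> (\<forall>b\<in>B. G b b = 1) \<and> (\<forall>a\<in>B. \<forall>b\<in>B. a \<noteq> b \<longrightarrow> G a b = 0)" for B
  have sum_B: "G (\<Sum>b\<in>B. u b *\<^sub>R b) a = u a" if "orth B" "a \<in> B" for B u a
  proof -
    have "G (\<Sum>b\<in>B. u b *\<^sub>R b) a = (\<Sum>b\<in>B. u b * G b a)"
      by (simp add: linear_sum[OF lin1] linear_cmul[OF lin1])
    also have "\<dots> = (\<Sum>b\<in>B. if b = a then u b else 0)"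
      using that by (intro sum.cong) (auto simp: orth_def)
    also have "\<dots> = u a" using that by (simp add: orth_def)
    finally show ?thesis .
  qed
  have indep: "independent B" if oB: "orth B" for B
  proof
    assume "dependent B"
    then obtain u b where "b \<in> B" "u b \<noteq> 0" "(\<Sum>b\<in>B. u b *\<^sub>R b) = 0"
      using oB dependent_finite[of B] by (auto simp: orth_def)
    then show False using sum_B[OF oB, of b u] linear_0[OF lin1] by simp
  qed
  have "\<exists>B. orth B \<and> (\<forall>B'. orth B' \<longrightarrow> card B' \<le> card B)"
  proof (rule ex_has_greatest_nat[of orth "{}" card "Suc DIM('a)"])
    show "orth {}" by (simp add: orth_def)
    show "\<forall>B. orth B \<longrightarrow> card B < Suc DIM('a)"
    proof (intro allI impI)
      fix B assume "orth B"
      from independent_bound[OF indep[OF this]] show "card B < Suc DIM('a)" by simp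
    qed
  qed
  then obtain B where B: "orth B" "\<And>B'. orth B' \<Longrightarrow> card B' \<le> card B" by blast
  have expand: "v = (\<Sum>b\<in>B. G v b *\<^sub>R b)" for v
  proof (rule ccontr)
    define u where "u = v - (\<Sum>b\<in>B. G v b *\<^sub>R b)"
    assume "v \<noteq> (\<Sum>b\<in>B. G v b *\<^sub>R b)"
    then have u: "0 < G u u" by (intro pos) (simp add: u_def)
    have perp: "G u b = 0" if "b \<in> B" for b
      by (simp add: u_def linear_diff[OF lin1] sum_B[OF B(1) that])
    define b' where "b' = u /\<^sub>R sqrt (G u u)"
    have "G b' b' = inverse (sqrt (G u u)) * (inverse (sqrt (G u u)) * G u u)"
      by (simp add: b'_def linear_cmul[OF lin1] linear_cmul[OF lin2])
    also have "\<dots> = 1"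
      using u by (simp add: divide_simps power2_eq_square[symmetric] mult.assoc[symmetric])
    finally have b': "G b' b' = 1" .
    have perp': "G b' b = 0" "G b b' = 0" if "b \<in> B" for b
      using perp[OF that] sym[of b b'] by (simp_all add: b'_def linear_cmul[OF lin1])
    have "b' \<notin> B" using perp'(1) b' by fastforce
    moreover have "orth (insert b' B)"
      using B(1) b' perp' unfolding orth_def by auto
    ultimately show False using B(2)[of "insert b' B"] B(1) by (simp add: orth_def)
  qed
  have "span B = UNIV"
    using expand by (metis (no_types, lifting) UNIV_eq_I span_base span_scale span_sum)
  then have "card B = DIM('a)"
    using indep[OF B(1)] by (metis dim_UNIV dim_span_eq_card_independent)
  then obtain \<beta> where \<beta>: "bij_betw \<beta> (Basis :: 'a set) B"
    using finite_same_card_bij[of Basis B] B(1) by (auto simp: orth_def)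
  define S where "S v = (\<Sum>e\<in>Basis. G v (\<beta> e) *\<^sub>R e)" for v
  have S: "linear S"
    unfolding S_def
    by (rule linearI) (simp_all add: linear_add[OF lin1] linear_cmul[OF lin1] scaleR_left_distrib sum.distrib scaleR_sum_right)
  have iso: "G v w = S v \<bullet> S w" for v w
  proof -
    have "G v w = G v (\<Sum>b\<in>B. G w b *\<^sub>R b)" using expand[of w] by simp
    also have "\<dots> = (\<Sum>b\<in>B. G v b * G w b)"
      by (simp add: linear_sum[OF lin2] linear_cmul[OF lin2] mult.commute)
    also have "\<dots> = (\<Sum>e\<in>Basis. G v (\<beta> e) * G w (\<beta> e))"
      by (rule sum.reindex_bij_betw[OF \<beta>, symmetric])
    also have "\<dots> = S v \<bullet> S w"
      by (simp add: S_def inner_sum_left inner_sum_right inner_Basis if_distrib mult.commute cong: if_cong)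
    finally show ?thesis .
  qed
  have "inj S"
    unfolding linear_injective_0[OF S] using iso pos by (metis inner_zero_left less_irrefl)
  then have "bij S" using linear_injective_imp_surjective[OF S] by (simp add: bij_def)
  with S iso show thesis by (intro that)
qed

text \<open>
  The metric is merely continuous in the base point, because the one it stands for arises from limits and
  improper integrals along trajectories of a flow of finite smoothness.
\<close>

locale metric_with_axis =
  fixes X :: "(real^'n) set" and G :: "real^'n \<Rightarrow> real^'n \<Rightarrow> real^'n \<Rightarrow> real" and e :: "real^'n \<Rightarrow> real^'n"
  assumes open_X: "open X"
    and bilinear_G: "\<And>x. x \<in> X \<Longrightarrow> bilinear (G x)"
    and G_commute: "\<And>x v w. x \<in> X \<Longrightarrow> G x v w = G x w v"
    and G_pos: "\<And>x v. x \<in> X \<Longrightarrow> v \<noteq> 0 \<Longrightarrow> 0 < G x v v"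
    and continuous_G: "\<And>v w. continuous_on X (\<lambda>x. G x v w)"
    and axis_unit: "\<And>x. x \<in> X \<Longrightarrow> G x (e x) (e x) = 1"
    and continuous_axis: "\<And>v. continuous_on X (\<lambda>x. G x (e x) v)"
begin

text \<open>
  In the inner product \<open>G x\<close> this is a round cone about the unit vector \<open>e x\<close>; the larger \<open>\<kappa>\<close>, the
  wider the cone, and \<open>\<kappa> = 1\<close> is the half-line spanned by the axis.
\<close>

definition axis_cone :: "real \<Rightarrow> real^'n \<Rightarrow> (real^'n) set" where
  "axis_cone \<kappa> x = {v. sqrt (G x v v) \<le> \<kappa> * G x (e x) v}"

lemma linear_axis: "x \<in> X \<Longrightarrow> linear (G x (e x))"
  using bilinear_G by (simp add: bilinear_def)

lemma G_isometry:
  assumes "x \<in> X"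
  obtains S :: "real^'n \<Rightarrow> real^'n"
  where "linear S" "bij S" "\<And>v w. G x v w = S v \<bullet> S w" "norm (S (e x)) = 1"
proof -
  obtain S :: "real^'n \<Rightarrow> real^'n" where S: "linear S" "bij S" "\<And>v w. G x v w = S v \<bullet> S w"
    using inner_product_isometry[OF bilinear_G[OF assms] G_commute[OF assms] G_pos[OF assms]] by metis
  have "norm (S (e x)) = 1" using axis_unit[OF assms] S(3)[of "e x" "e x"] by (simp add: norm_eq_1)
  with S show thesis by (rule that)
qed

lemma axis_cone_isometry:
  assumes "\<And>v w. G x v w = S v \<bullet> S w"
  shows "axis_cone \<kappa> x = {v. norm (S v) \<le> \<kappa> * (S (e x) \<bullet> S v)}"
  by (simp add: axis_cone_def assms norm_eq_sqrt_inner)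

lemma axis_cone_scale:
  assumes "x \<in> X" "0 \<le> \<alpha>" "v \<in> axis_cone \<kappa> x"
  shows "\<alpha> *\<^sub>R v \<in> axis_cone \<kappa> x"
proof -
  obtain S :: "real^'n \<Rightarrow> real^'n" where S: "linear S" "\<And>v w. G x v w = S v \<bullet> S w"
    by (rule G_isometry[OF assms(1)]) blast
  show ?thesis
    using mult_left_mono[OF _ assms(2), of "norm (S v)" "\<kappa> * (S (e x) \<bullet> S v)"] assms(2,3)
    by (simp add: axis_cone_isometry[OF S(2)] linear_cmul[OF S(1)] mult.left_commute)
qed

lemma cone_field_axis_cone:
  assumes "1 < \<kappa>"
  shows "cone_field X (axis_cone \<kappa>)"
  unfolding cone_field_def
proof (intro ballI conjI allI impI)
  fix x assume x: "x \<in> X"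
  obtain S :: "real^'n \<Rightarrow> real^'n"
    where S: "linear S" "bij S" "\<And>v w. G x v w = S v \<bullet> S w" "norm (S (e x)) = 1"
    by (rule G_isometry[OF x]) blast
  note cone = axis_cone_isometry[OF S(3)]
  have cS: "continuous_on UNIV S" using S(1) by (simp add: linear_continuous_on linear_conv_bounded_linear)
  show "closed (axis_cone \<kappa> x)"
    unfolding cone by (intro closed_Collect_le continuous_intros cS)
  have "open {v. norm (S v) < \<kappa> * (S (e x) \<bullet> S v)}"
    by (intro open_Collect_less continuous_intros cS)
  then have "{v. norm (S v) < \<kappa> * (S (e x) \<bullet> S v)} \<subseteq> interior (axis_cone \<kappa> x)"
    by (rule interior_maximal[rotated]) (auto simp: cone)
  moreover have "e x \<in> {v. norm (S v) < \<kappa> * (S (e x) \<bullet> S v)}"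
    using assms S(4) axis_unit[OF x] by (simp add: S(3))
  ultimately show "interior (axis_cone \<kappa> x) \<noteq> {}" by blast
  show "u + v \<in> axis_cone \<kappa> x" if "u \<in> axis_cone \<kappa> x" "v \<in> axis_cone \<kappa> x" for u v
  proof -
    have "norm (S (u + v)) \<le> norm (S u) + norm (S v)"
      by (simp add: linear_add[OF S(1)] norm_triangle_ineq)
    also have "\<dots> \<le> \<kappa> * (S (e x) \<bullet> S u) + \<kappa> * (S (e x) \<bullet> S v)" using that by (simp add: cone)
    also have "\<dots> = \<kappa> * (S (e x) \<bullet> S (u + v))"
      by (simp add: linear_add[OF S(1)] inner_add_right algebra_simps)
    finally show ?thesis by (simp add: cone)
  qed
  show "\<alpha> *\<^sub>R v \<in> axis_cone \<kappa> x" if "0 \<le> \<alpha>" "v \<in> axis_cone \<kappa> x" for \<alpha> v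
    using axis_cone_scale[OF x that] .
  show "axis_cone \<kappa> x \<inter> uminus ` axis_cone \<kappa> x = {0}"
  proof
    show "axis_cone \<kappa> x \<inter> uminus ` axis_cone \<kappa> x \<subseteq> {0}"
    proof
      fix v assume "v \<in> axis_cone \<kappa> x \<inter> uminus ` axis_cone \<kappa> x"
      then have "- v \<in> axis_cone \<kappa> x" "v \<in> axis_cone \<kappa> x" by auto
      then have "norm (S v) \<le> - (\<kappa> * (S (e x) \<bullet> S v))" "norm (S v) \<le> \<kappa> * (S (e x) \<bullet> S v)"
        by (simp_all add: cone linear_neg[OF S(1)])
      then have "norm (S v) \<le> 0" by linarith
      then have "S v = S 0" by (simp add: linear_0[OF S(1)])
      then show "v \<in> {0}" using S(2) by (simp add: bij_def inj_eq)
    qed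
    show "{0} \<subseteq> axis_cone \<kappa> x \<inter> uminus ` axis_cone \<kappa> x"
      by (auto simp: cone linear_0[OF S(1)] image_iff intro!: bexI[of _ 0])
  qed
qed

text \<open>
  Isometries to the standard inner product turn the cones at two points into round cones with the same
  opening about two unit vectors, and a rotation maps one axis to the other. The same map works for every
  opening.
\<close>

lemma linearly_equivalent_axis_cones: "linearly_equivalent_cones X (axis_cone \<kappa>) (axis_cone \<mu>)"
  unfolding linearly_equivalent_cones_def
proof (intro ballI)
  fix x y assume x: "x \<in> X" and y: "y \<in> X"
  obtain S :: "real^'n \<Rightarrow> real^'n"
    where S: "linear S" "bij S" "\<And>v w. G x v w = S v \<bullet> S w" "norm (S (e x)) = 1"
    by (rule G_isometry[OF x]) blast
  obtain R :: "real^'n \<Rightarrow> real^'n"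
    where R: "linear R" "bij R" "\<And>v w. G y v w = R v \<bullet> R w" "norm (R (e y)) = 1"
    by (rule G_isometry[OF y]) blast
  obtain Q where Q: "orthogonal_transformation Q" "Q (S (e x)) = R (e y)"
    using orthogonal_transformation_exists[of "S (e x)" "R (e y)"] S(4) R(4) by metis
  define L where "L v = inv R (Q (S v))" for v
  have RL: "R (L v) = Q (S v)" for v using R(2) by (simp add: L_def bij_def surj_f_inv_f)
  have Le: "L (e x) = e y" using R(2) by (simp add: L_def Q(2) bij_def)
  have lin: "linear L"
    unfolding L_def
    using linear_compose[OF S(1) linear_compose[OF orthogonal_transformation_linear[OF Q(1)]
        inj_linear_imp_inv_linear[OF R(1)]]] R(2)
    by (simp add: bij_def o_def)
  have bij: "bij L"
    unfolding L_def using bij_comp[OF S(2) bij_comp[OF orthogonal_transformation_bij[OF Q(1)] bij_imp_bij_inv[OF R(2)]]]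
    by (simp add: o_def)
  have G_L: "G y (L v) (L w) = G x v w" for v w
    using Q(1) by (simp add: R(3) RL S(3) orthogonal_transformation_def)
  have cone_L: "L v \<in> axis_cone \<kappa> y \<longleftrightarrow> v \<in> axis_cone \<kappa> x" for v \<kappa>
    unfolding axis_cone_def using G_L Le by (metis (mono_tags, lifting) mem_Collect_eq)
  have "L ` axis_cone \<kappa> x = axis_cone \<kappa> y" for \<kappa>
  proof (intro set_eqI iffI)
    fix w assume "w \<in> axis_cone \<kappa> y"
    moreover obtain v where "w = L v" using bij by (meson bij_pointE)
    ultimately show "w \<in> L ` axis_cone \<kappa> x" using cone_L by blast
  qed (use cone_L in blast)
  with lin bij show "\<exists>L. linear L \<and> bij L \<and> L ` axis_cone \<kappa> x = axis_cone \<kappa> y \<and> L ` axis_cone \<mu> x = axis_cone \<mu> y"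
    by blast
qed

lemma continuous_on_axis_form: "continuous_on (X \<times> UNIV) (\<lambda>(x, v). G x (e x) v)"
  by (rule continuous_on_linear_family[OF linear_axis continuous_axis])

lemma continuous_on_gauge: "continuous_on (X \<times> UNIV) (\<lambda>(x, v). \<kappa> * G x (e x) v - sqrt (G x v v))"
proof -
  have "continuous_on (X \<times> UNIV) (\<lambda>(x, v). G x v v)"
    by (rule continuous_on_bilinear_family[OF bilinear_G continuous_G])
  with continuous_on_axis_form show ?thesis
    unfolding split_beta by (intro continuous_intros)
qed

lemma gauge_strict:
  assumes "x \<in> X" "v \<noteq> 0" "v \<in> axis_cone \<mu> x" "0 < \<mu>" "\<mu> < \<kappa>"
  shows "sqrt (G x v v) < \<kappa> * G x (e x) v"
proof -
  have "0 < sqrt (G x v v)" using G_pos[OF assms(1,2)] by simp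
  also have v: "\<dots> \<le> \<mu> * G x (e x) v" using assms(3) by (simp add: axis_cone_def)
  finally have "0 < G x (e x) v" using assms(4) by (simp add: zero_less_mult_iff)
  then have "\<mu> * G x (e x) v < \<kappa> * G x (e x) v" using assms(5) by (rule mult_strict_right_mono[rotated])
  with v show ?thesis by linarith
qed

lemma axis_cone_subset_interior:
  assumes "x \<in> X" "0 < \<mu>" "\<mu> < \<kappa>"
  shows "axis_cone \<mu> x \<subseteq> interior (axis_cone \<kappa> x) \<union> {0}"
proof
  fix v assume v: "v \<in> axis_cone \<mu> x"
  have "continuous_on UNIV (\<lambda>w. \<kappa> * G x (e x) w - sqrt (G x w w))"
    using continuous_on_compose2[OF continuous_on_gauge, of UNIV "\<lambda>w. (x, w)" \<kappa>] assms(1)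
    by (simp add: continuous_on_Pair image_subset_iff)
  then have "open {w. 0 < \<kappa> * G x (e x) w - sqrt (G x w w)}"
    by (intro open_Collect_less continuous_on_const)
  then have sub: "{w. 0 < \<kappa> * G x (e x) w - sqrt (G x w w)} \<subseteq> interior (axis_cone \<kappa> x)"
    by (rule interior_maximal[rotated]) (auto simp: axis_cone_def)
  show "v \<in> interior (axis_cone \<kappa> x) \<union> {0}"
  proof (cases "v = 0")
    case False
    have "v \<in> {w. 0 < \<kappa> * G x (e x) w - sqrt (G x w w)}"
      using gauge_strict[OF assms(1) False v assms(2,3)] by simp
    with sub show ?thesis by blast
  qed simp
qed

text \<open>
  One function represents both cones. Choose smooth nonnegative functions that are positive
  exactly outside the wider cone (\<open>\<phi>1\<close>), exactly off the unit vectors of the narrower cone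
  (\<open>\<phi>2\<close>), and exactly at points strictly inside the wider cone (\<open>\<phi>3\<close>). The quotient
  \<open>\<phi>3 / (\<phi>2 + \<phi>3)\<close> has values in \<open>{0..1}\<close> and equals one just where \<open>\<phi>2\<close> vanishes;
  subtracting \<open>\<phi>1\<close> makes the difference negative outside the wider cone.
\<close>

lemma smoothly_represented_axis_cones:
  assumes g: "riemannian_metric_on X g" and \<mu>: "0 < \<mu>" "\<mu> < \<kappa>"
  shows "smoothly_represented_cones X g (axis_cone \<kappa>) (axis_cone \<mu>)"
proof -
  define Y where "Y = X \<times> (UNIV :: (real^'n) set)"
  have openY: "open Y" unfolding Y_def using open_X by (intro open_Times) auto
  define h where "h \<kappa> p = \<kappa> * G (fst p) (e (fst p)) (snd p) - sqrt (G (fst p) (snd p) (snd p))" for \<kappa> p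
  have conth: "continuous_on Y (h \<kappa>)" for \<kappa>
    using continuous_on_gauge unfolding Y_def h_def split_beta .
  have cone: "v \<in> axis_cone \<kappa> x \<longleftrightarrow> 0 \<le> h \<kappa> (x, v)" for \<kappa> x v
    by (simp add: axis_cone_def h_def)
  define gn where "gn p = g (fst p) (snd p) (snd p)" for p
  have g': "bilinear (g x)" "\<And>v. v \<noteq> 0 \<Longrightarrow> 0 < g x v v" if "x \<in> X" for x
    using g that by (auto simp: riemannian_metric_on_def)
  have "continuous_on X (\<lambda>x. g x u v)" for u v
    using g Ck_on.simps(1) by (metis riemannian_metric_on_def smooth_on_def)
  then have contg: "continuous_on Y gn"
    unfolding gn_def Y_def using continuous_on_bilinear_family[of X g] g'(1) by (simp add: split_beta)
  \<comment> \<open>the complement of the larger cone, the points strictly inside it, and the complement of the unit vectors of the smaller cone\<close>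
  define O1 where "O1 = Y \<inter> h \<kappa> -` {..<0}"
  define O3 where "O3 = Y \<inter> h \<kappa> -` {0<..}"
  define O2 where "O2 = (Y \<inter> h \<mu> -` {..<0}) \<union> (Y \<inter> gn -` (- {1}))"
  have "open O1" "open O2" "open O3"
    unfolding O1_def O2_def O3_def
    by (intro open_Un continuous_open_preimage conth contg openY open_Compl closed_singleton open_lessThan open_greaterThan)+
  note opens = this
  obtain \<phi>1 :: "(real^'n) \<times> (real^'n) \<Rightarrow> real" where \<phi>1: "smooth_on \<phi>1 UNIV" "\<And>p. 0 \<le> \<phi>1 p" "\<And>p. 0 < \<phi>1 p \<longleftrightarrow> p \<in> O1"
    by (rule open_set_smooth_positivity_set[OF opens(1)]) blast
  obtain \<phi>2 :: "(real^'n) \<times> (real^'n) \<Rightarrow> real" where \<phi>2: "smooth_on \<phi>2 UNIV" "\<And>p. 0 \<le> \<phi>2 p" "\<And>p. 0 < \<phi>2 p \<longleftrightarrow> p \<in> O2"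
    by (rule open_set_smooth_positivity_set[OF opens(2)]) blast
  obtain \<phi>3 :: "(real^'n) \<times> (real^'n) \<Rightarrow> real" where \<phi>3: "smooth_on \<phi>3 UNIV" "\<And>p. 0 \<le> \<phi>3 p" "\<And>p. 0 < \<phi>3 p \<longleftrightarrow> p \<in> O3"
    by (rule open_set_smooth_positivity_set[OF opens(3)]) blast
  have cover: "0 < \<phi>2 p + \<phi>3 p" if p: "p \<in> Y" for p
  proof (cases "p \<in> O2")
    case True
    then show ?thesis using \<phi>2(3)[of p] \<phi>3(2)[of p] by linarith
  next
    case False
    then have "0 \<le> h \<mu> p" "gn p = 1" using p by (auto simp: O2_def)
    moreover obtain x v where xv: "p = (x, v)" "x \<in> X" using p by (auto simp: Y_def)
    moreover have "v \<noteq> 0"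
      using \<open>gn p = 1\<close> bilinear_lzero[OF g'(1)[OF xv(2)]] by (auto simp: gn_def xv(1))
    ultimately have "p \<in> O3"
      using gauge_strict[of x v \<mu> \<kappa>] \<mu> p by (simp add: O3_def cone) (simp add: h_def)
    then show ?thesis using \<phi>3(3)[of p] \<phi>2(2)[of p] by linarith
  qed
  have nz: "\<phi>2 p + \<phi>3 p \<noteq> 0" if "p \<in> Y" for p using cover[OF that] by simp
  define k where "k p = \<phi>3 p * inverse (\<phi>2 p + \<phi>3 p) + (- 1) * \<phi>1 p" for p
  have "smooth_on k Y"
    unfolding smooth_on_def
  proof
    fix n
    have s: "Ck_on n \<phi>1 Y" "Ck_on n \<phi>2 Y" "Ck_on n \<phi>3 Y"
      using \<phi>1(1) \<phi>2(1) \<phi>3(1) by (auto simp: smooth_on_def intro: Ck_on_subset)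
    show "Ck_on n k Y"
      unfolding k_def
      by (intro Ck_on_add Ck_on_mult Ck_on_inverse Ck_on_const openY s nz)
  qed
  moreover have K: "axis_cone \<kappa> x = {v. 0 \<le> k (x, v)}" if x: "x \<in> X" for x
  proof -
    have "v \<in> axis_cone \<kappa> x \<longleftrightarrow> 0 \<le> k (x, v)" for v
    proof (cases "(x, v) \<in> O1")
      case True
      then have "\<phi>3 (x, v) = 0" using \<phi>3(2,3)[of "(x, v)"] by (auto simp: O1_def O3_def)
      then have "k (x, v) < 0" using \<phi>1(3)[of "(x, v)"] True by (simp add: k_def)
      moreover have "v \<notin> axis_cone \<kappa> x" using True by (simp add: O1_def cone)
      ultimately show ?thesis by simp
    next
      case False
      then have "\<phi>1 (x, v) = 0" using \<phi>1(2,3)[of "(x, v)"] by (metis less_eq_real_def)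
      then have "0 \<le> k (x, v)" using \<phi>2(2) \<phi>3(2) by (simp add: k_def)
      moreover have "v \<in> axis_cone \<kappa> x" using False x by (simp add: O1_def Y_def cone)
      ultimately show ?thesis by simp
    qed
    then show ?thesis by blast
  qed
  moreover have "axis_cone \<mu> x = {v. v = 0 \<or> 1 \<le> k (x, v /\<^sub>R metric_norm g x v)}" if x: "x \<in> X" for x
  proof -
    have zero: "0 \<in> axis_cone \<mu> x"
      using bilinear_lzero[OF bilinear_G[OF x]] bilinear_rzero[OF bilinear_G[OF x]] by (simp add: axis_cone_def)
    have nonzero: "v \<in> axis_cone \<mu> x \<longleftrightarrow> 1 \<le> k (x, v /\<^sub>R metric_norm g x v)" if v: "v \<noteq> 0" for v
    proof -
      define r where "r = metric_norm g x v"
      have r: "0 < r" "g x v v = r * r" using g'(2)[OF x v] by (simp_all add: r_def metric_norm_def)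
      define w where "w = v /\<^sub>R r"
      have gw: "gn (x, w) = 1"
        using r by (simp add: gn_def w_def bilinear_lmul[OF g'(1)[OF x]] bilinear_rmul[OF g'(1)[OF x]] divide_simps)
      have xw: "(x, w) \<in> Y" using x by (simp add: Y_def)
      have "v \<in> axis_cone \<mu> x \<longleftrightarrow> w \<in> axis_cone \<mu> x"
        using axis_cone_scale[OF x, of "inverse r" v \<mu>] axis_cone_scale[OF x, of r w \<mu>] r(1) by (auto simp: w_def)
      also have "\<dots> \<longleftrightarrow> (x, w) \<notin> O2" using gw xw by (auto simp: O2_def cone)
      also have "\<dots> \<longleftrightarrow> 1 \<le> k (x, w)"
      proof
        assume "(x, w) \<notin> O2"
        then have "\<phi>2 (x, w) = 0" using \<phi>2(2,3)[of "(x, w)"] by (metis less_eq_real_def)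
        moreover from this have "(x, w) \<in> O3" using cover[OF xw] \<phi>3(3)[of "(x, w)"] by simp
        then have "(x, w) \<notin> O1" by (auto simp: O1_def O3_def)
        then have "\<phi>1 (x, w) = 0" using \<phi>1(2,3)[of "(x, w)"] by (metis less_eq_real_def)
        ultimately show "1 \<le> k (x, w)" using cover[OF xw] by (simp add: k_def)
      next
        assume 1: "1 \<le> k (x, w)"
        show "(x, w) \<notin> O2"
        proof
          assume "(x, w) \<in> O2"
          then have "0 < \<phi>2 (x, w)" using \<phi>2(3) by simp
          then have "\<phi>3 (x, w) * inverse (\<phi>2 (x, w) + \<phi>3 (x, w)) < 1"
            using cover[OF xw] by (simp add: field_simps)
          then show False using 1 \<phi>1(2)[of "(x, w)"] by (simp add: k_def)
        qed
      qed
      finally show ?thesis by (simp add: w_def r_def)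
    qed
    show ?thesis
    proof (rule set_eqI)
      fix v show "v \<in> axis_cone \<mu> x \<longleftrightarrow> v \<in> {v. v = 0 \<or> 1 \<le> k (x, v /\<^sub>R metric_norm g x v)}"
        by (cases "v = 0") (simp_all only: zero nonzero mem_Collect_eq simp_thms)
    qed
  qed
  ultimately show ?thesis
    unfolding smoothly_represented_cones_def Y_def
    by (intro exI[of _ "1::nat"] exI[of _ "1::real"] exI[of _ "\<lambda>_. k"]) simp
qed

end

section \<open>Linear approximation and Gronwall's estimate\<close>

text \<open>
  The mean value inequality on short segments around the compact set, where the derivative is
  uniformly continuous.
\<close>

lemma uniform_linear_approximation:
  fixes g :: "'a::euclidean_space \<Rightarrow> 'b::real_normed_vector"
  assumes der: "\<And>x. (g has_derivative blinfun_apply (G x)) (at x)"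
    and cont: "continuous_on UNIV G" and "compact C" "0 < \<eta>"
  obtains \<delta> where "0 < \<delta>"
    "\<And>x y. x \<in> C \<Longrightarrow> norm (y - x) < \<delta> \<Longrightarrow> norm (g y - g x - G x (y - x)) \<le> \<eta> * norm (y - x)"
proof -
  define C' where "C' = {x + y |x y. x \<in> C \<and> y \<in> cball 0 1}"
  have "compact C'" unfolding C'_def by (intro compact_sums \<open>compact C\<close> compact_cball)
  then have "uniformly_continuous_on C' G"
    using cont by (intro compact_uniformly_continuous) (auto intro: continuous_on_subset)
  then obtain d where d: "0 < d" "\<And>x y. x \<in> C' \<Longrightarrow> y \<in> C' \<Longrightarrow> dist y x < d \<Longrightarrow> dist (G y) (G x) < \<eta>"
    using \<open>0 < \<eta>\<close> unfolding uniformly_continuous_on_def by metis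
  show thesis
  proof
    show "0 < min d 1" using d by simp
    fix x y assume x: "x \<in> C" and y: "norm (y - x) < min d 1"
    have "norm (g y - g x - G x (y - x)) \<le> norm (y - x) * \<eta>"
    proof (rule differentiable_bound_linearization[of x y "ball x (min d 1)" g "\<lambda>z. blinfun_apply (G z)" x \<eta>])
      fix t :: real assume "t \<in> {0..1}"
      then have "norm (t *\<^sub>R (y - x)) \<le> norm (y - x)" by (auto intro: mult_left_le_one_le)
      then show "x + t *\<^sub>R (y - x) \<in> ball x (min d 1)" using y by (simp add: dist_norm)
    next
      fix z assume z: "z \<in> ball x (min d 1)"
      have in_C': "x + w \<in> C'" if "norm w \<le> 1" for w
        using x that unfolding C'_def by auto
      have "norm (z - x) \<le> 1" using z by (simp add: dist_norm norm_minus_commute)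
      then have "z \<in> C'" "x \<in> C'" using in_C'[of "z - x"] in_C'[of 0] by auto
      then have "dist (G z) (G x) < \<eta>" using z d by (auto simp: dist_commute)
      then show "onorm (blinfun_apply (G z) - blinfun_apply (G x)) \<le> \<eta>"
        by (simp add: dist_norm norm_blinfun.rep_eq minus_blinfun.rep_eq fun_diff_def)
      show "(g has_derivative blinfun_apply (G z)) (at z within ball x (min d 1))"
        using der by (rule has_derivative_at_withinI)
    qed (use y d in auto)
    then show "norm (g y - g x - G x (y - x)) \<le> \<eta> * norm (y - x)" by (simp add: mult.commute)
  qed
qed

lemma continuous_imp_bounded_on_compact:
  fixes G :: "'a::topological_space \<Rightarrow> 'b::real_normed_vector"
  assumes "continuous_on C G" "compact C"
  obtains M where "0 < M" "\<And>x. x \<in> C \<Longrightarrow> norm (G x) \<le> M"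
proof -
  have "bounded (G ` C)" using assms compact_continuous_image compact_imp_bounded by blast
  then show thesis using that unfolding bounded_pos by auto
qed

lemma C1_lipschitz_on_cball:
  fixes g :: "'a::euclidean_space \<Rightarrow> 'b::real_normed_vector"
  assumes der: "\<And>x. (g has_derivative blinfun_apply (G x)) (at x)" and cont: "continuous_on UNIV G"
  obtains L where "0 < L" "\<And>x. x \<in> cball 0 r \<Longrightarrow> norm (G x) \<le> L"
    "\<And>x y. x \<in> cball 0 r \<Longrightarrow> y \<in> cball 0 r \<Longrightarrow> norm (g x - g y) \<le> L * norm (x - y)"
proof -
  obtain L where L: "0 < L" "\<And>x. x \<in> cball 0 r \<Longrightarrow> norm (G x) \<le> L"
    by (rule continuous_imp_bounded_on_compact[OF continuous_on_subset[OF cont subset_UNIV] compact_cball[of 0 r]]) blast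
  show thesis
  proof (rule that[OF L])
    show "norm (g x - g y) \<le> L * norm (x - y)" if "x \<in> cball 0 r" "y \<in> cball 0 r" for x y
      using L(2) that
      by (intro differentiable_bound[of "cball 0 r" g "\<lambda>x. blinfun_apply (G x)"])
        (auto simp: norm_blinfun.rep_eq intro: has_derivative_at_withinI[OF der])
  qed
qed

text \<open>
  The norm itself need not be differentiable at zeros of \<open>\<phi>\<close>, so the estimate is made for
  \<open>\<phi> s \<bullet> \<phi> s + \<kappa>\<^sup>2\<close>, whose growth rate is at most \<open>2 * (L + 1)\<close>. This costs the
  extra one in the exponent.
\<close>

lemma gronwall_norm:
  fixes \<phi> :: "real \<Rightarrow> 'a::real_inner"
  assumes der: "\<And>s. s \<in> {0..t} \<Longrightarrow> (\<phi> has_vector_derivative \<phi>' s) (at s)"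
    and bd: "\<And>s. s \<in> {0..t} \<Longrightarrow> norm (\<phi>' s) \<le> L * norm (\<phi> s) + \<kappa>"
    and nn: "0 \<le> L" "0 \<le> \<kappa>" "0 \<le> t"
  shows "norm (\<phi> t) \<le> (norm (\<phi> 0) + \<kappa>) * exp ((L + 1) * t)"
proof -
  define u where "u s = (\<phi> s \<bullet> \<phi> s + \<kappa>\<^sup>2) * exp (- (2 * (L + 1) * s))" for s
  have "u t \<le> u 0"
  proof (rule DERIV_nonpos_imp_nonincreasing[OF \<open>0 \<le> t\<close>])
    fix s assume "0 \<le> s" "s \<le> t"
    then have s: "s \<in> {0..t}" by simp
    have "((\<lambda>s. \<phi> s \<bullet> \<phi> s) has_vector_derivative (\<phi> s \<bullet> \<phi>' s + \<phi>' s \<bullet> \<phi> s)) (at s)"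
      by (rule bounded_bilinear.has_vector_derivative[OF bounded_bilinear_inner der[OF s] der[OF s]])
    then have d: "((\<lambda>s. \<phi> s \<bullet> \<phi> s) has_real_derivative 2 * (\<phi> s \<bullet> \<phi>' s)) (at s)"
      by (simp add: has_real_derivative_iff_has_vector_derivative inner_commute)
    have D: "(u has_real_derivative (2 * (\<phi> s \<bullet> \<phi>' s) - 2 * (L + 1) * (\<phi> s \<bullet> \<phi> s + \<kappa>\<^sup>2))
       * exp (- (2 * (L + 1) * s))) (at s)"
      unfolding u_def by (auto intro!: derivative_eq_intros d simp: algebra_simps)
    have "\<phi> s \<bullet> \<phi>' s \<le> norm (\<phi> s) * norm (\<phi>' s)" by (rule norm_cauchy_schwarz)
    also have "\<dots> \<le> norm (\<phi> s) * (L * norm (\<phi> s) + \<kappa>)" using bd[OF s] by (intro mult_left_mono) auto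
    also have "\<dots> = L * (norm (\<phi> s))\<^sup>2 + norm (\<phi> s) * \<kappa>"
      by (simp add: power2_eq_square algebra_simps)
    also have "\<dots> \<le> L * (norm (\<phi> s))\<^sup>2 + (norm (\<phi> s))\<^sup>2 + \<kappa>\<^sup>2 + L * \<kappa>\<^sup>2"
    proof -
      have "2 * (norm (\<phi> s) * \<kappa>) \<le> (norm (\<phi> s))\<^sup>2 + \<kappa>\<^sup>2"
        using sum_squares_bound[of "norm (\<phi> s)" \<kappa>] by (simp only: mult.assoc)
      moreover have "0 \<le> L * \<kappa>\<^sup>2" "0 \<le> norm (\<phi> s) * \<kappa>" using nn by simp_all
      ultimately show ?thesis by linarith
    qed
    also have "\<dots> = (L + 1) * (\<phi> s \<bullet> \<phi> s + \<kappa>\<^sup>2)"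
      by (simp add: algebra_simps power2_norm_eq_inner)
    finally have "(2 * (\<phi> s \<bullet> \<phi>' s) - 2 * (L + 1) * (\<phi> s \<bullet> \<phi> s + \<kappa>\<^sup>2))
       * exp (- (2 * (L + 1) * s)) \<le> 0"
      by (intro mult_nonpos_nonneg) (simp_all only: mult.assoc, simp_all)
    with D show "\<exists>y. (u has_real_derivative y) (at s) \<and> y \<le> 0" by blast
  qed
  then have "(\<phi> t \<bullet> \<phi> t + \<kappa>\<^sup>2) * exp (- (2 * (L + 1) * t)) * exp (2 * (L + 1) * t)
      \<le> (\<phi> 0 \<bullet> \<phi> 0 + \<kappa>\<^sup>2) * exp (2 * (L + 1) * t)"
    unfolding u_def by (intro mult_right_mono) simp_all
  then have "\<phi> t \<bullet> \<phi> t + \<kappa>\<^sup>2 \<le> (\<phi> 0 \<bullet> \<phi> 0 + \<kappa>\<^sup>2) * exp (2 * (L + 1) * t)"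
    by (simp only: mult.assoc mult_exp_exp) simp
  moreover have "\<phi> 0 \<bullet> \<phi> 0 + \<kappa>\<^sup>2 \<le> (norm (\<phi> 0) + \<kappa>)\<^sup>2"
    using nn by (simp add: power2_sum power2_norm_eq_inner)
  then have "(\<phi> 0 \<bullet> \<phi> 0 + \<kappa>\<^sup>2) * exp (2 * (L + 1) * t) \<le> (norm (\<phi> 0) + \<kappa>)\<^sup>2 * exp (2 * (L + 1) * t)"
    by (intro mult_right_mono) auto
  ultimately have "(norm (\<phi> t))\<^sup>2 \<le> (norm (\<phi> 0) + \<kappa>)\<^sup>2 * exp (2 * (L + 1) * t)"
    using zero_le_power2[of \<kappa>] unfolding power2_norm_eq_inner[of "\<phi> t"] by linarith
  also have "exp (2 * (L + 1) * t) = (exp ((L + 1) * t))\<^sup>2"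
    by (simp add: power2_eq_square exp_add[symmetric] algebra_simps)
  finally have "(norm (\<phi> t))\<^sup>2 \<le> ((norm (\<phi> 0) + \<kappa>) * exp ((L + 1) * t))\<^sup>2"
    by (simp only: power_mult_distrib)
  then show ?thesis
    by (rule power2_le_imp_le) (simp add: nn)
qed

lemma ode_unique_forward:
  fixes x y :: "real \<Rightarrow> 'a::euclidean_space"
  assumes der: "\<And>x. (f has_derivative blinfun_apply (Df x)) (at x)" and cont: "continuous_on UNIV Df"
    and x: "\<And>t. (x has_vector_derivative f (x t)) (at t)"
    and y: "\<And>t. (y has_vector_derivative f (y t)) (at t)"
    and "x 0 = y 0" "0 \<le> t"
  shows "x t = y t"
proof -
  have "continuous_on {0..t} x" "continuous_on {0..t} y"
    using x y has_vector_derivative_continuous by (blast intro: continuous_at_imp_continuous_on)+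
  then have "bounded (x ` {0..t} \<union> y ` {0..t})"
    by (simp add: compact_continuous_image compact_imp_bounded)
  then obtain r where "\<And>z. z \<in> x ` {0..t} \<union> y ` {0..t} \<Longrightarrow> norm z \<le> r"
    unfolding bounded_iff by blast
  then have r: "x s \<in> cball 0 r" "y s \<in> cball 0 r" if "s \<in> {0..t}" for s
    using that by simp_all
  obtain L where L: "0 < L"
    "\<And>x y. x \<in> cball 0 r \<Longrightarrow> y \<in> cball 0 r \<Longrightarrow> norm (f x - f y) \<le> L * norm (x - y)"
    using C1_lipschitz_on_cball[OF der cont] by metis
  have "norm (x t - y t) \<le> (norm (x 0 - y 0) + 0) * exp ((L + 1) * t)"
    using x y L r \<open>0 \<le> t\<close>
    by (intro gronwall_norm[where \<phi>' = "\<lambda>s. f (x s) - f (y s)"]) (auto intro!: derivative_intros)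
  with \<open>x 0 = y 0\<close> show ?thesis by simp
qed

lemma ode_unique:
  fixes x y :: "real \<Rightarrow> 'a::euclidean_space"
  assumes der: "\<And>x. (f has_derivative blinfun_apply (Df x)) (at x)" and cont: "continuous_on UNIV Df"
    and x: "\<And>t. (x has_vector_derivative f (x t)) (at t)"
    and y: "\<And>t. (y has_vector_derivative f (y t)) (at t)"
    and eq: "x 0 = y 0"
  shows "x t = y t"
proof (cases "0 \<le> t")
  case True
  then show ?thesis using ode_unique_forward[OF der cont x y eq] by blast
next
  case False
  have rev: "((\<lambda>s. z (- s)) has_vector_derivative - f (z (- s))) (at s)"
    if "\<And>t. (z has_vector_derivative f (z t)) (at t)" for z s
  proof -
    have "(uminus has_vector_derivative (- 1)) (at s)"
      by (auto intro!: derivative_eq_intros)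
    from vector_diff_chain_at[OF this that[of "- s"]] show ?thesis by (simp add: o_def)
  qed
  have "(\<lambda>s. x (- s)) (- t) = (\<lambda>s. y (- s)) (- t)"
  proof (rule ode_unique_forward[where f = "\<lambda>x. - f x" and Df = "\<lambda>x. - Df x" and x = "\<lambda>s. x (- s)" and y = "\<lambda>s. y (- s)"])
    show "((\<lambda>x. - f x) has_derivative blinfun_apply (- Df x)) (at x)" for x
      using has_derivative_minus[OF der[of x]] by (simp add: uminus_blinfun.rep_eq)
    show "continuous_on UNIV (\<lambda>x. - Df x)" using cont by (rule continuous_on_minus)
  qed (use rev[OF x] rev[OF y] eq False in auto)
  then show ?thesis by simp
qed

section \<open>Regularity of the flow\<close>

locale complete_C1_flow =
  fixes f :: "'a::euclidean_space \<Rightarrow> 'a" and \<psi> :: "real \<Rightarrow> 'a \<Rightarrow> 'a" and Df :: "'a \<Rightarrow> 'a \<Rightarrow>\<^sub>L 'a"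
  assumes f_has_derivative: "\<And>x. (f has_derivative blinfun_apply (Df x)) (at x)"
    and continuous_Df: "continuous_on UNIV Df"
    and flow: "complete_flow f \<psi>"
begin

lemma flow_0 [simp]: "\<psi> 0 x = x"
  using flow by (simp add: complete_flow_def)

lemma flow_has_vector_derivative: "((\<lambda>s. \<psi> s x) has_vector_derivative f (\<psi> t x)) (at t)"
  using flow by (simp add: complete_flow_def)

lemma continuous_flow_time: "continuous_on S (\<lambda>t. \<psi> t x)"
  using flow_has_vector_derivative has_vector_derivative_continuous
  by (blast intro: continuous_at_imp_continuous_on)

lemma continuous_f: "continuous_on S f"
  using f_has_derivative has_derivative_continuous by (blast intro: continuous_at_imp_continuous_on)

text \<open>
  Both sides solve the differential equation in \<open>s\<close> with the same initial value.
\<close>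

lemma flow_add: "\<psi> (s + t) x = \<psi> s (\<psi> t x)"
proof (rule ode_unique[OF f_has_derivative continuous_Df, of "\<lambda>s. \<psi> (s + t) x"])
  fix s
  have "((\<lambda>s. s + t) has_vector_derivative 1) (at s)"
    by (auto intro!: derivative_eq_intros)
  from vector_diff_chain_at[OF this flow_has_vector_derivative[of x "s + t"]]
  show "((\<lambda>s. \<psi> (s + t) x) has_vector_derivative f (\<psi> (s + t) x)) (at s)" by (simp add: o_def)
qed (auto intro: flow_has_vector_derivative)

text \<open>
  A neighbouring trajectory would have to leave the unit tube around the compact piece of trajectory at
  a first time, but Gronwall's estimate inside the tube keeps it closer than that.
\<close>

lemma flow_locally_bounded:
  assumes "0 \<le> b"
  obtains d R where "0 < d" "\<And>x t. x \<in> ball x0 d \<Longrightarrow> t \<in> {0..b} \<Longrightarrow> \<psi> t x \<in> cball 0 R"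
proof -
  obtain R where R: "\<And>t. t \<in> {0..b} \<Longrightarrow> norm (\<psi> t x0) \<le> R"
    using continuous_imp_bounded_on_compact[OF continuous_flow_time, of "{0..b}" x0] by auto
  obtain L where L: "0 < L"
    "\<And>x y. x \<in> cball 0 (R + 1) \<Longrightarrow> y \<in> cball 0 (R + 1) \<Longrightarrow> norm (f x - f y) \<le> L * norm (x - y)"
    using C1_lipschitz_on_cball[OF f_has_derivative continuous_Df] by metis
  define d where "d = exp (- ((L + 1) * b)) / 2"
  have d0: "0 < d" by (simp add: d_def)
  have close: "norm (\<psi> t x - \<psi> t x0) < 1" if x: "x \<in> ball x0 d" and "t \<in> {0..b}" for x t
  proof (rule ccontr)
    define u where "u s = norm (\<psi> s x - \<psi> s x0)" for s
    assume "\<not> norm (\<psi> t x - \<psi> t x0) < 1"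
    with that have t: "t \<in> {0..b}" "1 \<le> u t" by (auto simp: u_def)
    have cu: "continuous_on S u" for S
      unfolding u_def by (intro continuous_intros continuous_flow_time)
    have u0: "u 0 < d" using x by (simp add: u_def dist_norm norm_minus_commute)
    have d1: "d < 1"
    proof -
      have "- ((L + 1) * b) \<le> 0" using L assms by simp
      then have "exp (- ((L + 1) * b)) \<le> 1" by (simp only: exp_le_one_iff)
      then show ?thesis unfolding d_def by linarith
    qed
    \<comment> \<open>the first time at which the two trajectories are at distance one\<close>
    define S where "S = {s \<in> {0..b}. 1 \<le> u s}"
    have S: "S = {0..b} \<inter> u -` {1..}" by (auto simp: S_def)
    have "closed S" unfolding S by (rule continuous_closed_preimage[OF cu]) auto
    then have "compact S"
      using bounded_subset[OF bounded_closed_interval, of S 0 b] by (auto simp: compact_eq_bounded_closed S)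
    then obtain t1 where t1: "t1 \<in> S" "\<And>s. s \<in> S \<Longrightarrow> t1 \<le> s"
      using compact_attains_inf[of S] t by (auto simp: S_def)
    have le1: "u s \<le> 1" if s: "s \<in> {0..t1}" for s
    proof (rule ccontr)
      assume "\<not> u s \<le> 1"
      then obtain r where "0 \<le> r" "r \<le> s" "u r = 1"
        using IVT'[of u 0 1 s] u0 d1 s cu by auto
      then have "r \<in> S" using s t1(1) by (auto simp: S_def)
      then have "r = s" using t1(2)[of r] \<open>r \<le> s\<close> s by auto
      then show False using \<open>u r = 1\<close> \<open>\<not> u s \<le> 1\<close> by simp
    qed
    have in_ball: "\<psi> s x \<in> cball 0 (R + 1)" "\<psi> s x0 \<in> cball 0 (R + 1)" if "s \<in> {0..t1}" for s
    proof -
      have s: "s \<in> {0..b}" using that t1 by (auto simp: S_def)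
      show "\<psi> s x0 \<in> cball 0 (R + 1)" using R[OF s] by simp
      have "norm (\<psi> s x) \<le> norm (\<psi> s x0) + u s"
        unfolding u_def by (metis add.commute diff_add_cancel norm_triangle_ineq)
      then show "\<psi> s x \<in> cball 0 (R + 1)" using R[OF s] le1[OF that] by simp
    qed
    have "u t1 \<le> (norm (\<psi> 0 x - \<psi> 0 x0) + 0) * exp ((L + 1) * t1)"
      unfolding u_def using L t1(1) in_ball
      by (intro gronwall_norm[where \<phi>' = "\<lambda>s. f (\<psi> s x) - f (\<psi> s x0)"])
        (auto simp: S_def intro!: derivative_intros flow_has_vector_derivative)
    also have "\<dots> = u 0 * exp ((L + 1) * t1)" by (simp add: u_def)
    also have "\<dots> \<le> d * exp ((L + 1) * b)"
      using u0 t1(1) L d0 by (intro mult_mono) (auto simp: S_def u_def)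
    also have "\<dots> < 1" by (simp add: d_def exp_minus)
    finally show False using t1(1) by (simp add: S_def)
  qed
  show thesis
  proof
    show "0 < d" by (rule d0)
    show "\<psi> t x \<in> cball 0 (R + 1)" if "x \<in> ball x0 d" "t \<in> {0..b}" for x t
    proof -
      have "norm (\<psi> t x) \<le> norm (\<psi> t x0) + norm (\<psi> t x - \<psi> t x0)"
        by (metis add.commute diff_add_cancel norm_triangle_ineq)
      then show ?thesis using R close that by fastforce
    qed
  qed
qed

lemma flow_locally_lipschitz:
  assumes "0 \<le> b"
  obtains d E where "0 < d" "0 < E" "\<And>x y t. x \<in> ball x0 d \<Longrightarrow> y \<in> ball x0 d \<Longrightarrow> t \<in> {0..b} \<Longrightarrow>
     norm (\<psi> t x - \<psi> t y) \<le> E * norm (x - y)"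
proof -
  obtain d R where d: "0 < d" "\<And>x t. x \<in> ball x0 d \<Longrightarrow> t \<in> {0..b} \<Longrightarrow> \<psi> t x \<in> cball 0 R"
    using flow_locally_bounded[OF assms] by metis
  obtain L where L: "0 < L"
    "\<And>x y. x \<in> cball 0 R \<Longrightarrow> y \<in> cball 0 R \<Longrightarrow> norm (f x - f y) \<le> L * norm (x - y)"
    using C1_lipschitz_on_cball[OF f_has_derivative continuous_Df] by metis
  have "norm (\<psi> t x - \<psi> t y) \<le> exp ((L + 1) * b) * norm (x - y)"
    if "x \<in> ball x0 d" "y \<in> ball x0 d" "t \<in> {0..b}" for x y t
  proof -
    have "norm (\<psi> t x - \<psi> t y) \<le> (norm (\<psi> 0 x - \<psi> 0 y) + 0) * exp ((L + 1) * t)"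
      using L d that
      by (intro gronwall_norm[where \<phi>' = "\<lambda>s. f (\<psi> s x) - f (\<psi> s y)"])
        (auto intro!: derivative_intros flow_has_vector_derivative)
    also have "\<dots> \<le> norm (x - y) * exp ((L + 1) * b)"
      using that L by (intro mult_mono) auto
    finally show ?thesis by (simp add: mult.commute)
  qed
  with d(1) show thesis by (intro that[of d "exp ((L + 1) * b)"]) auto
qed

lemma continuous_flow: "continuous_on ({0..} \<times> UNIV) (\<lambda>(t, x). \<psi> t x)"
proof (rule continuous_on_TimesI)
  show "local_lipschitz {0..} UNIV \<psi>"
  proof (rule local_lipschitzI)
    fix t :: real and x0 assume "t \<in> {0..}"
    then have "0 \<le> t + 1" by simp
    then obtain d E where d: "0 < d" "0 < E" "\<And>x y s. x \<in> ball x0 d \<Longrightarrow> y \<in> ball x0 d \<Longrightarrow> s \<in> {0..t + 1} \<Longrightarrow>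
       norm (\<psi> s x - \<psi> s y) \<le> E * norm (x - y)"
      using flow_locally_lipschitz by metis
    have "E-lipschitz_on (cball x0 (min 1 (d / 2)) \<inter> UNIV) (\<psi> s)" if "s \<in> cball t (min 1 (d / 2)) \<inter> {0..}" for s
    proof (rule lipschitz_onI)
      fix x y assume "x \<in> cball x0 (min 1 (d / 2)) \<inter> UNIV" "y \<in> cball x0 (min 1 (d / 2)) \<inter> UNIV"
      then have "x \<in> ball x0 d" "y \<in> ball x0 d" "s \<in> {0..t + 1}"
        using that d(1) by (auto simp: dist_real_def)
      from d(3)[OF this] show "dist (\<psi> s x) (\<psi> s y) \<le> E * dist x y" by (simp add: dist_norm)
    qed (use d in simp)
    then show "\<exists>u>0. \<exists>L. \<forall>s\<in>cball t u \<inter> {0..}. L-lipschitz_on (cball x0 u \<inter> UNIV) (\<psi> s)"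
      using d(1) by (intro exI[of _ "min 1 (d / 2)"] conjI exI[of _ E]) auto
  qed
  show "continuous_on {0..} (\<lambda>t. \<psi> t x)" for x by (rule continuous_flow_time)
qed

lemma continuous_flow_at: "0 \<le> t \<Longrightarrow> continuous_on S (\<psi> t)"
  using continuous_on_compose2[OF continuous_flow, of S "\<lambda>x. (t, x)"]
  by (simp add: continuous_on_Pair image_subset_iff)

definition diff_quotient :: "real \<Rightarrow> real \<Rightarrow> 'a \<Rightarrow> 'a \<Rightarrow> 'a" where
  "diff_quotient h t x v = (\<psi> t (x + h *\<^sub>R v) - \<psi> t x) /\<^sub>R h"

text \<open>
  Solutions of the variational equation along the trajectory of \<open>x\<close> on \<open>{0..b}\<close>, up to
  an error \<open>\<kappa>\<close> in the velocity.
\<close>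

definition approx_variational :: "real \<Rightarrow> 'a \<Rightarrow> real \<Rightarrow> (real \<Rightarrow> 'a) \<Rightarrow> bool" where
  "approx_variational b x \<kappa> \<phi> \<longleftrightarrow>
     (\<forall>t\<in>{0..b}. \<exists>\<phi>'. (\<phi> has_vector_derivative \<phi>') (at t) \<and> norm (\<phi>' - Df (\<psi> t x) (\<phi> t)) \<le> \<kappa>)"

lemma approx_variational_add:
  assumes "approx_variational b x \<kappa> \<phi>" "approx_variational b x \<mu> \<zeta>"
  shows "approx_variational b x (\<kappa> + \<mu>) (\<lambda>t. \<phi> t + \<zeta> t)"
  unfolding approx_variational_def
proof
  fix t assume t: "t \<in> {0..b}"
  obtain \<phi>' where 1: "(\<phi> has_vector_derivative \<phi>') (at t)" "norm (\<phi>' - Df (\<psi> t x) (\<phi> t)) \<le> \<kappa>"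
    using assms(1)[unfolded approx_variational_def, rule_format, OF t] by blast
  obtain \<zeta>' where 2: "(\<zeta> has_vector_derivative \<zeta>') (at t)" "norm (\<zeta>' - Df (\<psi> t x) (\<zeta> t)) \<le> \<mu>"
    using assms(2)[unfolded approx_variational_def, rule_format, OF t] by blast
  have "norm ((\<phi>' + \<zeta>') - Df (\<psi> t x) (\<phi> t + \<zeta> t))
      = norm ((\<phi>' - Df (\<psi> t x) (\<phi> t)) + (\<zeta>' - Df (\<psi> t x) (\<zeta> t)))"
    by (simp add: blinfun.add_right algebra_simps)
  also have "\<dots> \<le> \<kappa> + \<mu>" using 1(2) 2(2) by (rule norm_triangle_mono)
  finally show "\<exists>\<phi>'. ((\<lambda>t. \<phi> t + \<zeta> t) has_vector_derivative \<phi>') (at t) \<and>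
      norm (\<phi>' - Df (\<psi> t x) (\<phi> t + \<zeta> t)) \<le> \<kappa> + \<mu>"
    using has_vector_derivative_add[OF 1(1) 2(1)] by blast
qed

lemma approx_variational_scaleR:
  assumes "approx_variational b x \<kappa> \<phi>"
  shows "approx_variational b x (\<bar>c\<bar> * \<kappa>) (\<lambda>t. c *\<^sub>R \<phi> t)"
  unfolding approx_variational_def
proof
  fix t assume t: "t \<in> {0..b}"
  obtain \<phi>' where 1: "(\<phi> has_vector_derivative \<phi>') (at t)" "norm (\<phi>' - Df (\<psi> t x) (\<phi> t)) \<le> \<kappa>"
    using assms[unfolded approx_variational_def, rule_format, OF t] by blast
  have "norm (c *\<^sub>R \<phi>' - Df (\<psi> t x) (c *\<^sub>R \<phi> t)) = \<bar>c\<bar> * norm (\<phi>' - Df (\<psi> t x) (\<phi> t))"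
    by (simp add: blinfun.scaleR_right flip: scaleR_diff_right)
  also have "\<dots> \<le> \<bar>c\<bar> * \<kappa>" using 1(2) by (simp add: mult_left_mono)
  finally show "\<exists>\<phi>'. ((\<lambda>t. c *\<^sub>R \<phi> t) has_vector_derivative \<phi>') (at t) \<and>
      norm (\<phi>' - Df (\<psi> t x) (c *\<^sub>R \<phi> t)) \<le> \<bar>c\<bar> * \<kappa>"
    using has_vector_derivative_scaleR[OF DERIV_const 1(1), of c] by auto
qed

lemma approx_variational_small:
  assumes "approx_variational b x \<kappa> \<phi>" "\<phi> 0 = 0" "t \<in> {0..b}" "0 < L"
    and "\<And>s. s \<in> {0..b} \<Longrightarrow> norm (Df (\<psi> s x)) \<le> L"
  shows "norm (\<phi> t) \<le> \<kappa> * exp ((L + 1) * b)"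
proof -
  define \<phi>' where "\<phi>' s = (SOME d. (\<phi> has_vector_derivative d) (at s) \<and> norm (d - Df (\<psi> s x) (\<phi> s)) \<le> \<kappa>)" for s
  have \<phi>': "(\<phi> has_vector_derivative \<phi>' s) (at s)" "norm (\<phi>' s - Df (\<psi> s x) (\<phi> s)) \<le> \<kappa>" if "s \<in> {0..b}" for s
    using someI_ex[OF assms(1)[unfolded approx_variational_def, rule_format, OF that]] by (simp_all add: \<phi>'_def)
  have \<kappa>: "0 \<le> \<kappa>" using \<phi>'(2)[OF assms(3)] norm_ge_zero order_trans by blast
  have "norm (\<phi> t) \<le> (norm (\<phi> 0) + \<kappa>) * exp ((L + 1) * t)"
  proof (rule gronwall_norm)
    fix s assume "s \<in> {0..t}"
    then have s: "s \<in> {0..b}" using assms(3) by auto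
    show "(\<phi> has_vector_derivative \<phi>' s) (at s)" using \<phi>'(1)[OF s] .
    have "norm (\<phi>' s) \<le> norm (Df (\<psi> s x) (\<phi> s)) + norm (\<phi>' s - Df (\<psi> s x) (\<phi> s))"
      by (rule norm_triangle_sub)
    also have "\<dots> \<le> L * norm (\<phi> s) + \<kappa>"
      using \<phi>'(2)[OF s] norm_blinfun[of "Df (\<psi> s x)" "\<phi> s"] mult_right_mono[OF assms(5)[OF s] norm_ge_zero[of "\<phi> s"]]
      by linarith
    finally show "norm (\<phi>' s) \<le> L * norm (\<phi> s) + \<kappa>" .
  qed (use assms \<kappa> in auto)
  also have "\<dots> \<le> \<kappa> * exp ((L + 1) * b)"
    using assms \<kappa> by (auto intro!: mult_left_mono)
  finally show ?thesis .
qed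

text \<open>
  The velocity of a difference quotient is a difference quotient of \<open>f\<close> along the trajectory.
  It differs from the linearization by an amount proportional to the distance of the two trajectories,
  with an arbitrarily small factor.
\<close>

lemma diff_quotient_approx_variational:
  assumes "0 \<le> b"
  obtains \<rho> L where "0 < \<rho>" "0 < L" "\<And>x s. x \<in> ball x0 \<rho> \<Longrightarrow> s \<in> {0..b} \<Longrightarrow> norm (Df (\<psi> s x)) \<le> L"
    "\<And>\<kappa> V. 0 < \<kappa> \<Longrightarrow> 0 < V \<Longrightarrow> \<exists>\<delta>>0. \<forall>x\<in>ball x0 \<rho>. \<forall>v h. norm v \<le> V \<longrightarrow> h \<noteq> 0 \<longrightarrow> \<bar>h\<bar> < \<delta> \<longrightarrow>
        approx_variational b x \<kappa> (\<lambda>t. diff_quotient h t x v)"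
proof -
  obtain d1 R where d1: "0 < d1" "\<And>x t. x \<in> ball x0 d1 \<Longrightarrow> t \<in> {0..b} \<Longrightarrow> \<psi> t x \<in> cball 0 R"
    using flow_locally_bounded[OF assms] by metis
  obtain d2 E where d2: "0 < d2" "0 < E" "\<And>x y t. x \<in> ball x0 d2 \<Longrightarrow> y \<in> ball x0 d2 \<Longrightarrow> t \<in> {0..b} \<Longrightarrow>
     norm (\<psi> t x - \<psi> t y) \<le> E * norm (x - y)"
    using flow_locally_lipschitz[OF assms] by metis
  obtain L where L: "0 < L" "\<And>x. x \<in> cball 0 R \<Longrightarrow> norm (Df x) \<le> L"
    using C1_lipschitz_on_cball[OF f_has_derivative continuous_Df] by metis
  define d where "d = min d1 d2"
  have d: "0 < d" using d1 d2 by (simp add: d_def)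
  have "\<exists>\<delta>>0. \<forall>x\<in>ball x0 (d / 2). \<forall>v h. norm v \<le> V \<longrightarrow> h \<noteq> 0 \<longrightarrow> \<bar>h\<bar> < \<delta> \<longrightarrow>
        approx_variational b x \<kappa> (\<lambda>t. diff_quotient h t x v)" if \<kappa>: "0 < \<kappa>" and V: "0 < V" for \<kappa> V
  proof -
    define \<eta> where "\<eta> = \<kappa> / (E * V)"
    have \<eta>: "0 < \<eta>" using \<kappa> V d2 by (simp add: \<eta>_def)
    obtain \<delta> where \<delta>: "0 < \<delta>" "\<And>x y. x \<in> cball 0 R \<Longrightarrow> norm (y - x) < \<delta> \<Longrightarrow>
        norm (f y - f x - Df x (y - x)) \<le> \<eta> * norm (y - x)"
      using uniform_linear_approximation[OF f_has_derivative continuous_Df compact_cball \<eta>] by metis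
    define \<delta>' where "\<delta>' = min (d / (2 * V)) (\<delta> / (E * V))"
    have "approx_variational b x \<kappa> (\<lambda>t. diff_quotient h t x v)"
      if x: "x \<in> ball x0 (d / 2)" and v: "norm v \<le> V" and h: "h \<noteq> 0" "\<bar>h\<bar> < \<delta>'" for x v h
      unfolding approx_variational_def
    proof
      fix t assume t: "t \<in> {0..b}"
      define y where "y = x + h *\<^sub>R v"
      have hV: "norm (y - x) \<le> \<bar>h\<bar> * V" using v by (simp add: y_def mult_left_mono)
      have "\<bar>h\<bar> * V < d / 2"
        using h V by (simp add: \<delta>'_def field_simps)
      with hV have "dist x y < d / 2" by (simp add: dist_norm norm_minus_commute)
      then have y: "y \<in> ball x0 d" using x dist_triangle[of x0 y x] by simp
      have x': "x \<in> ball x0 d" using x d by simp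
      have xy: "x \<in> ball x0 d1" "x \<in> ball x0 d2" "y \<in> ball x0 d1" "y \<in> ball x0 d2"
        using x' y by (auto simp: d_def)
      have lip: "norm (\<psi> t y - \<psi> t x) \<le> E * (\<bar>h\<bar> * V)"
        using d2(3)[OF xy(4,2) t] hV d2(2) by (meson mult_left_mono order_trans less_imp_le)
      also have "\<dots> < \<delta>" using h V d2(2) by (simp add: \<delta>'_def field_simps)
      finally have "norm (f (\<psi> t y) - f (\<psi> t x) - Df (\<psi> t x) (\<psi> t y - \<psi> t x)) \<le> \<eta> * norm (\<psi> t y - \<psi> t x)"
        using \<delta>(2) d1(2)[OF xy(1) t] by blast
      also have "\<dots> \<le> \<eta> * (E * (\<bar>h\<bar> * V))" using lip \<eta> by (intro mult_left_mono) auto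
      also have "\<dots> = \<kappa> * \<bar>h\<bar>" using d2(2) V by (simp add: \<eta>_def)
      finally have *: "norm (f (\<psi> t y) - f (\<psi> t x) - Df (\<psi> t x) (\<psi> t y - \<psi> t x)) / \<bar>h\<bar> \<le> \<kappa>"
        using h by (simp add: field_simps)
      have "((\<lambda>t. diff_quotient h t x v) has_vector_derivative (f (\<psi> t y) - f (\<psi> t x)) /\<^sub>R h) (at t)"
        unfolding diff_quotient_def y_def[symmetric]
        using has_vector_derivative_scaleR[OF DERIV_const, of "\<lambda>t. \<psi> t y - \<psi> t x" "f (\<psi> t y) - f (\<psi> t x)" t UNIV "inverse h"]
          has_vector_derivative_diff[OF flow_has_vector_derivative flow_has_vector_derivative] by auto
      moreover have "norm ((f (\<psi> t y) - f (\<psi> t x)) /\<^sub>R h - Df (\<psi> t x) (diff_quotient h t x v)) \<le> \<kappa>"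
      proof -
        have "(f (\<psi> t y) - f (\<psi> t x)) /\<^sub>R h - Df (\<psi> t x) (diff_quotient h t x v)
          = (f (\<psi> t y) - f (\<psi> t x) - Df (\<psi> t x) (\<psi> t y - \<psi> t x)) /\<^sub>R h"
          by (simp only: diff_quotient_def y_def blinfun.scaleR_right scaleR_diff_right[symmetric])
        with * show ?thesis by (simp add: divide_inverse mult.commute)
      qed
      ultimately show "\<exists>\<phi>'. ((\<lambda>t. diff_quotient h t x v) has_vector_derivative \<phi>') (at t) \<and>
         norm (\<phi>' - Df (\<psi> t x) (diff_quotient h t x v)) \<le> \<kappa>" by blast
    qed
    moreover have "0 < \<delta>'" using d V \<delta> d2 by (simp add: \<delta>'_def)
    ultimately show ?thesis by blast
  qed
  moreover have "norm (Df (\<psi> s x)) \<le> L" if "x \<in> ball x0 (d / 2)" "s \<in> {0..b}" for x s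
    using L d1(2)[of x s] that d by (auto simp: d_def)
  ultimately show thesis using that[of "d / 2" L] d L(1) by simp
qed

end

lemma one_over_Suc_tendsto_0: "(\<lambda>n. 1 / real (Suc n)) \<longlonglongrightarrow> 0"
  using LIMSEQ_inverse_real_of_nat by (simp add: inverse_eq_divide)

context complete_C1_flow
begin

lemma diff_quotient_0 [simp]: "h \<noteq> 0 \<Longrightarrow> diff_quotient h 0 x v = v"
  by (simp add: diff_quotient_def)

definition flow_variation :: "real \<Rightarrow> 'a \<Rightarrow> 'a \<Rightarrow> 'a" where
  "flow_variation t x v = lim (\<lambda>n. diff_quotient (1 / Suc n) t x v)"

text \<open>
  Two difference quotients have the same initial value \<open>v\<close>, so Gronwall's estimate makes their
  difference small: they form a Cauchy family as \<open>h\<close> tends to zero, uniformly in the point and the time.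
\<close>

lemma diff_quotient_uniform_limit:
  assumes "0 \<le> b"
  obtains \<rho> where "0 < \<rho>"
    "\<And>\<eta> V. 0 < \<eta> \<Longrightarrow> 0 < V \<Longrightarrow> \<exists>\<delta>>0. \<forall>x\<in>ball x0 \<rho>. \<forall>v t h. norm v \<le> V \<longrightarrow> t \<in> {0..b} \<longrightarrow> h \<noteq> 0 \<longrightarrow>
        \<bar>h\<bar> < \<delta> \<longrightarrow> norm (diff_quotient h t x v - flow_variation t x v) \<le> \<eta>"
    "\<And>x v t. x \<in> ball x0 \<rho> \<Longrightarrow> t \<in> {0..b} \<Longrightarrow> (\<lambda>n. diff_quotient (1 / Suc n) t x v) \<longlonglongrightarrow> flow_variation t x v"
proof -
  obtain \<rho> L where \<rho>: "0 < \<rho>" "0 < L" "\<And>x s. x \<in> ball x0 \<rho> \<Longrightarrow> s \<in> {0..b} \<Longrightarrow> norm (Df (\<psi> s x)) \<le> L"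
    "\<And>\<kappa> V. 0 < \<kappa> \<Longrightarrow> 0 < V \<Longrightarrow> \<exists>\<delta>>0. \<forall>x\<in>ball x0 \<rho>. \<forall>v h. norm v \<le> V \<longrightarrow> h \<noteq> 0 \<longrightarrow> \<bar>h\<bar> < \<delta> \<longrightarrow>
        approx_variational b x \<kappa> (\<lambda>t. diff_quotient h t x v)"
    using diff_quotient_approx_variational[OF assms, of x0] by metis
  have cauchy: "\<exists>\<delta>>0. \<forall>x\<in>ball x0 \<rho>. \<forall>v t h k. norm v \<le> V \<longrightarrow> t \<in> {0..b} \<longrightarrow> h \<noteq> 0 \<longrightarrow> \<bar>h\<bar> < \<delta> \<longrightarrow>
      k \<noteq> 0 \<longrightarrow> \<bar>k\<bar> < \<delta> \<longrightarrow> norm (diff_quotient h t x v - diff_quotient k t x v) \<le> \<eta>" if \<eta>: "0 < \<eta>" and "0 < V" for \<eta> V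
  proof -
    define \<kappa> where "\<kappa> = \<eta> / (2 * exp ((L + 1) * b))"
    have "0 < \<kappa>" using \<eta> by (simp add: \<kappa>_def)
    with \<rho>(4) \<open>0 < V\<close> obtain \<delta> where \<delta>: "0 < \<delta>"
      "\<And>x v h. x \<in> ball x0 \<rho> \<Longrightarrow> norm v \<le> V \<Longrightarrow> h \<noteq> 0 \<Longrightarrow> \<bar>h\<bar> < \<delta> \<Longrightarrow>
        approx_variational b x \<kappa> (\<lambda>t. diff_quotient h t x v)" by metis
    have "norm (diff_quotient h t x v - diff_quotient k t x v) \<le> \<eta>"
      if x: "x \<in> ball x0 \<rho>" and v: "norm v \<le> V" and t: "t \<in> {0..b}" and h: "h \<noteq> 0" "\<bar>h\<bar> < \<delta>" "k \<noteq> 0" "\<bar>k\<bar> < \<delta>"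
      for x v t h k
    proof -
      have "norm (diff_quotient h t x v + (-1) *\<^sub>R diff_quotient k t x v) \<le> (\<kappa> + \<bar>-1\<bar> * \<kappa>) * exp ((L + 1) * b)"
        by (rule approx_variational_small[OF approx_variational_add[OF \<delta>(2) approx_variational_scaleR[OF \<delta>(2)]] _ t \<rho>(2,3)])
          (use x v h in auto)
      also have "\<dots> = \<eta>" by (simp add: \<kappa>_def)
      finally show ?thesis by simp
    qed
    with \<delta>(1) show ?thesis by blast
  qed
  have small: "\<forall>\<^sub>F n in sequentially. \<bar>1 / real (Suc n)\<bar> < \<delta>" if "0 < \<delta>" for \<delta>
  proof -
from tendstoD[OF one_over_Suc_tendsto_0 that] show ?thesis by (simp add: dist_real_def)
  qed
  have lim: "(\<lambda>n. diff_quotient (1 / Suc n) t x v) \<longlonglongrightarrow> flow_variation t x v"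
    if x: "x \<in> ball x0 \<rho>" and t: "t \<in> {0..b}" for x v t
  proof -
    have "Cauchy (\<lambda>n. diff_quotient (1 / Suc n) t x v)"
    proof (rule CauchyI)
      fix e :: real assume "0 < e"
      then obtain \<delta> where \<delta>: "0 < \<delta>" "\<And>h k. h \<noteq> 0 \<Longrightarrow> \<bar>h\<bar> < \<delta> \<Longrightarrow> k \<noteq> 0 \<Longrightarrow> \<bar>k\<bar> < \<delta> \<Longrightarrow>
         norm (diff_quotient h t x v - diff_quotient k t x v) \<le> e / 2"
        using cauchy[of "e / 2" "norm v + 1"] x t norm_ge_zero[of v]
        by (smt (verit) half_gt_zero)
      obtain M where M: "\<And>n. n \<ge> M \<Longrightarrow> \<bar>1 / real (Suc n)\<bar> < \<delta>"
        using small[OF \<delta>(1)] unfolding eventually_sequentially by blast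
      have "norm (diff_quotient (1 / Suc m) t x v - diff_quotient (1 / Suc n) t x v) < e" if "m \<ge> M" "n \<ge> M" for m n
      proof -
        have "norm (diff_quotient (1 / Suc m) t x v - diff_quotient (1 / Suc n) t x v) \<le> e / 2"
          by (rule \<delta>(2)) (use M[OF that(1)] M[OF that(2)] in \<open>auto simp del: of_nat_Suc\<close>)
        with \<open>0 < e\<close> show ?thesis by linarith
      qed
      then show "\<exists>M. \<forall>m\<ge>M. \<forall>n\<ge>M. norm (diff_quotient (1 / Suc m) t x v - diff_quotient (1 / Suc n) t x v) < e" by blast
    qed
    then show ?thesis unfolding flow_variation_def by (simp add: Cauchy_convergent_iff convergent_LIMSEQ_iff)
  qed
  have unif: "\<exists>\<delta>>0. \<forall>x\<in>ball x0 \<rho>. \<forall>v t h. norm v \<le> V \<longrightarrow> t \<in> {0..b} \<longrightarrow> h \<noteq> 0 \<longrightarrow>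
        \<bar>h\<bar> < \<delta> \<longrightarrow> norm (diff_quotient h t x v - flow_variation t x v) \<le> \<eta>" if \<eta>V: "0 < \<eta>" "0 < V" for \<eta> V
  proof -
    obtain \<delta> where \<delta>: "0 < \<delta>" "\<And>x v t h k. x \<in> ball x0 \<rho> \<Longrightarrow> norm v \<le> V \<Longrightarrow> t \<in> {0..b} \<Longrightarrow> h \<noteq> 0 \<Longrightarrow> \<bar>h\<bar> < \<delta> \<Longrightarrow>
      k \<noteq> 0 \<Longrightarrow> \<bar>k\<bar> < \<delta> \<Longrightarrow> norm (diff_quotient h t x v - diff_quotient k t x v) \<le> \<eta>"
      using cauchy[OF \<eta>V] by blast
    have "norm (diff_quotient h t x v - flow_variation t x v) \<le> \<eta>"
      if "x \<in> ball x0 \<rho>" "norm v \<le> V" "t \<in> {0..b}" "h \<noteq> 0" "\<bar>h\<bar> < \<delta>" for x v t h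
    proof (rule tendsto_upperbound[OF tendsto_norm[OF tendsto_diff[OF tendsto_const lim]]])
      show "\<forall>\<^sub>F n in sequentially. norm (diff_quotient h t x v - diff_quotient (1 / Suc n) t x v) \<le> \<eta>"
        using small[OF \<delta>(1)] by (rule eventually_mono) (rule \<delta>(2)[OF that], simp_all)
    qed (use that in auto)
    with \<delta>(1) show ?thesis by blast
  qed
  show thesis by (rule that[OF \<rho>(1) unif lim])
qed

text \<open>
  The defect of linearity of the difference quotients starts at zero and solves the variational equation
  up to a small error.
\<close>

lemma linear_flow_variation:
  assumes "0 \<le> t"
  shows "linear (flow_variation t x)"
proof -
  have comb: "flow_variation t x (a *\<^sub>R u + c *\<^sub>R v) = a *\<^sub>R flow_variation t x u + c *\<^sub>R flow_variation t x v" for a c u v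
  proof -
    define e where "e h = diff_quotient h t x (a *\<^sub>R u + c *\<^sub>R v) + ((- a) *\<^sub>R diff_quotient h t x u + (- c) *\<^sub>R diff_quotient h t x v)" for h
    obtain \<rho> L where \<rho>: "0 < \<rho>" "0 < L" "\<And>y s. y \<in> ball x \<rho> \<Longrightarrow> s \<in> {0..t} \<Longrightarrow> norm (Df (\<psi> s y)) \<le> L"
      "\<And>\<kappa> V. 0 < \<kappa> \<Longrightarrow> 0 < V \<Longrightarrow> \<exists>\<delta>>0. \<forall>y\<in>ball x \<rho>. \<forall>v h. norm v \<le> V \<longrightarrow> h \<noteq> 0 \<longrightarrow> \<bar>h\<bar> < \<delta> \<longrightarrow>
          approx_variational t y \<kappa> (\<lambda>t. diff_quotient h t y v)"
      using diff_quotient_approx_variational[OF assms, of x] by metis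
    obtain \<rho>' where "0 < \<rho>'" "\<And>y v s. y \<in> ball x \<rho>' \<Longrightarrow> s \<in> {0..t} \<Longrightarrow>
         (\<lambda>n. diff_quotient (1 / Suc n) s y v) \<longlonglongrightarrow> flow_variation s y v"
      using diff_quotient_uniform_limit[OF assms, of x] by metis
    then have lim: "(\<lambda>n. diff_quotient (1 / Suc n) t x v) \<longlonglongrightarrow> flow_variation t x v" for v
      using assms by simp
    have "(\<lambda>n. e (1 / Suc n)) \<longlonglongrightarrow> flow_variation t x (a *\<^sub>R u + c *\<^sub>R v)
        + ((- a) *\<^sub>R flow_variation t x u + (- c) *\<^sub>R flow_variation t x v)"
      unfolding e_def by (intro tendsto_intros lim)
    moreover have "(\<lambda>n. e (1 / Suc n)) \<longlonglongrightarrow> 0"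
    proof (rule tendstoI)
      fix r :: real assume "0 < r"
      define q where "q = 1 + (\<bar>a\<bar> + \<bar>c\<bar>)"
      define \<kappa> where "\<kappa> = r / (2 * q * exp ((L + 1) * t))"
      define V where "V = norm u + norm v + norm (a *\<^sub>R u + c *\<^sub>R v) + 1"
      have p: "0 < q" unfolding q_def by linarith
      have "0 < \<kappa>" using \<open>0 < r\<close> p by (simp add: \<kappa>_def)
      moreover have V: "0 < V" "norm u \<le> V" "norm v \<le> V" "norm (a *\<^sub>R u + c *\<^sub>R v) \<le> V"
        using norm_ge_zero[of u] norm_ge_zero[of v] norm_ge_zero[of "a *\<^sub>R u + c *\<^sub>R v"] unfolding V_def by linarith+
      ultimately obtain \<delta> where \<delta>: "0 < \<delta>" "\<And>v h. norm v \<le> V \<Longrightarrow> h \<noteq> 0 \<Longrightarrow> \<bar>h\<bar> < \<delta> \<Longrightarrow>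
          approx_variational t x \<kappa> (\<lambda>t. diff_quotient h t x v)"
        using \<rho>(4)[of \<kappa> V] \<rho>(1) by (metis centre_in_ball)
      have b: "norm (e h) < r" if "h \<noteq> 0" "\<bar>h\<bar> < \<delta>" for h
      proof -
        have "norm (e h) \<le> (\<kappa> + (\<bar>- a\<bar> * \<kappa> + \<bar>- c\<bar> * \<kappa>)) * exp ((L + 1) * t)"
          unfolding e_def
          by (rule approx_variational_small[OF approx_variational_add[OF \<delta>(2)
              approx_variational_add[OF approx_variational_scaleR[OF \<delta>(2)] approx_variational_scaleR[OF \<delta>(2)]]] _ _ \<rho>(2,3)])
            (use V that assms \<rho>(1) in auto)
        also have "\<dots> = \<kappa> * q * exp ((L + 1) * t)" by (simp add: q_def algebra_simps)
        also have "\<dots> = r / 2" using p by (simp add: \<kappa>_def)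
        finally show ?thesis using \<open>0 < r\<close> by linarith
      qed
from tendstoD[OF one_over_Suc_tendsto_0 \<delta>(1)] show "\<forall>\<^sub>F n in sequentially. dist (e (1 / Suc n)) 0 < r"
        by (rule eventually_mono) (simp add: b dist_real_def del: of_nat_Suc)
    qed
    ultimately have "flow_variation t x (a *\<^sub>R u + c *\<^sub>R v)
        + ((- a) *\<^sub>R flow_variation t x u + (- c) *\<^sub>R flow_variation t x v) = 0"
      by (rule LIMSEQ_unique)
    then show ?thesis by (simp add: algebra_simps)
  qed
  show ?thesis
  proof (rule linearI)
    show "flow_variation t x (u + v) = flow_variation t x u + flow_variation t x v" for u v
      using comb[of 1 u 1 v] by simp
    show "flow_variation t x (a *\<^sub>R u) = a *\<^sub>R flow_variation t x u" for a u
      using comb[of a u 0 0] by simp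
  qed
qed

definition D\<psi> :: "real \<Rightarrow> 'a \<Rightarrow> 'a \<Rightarrow>\<^sub>L 'a" where
  "D\<psi> t x = Blinfun (flow_variation t x)"

lemma D\<psi>_apply: "0 \<le> t \<Longrightarrow> blinfun_apply (D\<psi> t x) = flow_variation t x"
  unfolding D\<psi>_def using linear_flow_variation
  by (intro bounded_linear_Blinfun_apply) (simp add: linear_conv_bounded_linear)

text \<open>
  The convergence of the difference quotients is uniform in the unit direction, which turns directional
  derivatives into a total derivative.
\<close>

lemma flow_has_derivative:
  assumes "0 \<le> t"
  shows "(\<psi> t has_derivative blinfun_apply (D\<psi> t x)) (at x)"
  unfolding has_derivative_at_alt
proof (intro conjI allI impI)
  show "bounded_linear (blinfun_apply (D\<psi> t x))" by (rule blinfun.bounded_linear_right)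
  fix e :: real assume "0 < e"
  obtain \<rho> where "0 < \<rho>"
    "\<And>\<eta> V. 0 < \<eta> \<Longrightarrow> 0 < V \<Longrightarrow> \<exists>\<delta>>0. \<forall>y\<in>ball x \<rho>. \<forall>v s h. norm v \<le> V \<longrightarrow> s \<in> {0..t} \<longrightarrow> h \<noteq> 0 \<longrightarrow>
        \<bar>h\<bar> < \<delta> \<longrightarrow> norm (diff_quotient h s y v - flow_variation s y v) \<le> \<eta>"
    using diff_quotient_uniform_limit[OF assms, of x] by metis
  then obtain \<delta> where \<delta>: "0 < \<delta>" "\<And>v h. norm v \<le> 1 \<Longrightarrow> h \<noteq> 0 \<Longrightarrow>
        \<bar>h\<bar> < \<delta> \<Longrightarrow> norm (diff_quotient h t x v - flow_variation t x v) \<le> e"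
    using \<open>0 < e\<close> assms by (metis atLeastAtMost_iff centre_in_ball order_refl zero_less_one)
  have "norm (\<psi> t y - \<psi> t x - D\<psi> t x (y - x)) \<le> e * norm (y - x)" if "norm (y - x) < \<delta>" for y
  proof (cases "y = x")
    case False
    define h where "h = norm (y - x)"
    define v where "v = (y - x) /\<^sub>R h"
    have h: "0 < h" using False by (simp add: h_def)
    have y: "y = x + h *\<^sub>R v" using h by (simp add: v_def)
    have "norm (diff_quotient h t x v - flow_variation t x v) \<le> e"
      using h that by (intro \<delta>(2)) (auto simp: v_def h_def)
    moreover have "\<psi> t y - \<psi> t x - D\<psi> t x (y - x) = h *\<^sub>R (diff_quotient h t x v - flow_variation t x v)"
      using h by (simp add: y diff_quotient_def blinfun.scaleR_right D\<psi>_apply[OF assms] scaleR_diff_right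
          linear_cmul[OF linear_flow_variation[OF assms]])
    ultimately show ?thesis using h by (simp add: mult.commute flip: h_def)
  qed simp
  then show "\<exists>d>0. \<forall>y. norm (y - x) < d \<longrightarrow> norm (\<psi> t y - \<psi> t x - D\<psi> t x (y - x)) \<le> e * norm (y - x)"
    using \<delta>(1) by blast
qed

lemma continuous_D\<psi>: "continuous_on ({0..} \<times> UNIV) (\<lambda>(t, x). D\<psi> t x)"
proof (rule continuous_on_blinfun_componentwise)
  fix v :: 'a
  have "continuous (at (t, x) within {0..} \<times> UNIV) (\<lambda>p. flow_variation (fst p) (snd p) v)" if t: "0 \<le> t" for t x
  proof -
    have "0 \<le> t + 1" using t by simp
    then obtain \<rho> where \<rho>: "0 < \<rho>"
      "\<And>\<eta> V. 0 < \<eta> \<Longrightarrow> 0 < V \<Longrightarrow> \<exists>\<delta>>0. \<forall>y\<in>ball x \<rho>. \<forall>v s h. norm v \<le> V \<longrightarrow> s \<in> {0..t + 1} \<longrightarrow> h \<noteq> 0 \<longrightarrow>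
        \<bar>h\<bar> < \<delta> \<longrightarrow> norm (diff_quotient h s y v - flow_variation s y v) \<le> \<eta>"
      using diff_quotient_uniform_limit[of "t + 1" x] by metis
    define S where "S = {0..t + 1} \<times> ball x \<rho>"
    have "continuous_on S (\<lambda>p. flow_variation (fst p) (snd p) v)"
    proof (rule uniform_limit_theorem)
      have "continuous_on S (\<lambda>p. diff_quotient (1 / Suc n) (fst p) (snd p) v)" for n
        unfolding diff_quotient_def
        by (intro continuous_intros continuous_on_compose2[OF continuous_flow, where f = "\<lambda>p. (fst p, _ p)", unfolded split_beta fst_conv snd_conv])
          (auto simp: S_def)
      then show "\<forall>\<^sub>F n in sequentially. continuous_on S (\<lambda>p. diff_quotient (1 / Suc n) (fst p) (snd p) v)" by simp
      show "uniform_limit S (\<lambda>n p. diff_quotient (1 / Suc n) (fst p) (snd p) v) (\<lambda>p. flow_variation (fst p) (snd p) v) sequentially"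
      proof (rule uniform_limitI)
        fix e :: real assume "0 < e"
        then obtain \<delta> where \<delta>: "0 < \<delta>" "\<And>y s h. y \<in> ball x \<rho> \<Longrightarrow> s \<in> {0..t + 1} \<Longrightarrow> h \<noteq> 0 \<Longrightarrow>
           \<bar>h\<bar> < \<delta> \<Longrightarrow> norm (diff_quotient h s y v - flow_variation s y v) \<le> e / 2"
          using \<rho>(2)[of "e / 2" "norm v + 1"] norm_ge_zero[of v] by (smt (verit) half_gt_zero)
from tendstoD[OF one_over_Suc_tendsto_0 \<delta>(1)] show "\<forall>\<^sub>F n in sequentially. \<forall>p\<in>S.
           dist (diff_quotient (1 / Suc n) (fst p) (snd p) v) (flow_variation (fst p) (snd p) v) < e"
        proof (rule eventually_mono, intro ballI)
          fix n p assume n: "dist (1 / real (Suc n)) 0 < \<delta>" and p: "p \<in> S"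
          have "norm (diff_quotient (1 / Suc n) (fst p) (snd p) v - flow_variation (fst p) (snd p) v) \<le> e / 2"
            using n p by (intro \<delta>(2)) (auto simp: S_def dist_real_def simp del: of_nat_Suc)
          with \<open>0 < e\<close> show "dist (diff_quotient (1 / Suc n) (fst p) (snd p) v) (flow_variation (fst p) (snd p) v) < e"
            by (simp add: dist_norm)
        qed
      qed
    qed simp
    then have "continuous (at (t, x) within S) (\<lambda>p. flow_variation (fst p) (snd p) v)"
      using t \<rho>(1) by (simp add: continuous_on_eq_continuous_within S_def)
    moreover have "at (t, x) within S = at (t, x) within ({0..} \<times> UNIV)"
      using \<rho>(1) by (intro at_within_nhd[of _ "{..<t + 1} \<times> ball x \<rho>"] open_Times) (auto simp: S_def)
    ultimately show ?thesis by simp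
  qed
  then have "continuous_on ({0..} \<times> UNIV) (\<lambda>p. flow_variation (fst p) (snd p) v)"
    by (auto simp: continuous_on_eq_continuous_within)
  then show "continuous_on ({0..} \<times> UNIV) (\<lambda>p. blinfun_apply (case p of (t, x) \<Rightarrow> D\<psi> t x) v)"
    by (subst continuous_on_cong[OF refl]) (auto simp: D\<psi>_apply)
qed

lemma continuous_D\<psi>_at: "0 \<le> t \<Longrightarrow> continuous_on S (D\<psi> t)"
  using continuous_on_compose2[OF continuous_D\<psi>, of S "\<lambda>x. (t, x)"]
  by (simp add: continuous_on_Pair image_subset_iff)

lemma D\<psi>_0 [simp]: "D\<psi> 0 x = id_blinfun"
proof (rule blinfun_eqI)
  have "((\<lambda>x. x) has_derivative blinfun_apply (D\<psi> 0 x)) (at x)"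
    using flow_has_derivative[of 0 x] by (simp add: fun_eq_iff[THEN iffD2, of "\<psi> 0" "\<lambda>x. x"])
  then show "D\<psi> 0 x v = id_blinfun v" for v
    using has_derivative_unique[OF _ has_derivative_ident] by (metis id_blinfun.rep_eq)
qed

lemma D\<psi>_add:
  assumes "0 \<le> s" "0 \<le> t"
  shows "D\<psi> (s + t) x v = D\<psi> s (\<psi> t x) (D\<psi> t x v)"
proof -
  have "(\<lambda>y. \<psi> s (\<psi> t y)) = \<psi> (s + t)" by (simp add: flow_add fun_eq_iff)
  with has_derivative_compose[OF flow_has_derivative[OF assms(2)] flow_has_derivative[OF assms(1)], of x]
  have "(\<psi> (s + t) has_derivative (\<lambda>v. D\<psi> s (\<psi> t x) (D\<psi> t x v))) (at x)" by simp
  with flow_has_derivative[of "s + t" x] assms show ?thesis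
    by (metis add_nonneg_nonneg has_derivative_unique)
qed

text \<open>
  Differentiate \<open>\<psi> t (\<psi> s x) = \<psi> s (\<psi> t x)\<close> with respect to \<open>s\<close> at zero.
\<close>

lemma D\<psi>_f:
  assumes "0 \<le> t"
  shows "D\<psi> t x (f x) = f (\<psi> t x)"
proof -
  have "((\<lambda>s. \<psi> t (\<psi> s x)) has_derivative (\<lambda>h. D\<psi> t (\<psi> 0 x) (h *\<^sub>R f (\<psi> 0 x)))) (at 0)"
    by (rule has_derivative_compose[OF flow_has_vector_derivative[unfolded has_vector_derivative_def] flow_has_derivative[OF assms]])
  then have "((\<lambda>s. \<psi> t (\<psi> s x)) has_vector_derivative D\<psi> t x (f x)) (at 0)"
    by (simp add: has_vector_derivative_def blinfun.scaleR_right)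
  moreover have "(\<lambda>s. \<psi> t (\<psi> s x)) = (\<lambda>s. \<psi> s (\<psi> t x))"
    by (metis add.commute flow_add)
  ultimately have "((\<lambda>s. \<psi> s (\<psi> t x)) has_vector_derivative D\<psi> t x (f x)) (at 0)" by simp
  with flow_has_vector_derivative[of "\<psi> t x" 0] show ?thesis
    using vector_derivative_unique_at by fastforce
qed

end

section \<open>Transport transverse to the orbits\<close>

lemma linear_norm_le_Basis:
  fixes L :: "'a::euclidean_space \<Rightarrow> 'b::real_normed_vector"
  assumes "linear L"
  shows "norm (L v) \<le> (\<Sum>e\<in>Basis. norm (L e)) * norm v"
proof -
  have bl: "bounded_linear L" using assms by (simp add: linear_conv_bounded_linear)
  have "norm (L v) \<le> onorm L * norm v" by (rule onorm[OF bl])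
  also have "\<dots> \<le> (\<Sum>e\<in>Basis. norm (L e)) * norm v"
    by (intro mult_right_mono onorm_componentwise[OF bl]) simp
  finally show ?thesis .
qed

text \<open>
  Halving once per time \<open>\<tau>\<close> amounts to decay at rate \<open>ln 2 / \<tau>\<close>; the factor two pays for the
  incomplete last period.
\<close>

lemma time_in_periods:
  fixes \<tau> t :: real
  assumes "0 < \<tau>" "0 \<le> t"
  obtains k :: nat and s where "t = s + real k * \<tau>" "0 \<le> s" "s \<le> \<tau>" "(1/2) ^ k \<le> 2 * exp (- (ln 2 / \<tau>) * t)"
proof
  define k where "k = nat \<lfloor>t / \<tau>\<rfloor>"
  define s where "s = t - real k * \<tau>"
  have k: "real k \<le> t / \<tau>" "t / \<tau> < real k + 1"
    using assms by (simp_all add: k_def)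
  show "t = s + real k * \<tau>" by (simp add: s_def)
  show "0 \<le> s" "s \<le> \<tau>" using k assms by (simp_all add: s_def field_simps)
  have "(1/2) ^ k = exp (- ln 2 * real k)"
    by (simp add: exp_minus exp_of_nat2_mult power_one_over inverse_eq_divide)
  also have "\<dots> \<le> exp (ln 2 + - (ln 2 / \<tau>) * t)"
  proof -
    have "ln 2 * (t / \<tau>) \<le> ln 2 * (real k + 1)" using k by (intro mult_left_mono) auto
    then show ?thesis by (simp add: algebra_simps)
  qed
  also have "\<dots> = 2 * exp (- (ln 2 / \<tau>) * t)" by (simp only: exp_add) simp
  finally show "(1/2) ^ k \<le> 2 * exp (- (ln 2 / \<tau>) * t)" .
qed

context complete_C1_flow
begin

lemma flow_equilibrium: "f y = 0 \<Longrightarrow> \<psi> s y = y"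
  using ode_unique[OF f_has_derivative continuous_Df, of "\<lambda>s. \<psi> s y" "\<lambda>_. y" s] flow_has_vector_derivative
  by simp

lemma f_flow_eq_0_iff: "f (\<psi> t y) = 0 \<longleftrightarrow> f y = 0"
proof
  assume "f (\<psi> t y) = 0"
  then have "\<psi> (- t) (\<psi> t y) = \<psi> t y" by (rule flow_equilibrium)
  then have "y = \<psi> t y" by (simp flip: flow_add)
  with \<open>f (\<psi> t y) = 0\<close> show "f y = 0" by simp
qed (simp add: flow_equilibrium)

lemma D\<psi>_bounded_on_compact:
  assumes "compact C"
  obtains M where "0 < M" "\<And>s x v. 0 \<le> s \<Longrightarrow> s \<le> b \<Longrightarrow> x \<in> C \<Longrightarrow> norm (D\<psi> s x v) \<le> M * norm v"
proof -
  have "continuous_on ({0..b} \<times> C) (\<lambda>(t, x). D\<psi> t x)"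
    using continuous_D\<psi> by (rule continuous_on_subset) auto
  moreover have "compact ({0..b} \<times> C)" using assms by (intro compact_Times) auto
  ultimately obtain M where M: "0 < M" "\<And>p. p \<in> {0..b} \<times> C \<Longrightarrow> norm (case p of (t, x) \<Rightarrow> D\<psi> t x) \<le> M"
    by (rule continuous_imp_bounded_on_compact) blast
  show thesis
  proof (rule that[OF M(1)])
    fix s x v assume "0 \<le> s" "s \<le> b" "x \<in> C"
    then have "norm (D\<psi> s x) \<le> M" using M(2)[of "(s, x)"] by simp
    then show "norm (D\<psi> s x v) \<le> M * norm v"
      using norm_blinfun[of "D\<psi> s x" v] mult_right_mono[OF _ norm_ge_zero] order_trans by blast
  qed
qed

definition along :: "'a \<Rightarrow> 'a \<Rightarrow> real" where
  "along x v = (v \<bullet> f x) / (f x \<bullet> f x)"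

definition normal_part :: "'a \<Rightarrow> 'a \<Rightarrow> 'a" where
  "normal_part x v = v - along x v *\<^sub>R f x"

lemma linear_along: "linear (along x)"
  by (rule linearI) (simp_all add: along_def inner_add_left add_divide_distrib)

lemma linear_normal_part: "linear (normal_part x)"
  unfolding normal_part_def
  by (rule linearI) (simp_all add: linear_add[OF linear_along] linear_cmul[OF linear_along] algebra_simps)

lemma along_f: "f x \<noteq> 0 \<Longrightarrow> along x (f x) = 1"
  by (simp add: along_def)

lemma normal_part_f [simp]: "normal_part x (f x) = 0"
  by (cases "f x = 0") (simp_all add: normal_part_def along_f)

lemma normal_decomposition: "v = normal_part x v + along x v *\<^sub>R f x"
  by (simp add: normal_part_def)

lemma norm_normal_part_le: "norm (normal_part x v) \<le> norm v"
proof -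
  have "normal_part x v \<bullet> f x = 0"
    by (cases "f x = 0") (simp_all add: normal_part_def along_def inner_diff_left)
  then have "normal_part x v \<bullet> normal_part x v = normal_part x v \<bullet> v"
    by (subst (3) normal_decomposition[of v x]) (simp add: inner_add_right)
  then have "norm (normal_part x v) * norm (normal_part x v) \<le> norm (normal_part x v) * norm v"
    using norm_cauchy_schwarz[of "normal_part x v" v] by (simp add: power2_norm_eq_inner flip: power2_eq_square)
  then show ?thesis by (cases "normal_part x v = 0") simp_all
qed

lemma norm_along_le: "f x \<noteq> 0 \<Longrightarrow> \<bar>along x v\<bar> \<le> norm v / norm (f x)"
  using Cauchy_Schwarz_ineq2[of v "f x"]
  by (simp add: along_def abs_divide divide_simps power2_norm_eq_inner flip: power2_eq_square)
    (simp add: power2_eq_square mult_left_mono flip: power2_norm_eq_inner)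

lemma continuous_on_along:
  assumes "continuous_on S g" "continuous_on S h" "\<And>p. p \<in> S \<Longrightarrow> f (g p) \<noteq> 0"
  shows "continuous_on S (\<lambda>p. along (g p) (h p))"
  unfolding along_def using assms
  by (intro continuous_intros continuous_on_compose2[OF continuous_f[of UNIV] assms(1)]) auto

text \<open>
  The linear Poincare flow: transport, followed by orthogonal projection along the vector field.
\<close>

definition Q\<psi> :: "real \<Rightarrow> 'a \<Rightarrow> 'a \<Rightarrow> 'a" where
  "Q\<psi> t x v = normal_part (\<psi> t x) (D\<psi> t x v)"

text \<open>
  The constant \<open>B\<close> and the compact set \<open>C\<close> that contains the trajectories may depend on
  \<open>x0\<close>, but serve all points near \<open>x0\<close> at once.
\<close>

definition locally_contracting :: "'a set \<Rightarrow> real \<Rightarrow> 'a \<Rightarrow> bool" where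
  "locally_contracting X c x0 \<longleftrightarrow>
     (\<exists>d B C. 0 < d \<and> 0 < B \<and> compact C \<and> ball x0 d \<subseteq> X \<and> (\<forall>x\<in>C. f x \<noteq> 0) \<and>
       (\<forall>x\<in>ball x0 d. \<forall>t\<ge>0. \<psi> t x \<in> C \<and> (\<forall>v. norm (Q\<psi> t x v) \<le> B * exp (- c * t) * norm v)))"

lemma linear_Q\<psi>: "linear (Q\<psi> t x)"
  unfolding Q\<psi>_def by (rule linearI)
    (simp_all add: linear_add[OF linear_normal_part] linear_cmul[OF linear_normal_part] blinfun.add_right blinfun.scaleR_right)

lemma norm_Q\<psi>_le: "norm (Q\<psi> t x v) \<le> norm (D\<psi> t x v)"
  unfolding Q\<psi>_def by (rule norm_normal_part_le)

text \<open>
  The cocycle property survives the projection because the removed multiple of \<open>f\<close> is transported to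
  a multiple of \<open>f\<close>, which the next projection removes as well.
\<close>

lemma Q\<psi>_add:
  assumes "0 \<le> s" "0 \<le> t"
  shows "Q\<psi> (s + t) x v = Q\<psi> s (\<psi> t x) (Q\<psi> t x v)"
proof -
  have "D\<psi> (s + t) x v = D\<psi> s (\<psi> t x) (normal_part (\<psi> t x) (D\<psi> t x v) + along (\<psi> t x) (D\<psi> t x v) *\<^sub>R f (\<psi> t x))"
    using D\<psi>_add[OF assms] normal_decomposition by metis
  also have "\<dots> = D\<psi> s (\<psi> t x) (Q\<psi> t x v) + along (\<psi> t x) (D\<psi> t x v) *\<^sub>R f (\<psi> (s + t) x)"
    using D\<psi>_f[OF assms(1)] by (simp add: blinfun.add_right blinfun.scaleR_right Q\<psi>_def flow_add)
  finally show ?thesis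
    by (simp add: Q\<psi>_def flow_add linear_add[OF linear_normal_part] linear_cmul[OF linear_normal_part])
qed

end

section \<open>The return map of the cycle\<close>

text \<open>
  The last condition is the form in which hyperbolic stability enters: in the long run the monodromy map
  retains only the component along the vector field. Stated with real limits, it makes no
  reference to eigenvalues.
\<close>

locale attracting_cycle = complete_C1_flow f \<psi> Df
  for f :: "'a::euclidean_space \<Rightarrow> 'a" and \<psi> Df +
  fixes \<Gamma> :: "'a set" and p :: 'a and T :: real
  assumes T_pos: "0 < T" and cycle_eq: "\<Gamma> = range (\<lambda>t. \<psi> t p)" and periodic: "\<psi> T p = p"
    and f_p: "f p \<noteq> 0"
    and monodromy_limit: "\<And>v. \<exists>c. (\<lambda>k. (blinfun_apply (D\<psi> T p) ^^ k) v) \<longlonglongrightarrow> c *\<^sub>R f p"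
begin

lemma flow_periods: "\<psi> (real k * T) p = p"
proof (induction k)
  case (Suc k)
  have "\<psi> (real (Suc k) * T) p = \<psi> (real k * T + T) p" by (simp add: algebra_simps)
  then show ?case by (simp only: flow_add periodic Suc)
qed simp

lemma cycle_eq_image: "\<Gamma> = (\<lambda>t. \<psi> t p) ` {0..T}"
proof
  show "\<Gamma> \<subseteq> (\<lambda>t. \<psi> t p) ` {0..T}"
  proof
    fix y assume "y \<in> \<Gamma>"
    then obtain t where t: "y = \<psi> t p" using cycle_eq by auto
    define k where "k = \<lfloor>t / T\<rfloor>"
    define s where "s = t - of_int k * T"
    have "of_int k \<le> t / T" "t / T < of_int k + 1" by (simp_all add: k_def)
    then have s: "s \<in> {0..T}" using T_pos by (simp add: s_def field_simps)
    have "\<psi> (of_int k * T) p = p"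
    proof (cases "0 \<le> k")
      case True
      then show ?thesis using flow_periods[of "nat k"] by simp
    next
      case False
      then have "\<psi> (of_int k * T) p = \<psi> (of_int k * T) (\<psi> (real (nat (- k)) * T) p)"
        by (simp only: flow_periods)
      also have "\<dots> = \<psi> 0 p" using False by (simp flip: flow_add)
      finally show ?thesis by simp
    qed
    then have "y = \<psi> s p"
      using flow_add[of s "of_int k * T" p] by (simp add: t s_def)
    with s show "y \<in> (\<lambda>t. \<psi> t p) ` {0..T}" by blast
  qed
qed (auto simp: cycle_eq)

lemma compact_cycle: "compact \<Gamma>"
  unfolding cycle_eq_image by (intro compact_continuous_image continuous_flow_time) auto

lemma closed_cycle: "closed \<Gamma>"
  using compact_cycle by (rule compact_imp_closed)

lemma p_in_cycle: "p \<in> \<Gamma>"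
  unfolding cycle_eq by (rule range_eqI[of _ _ 0]) simp

lemma cycle_nonempty: "\<Gamma> \<noteq> {}"
  using p_in_cycle by blast

lemma flow_in_cycle: "y \<in> \<Gamma> \<Longrightarrow> \<psi> t y \<in> \<Gamma>"
  unfolding cycle_eq by (auto simp flip: flow_add)

lemma f_cycle: "y \<in> \<Gamma> \<Longrightarrow> f y \<noteq> 0"
  unfolding cycle_eq using f_p f_flow_eq_0_iff by auto

lemma flow_periods_cycle: "y \<in> \<Gamma> \<Longrightarrow> \<psi> (real k * T) y = y"
proof -
  assume "y \<in> \<Gamma>"
  then obtain t where y: "y = \<psi> t p" unfolding cycle_eq by blast
  have "\<psi> (real k * T) (\<psi> t p) = \<psi> t (\<psi> (real k * T) p)" by (simp only: flow_add[symmetric] add.commute)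
  then show ?thesis by (simp only: y flow_periods)
qed

lemma D\<psi>_periods: "D\<psi> (real k * T) p v = (blinfun_apply (D\<psi> T p) ^^ k) v"
proof (induction k)
  case (Suc k)
  have "D\<psi> (real (Suc k) * T) p v = D\<psi> (T + real k * T) p v" by (simp add: algebra_simps)
  then show ?case using T_pos Suc by (simp add: D\<psi>_add flow_periods)
qed simp

lemma return_map_contracts_at_p:
  assumes "0 < \<epsilon>"
  shows "\<exists>k. \<forall>v. norm (Q\<psi> (real k * T) p v) \<le> \<epsilon> * norm v"
proof -
  have "(\<lambda>k. Q\<psi> (real k * T) p e) \<longlonglongrightarrow> 0" for e
  proof -
    obtain c where c: "(\<lambda>k. (blinfun_apply (D\<psi> T p) ^^ k) e) \<longlonglongrightarrow> c *\<^sub>R f p" using monodromy_limit by blast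
    have "bounded_linear (normal_part p)"
      using linear_normal_part by (simp add: linear_conv_bounded_linear)
    from bounded_linear.tendsto[OF this c] show ?thesis
      by (simp add: Q\<psi>_def flow_periods D\<psi>_periods linear_cmul[OF linear_normal_part])
  qed
  then have "(\<lambda>k. \<Sum>e\<in>Basis. norm (Q\<psi> (real k * T) p e)) \<longlonglongrightarrow> (\<Sum>e\<in>(Basis :: 'a set). norm (0 :: 'a))"
    by (intro tendsto_intros)
  then have "(\<lambda>k. \<Sum>e\<in>Basis. norm (Q\<psi> (real k * T) p e)) \<longlonglongrightarrow> 0" by simp
  from tendstoD[OF this assms] obtain k where "\<bar>\<Sum>e\<in>Basis. norm (Q\<psi> (real k * T) p e)\<bar> < \<epsilon>"
    unfolding eventually_sequentially dist_real_def diff_0_right by blast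
  then have k: "(\<Sum>e\<in>Basis. norm (Q\<psi> (real k * T) p e)) \<le> \<epsilon>" by linarith
  have "norm (Q\<psi> (real k * T) p v) \<le> \<epsilon> * norm v" for v
    using linear_norm_le_Basis[OF linear_Q\<psi>] mult_right_mono[OF k norm_ge_zero] order_trans by blast
  then show ?thesis by blast
qed

text \<open>
  A round trip from \<open>y\<close> consists of the way to \<open>p\<close>, many periods at \<open>p\<close>, and the way back to
  \<open>y\<close>. The outer two are bounded uniformly over the cycle, so the contraction at \<open>p\<close> wins uniformly.
\<close>

lemma return_map_contracts_on_cycle:
  assumes "0 < \<epsilon>"
  obtains k where "0 < k" "\<And>y v. y \<in> \<Gamma> \<Longrightarrow> norm (Q\<psi> (real k * T) y v) \<le> \<epsilon> * norm v"
proof -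
  obtain M where M: "0 < M" "\<And>s x v. 0 \<le> s \<Longrightarrow> s \<le> T \<Longrightarrow> x \<in> \<Gamma> \<Longrightarrow> norm (D\<psi> s x v) \<le> M * norm v"
    using D\<psi>_bounded_on_compact[OF compact_cycle, of T] by metis
  have MQ: "norm (Q\<psi> s x v) \<le> M * norm v" if "0 \<le> s" "s \<le> T" "x \<in> \<Gamma>" for s x v
    using norm_Q\<psi>_le M(2)[OF that] order_trans by blast
  obtain k where k: "\<And>v. norm (Q\<psi> (real k * T) p v) \<le> \<epsilon> / (M * M) * norm v"
    using return_map_contracts_at_p[of "\<epsilon> / (M * M)"] assms M(1) by auto
  have "norm (Q\<psi> (real (Suc k) * T) y v) \<le> \<epsilon> * norm v" if y: "y \<in> \<Gamma>" for y v
  proof -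
    obtain s where s: "0 \<le> s" "s \<le> T" "y = \<psi> s p" using y[unfolded cycle_eq_image] by auto
    have return_p: "\<psi> (T - s) y = p" using periodic by (simp add: s(3) flip: flow_add)
    have "real (Suc k) * T = s + (real k * T + (T - s))" by (simp add: algebra_simps)
    then have "Q\<psi> (real (Suc k) * T) y v = Q\<psi> (s + (real k * T + (T - s))) y v" by (simp only:)
    also have "\<dots> = Q\<psi> s (\<psi> (real k * T + (T - s)) y) (Q\<psi> (real k * T + (T - s)) y v)"
      using s T_pos by (intro Q\<psi>_add) auto
    also have "\<psi> (real k * T + (T - s)) y = p" by (simp only: flow_add return_p flow_periods)
    also have "Q\<psi> (real k * T + (T - s)) y v = Q\<psi> (real k * T) (\<psi> (T - s) y) (Q\<psi> (T - s) y v)"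
      using s T_pos by (intro Q\<psi>_add) auto
    finally have "Q\<psi> (real (Suc k) * T) y v = Q\<psi> s p (Q\<psi> (real k * T) p (Q\<psi> (T - s) y v))"
      by (simp only: return_p)
    also have "norm \<dots> \<le> M * norm (Q\<psi> (real k * T) p (Q\<psi> (T - s) y v))"
      using s p_in_cycle by (intro MQ) auto
    also have "\<dots> \<le> M * (\<epsilon> / (M * M) * norm (Q\<psi> (T - s) y v))"
      using M(1) k by (intro mult_left_mono) auto
    also have "\<dots> \<le> M * (\<epsilon> / (M * M) * (M * norm v))"
      using M(1) assms s y by (intro mult_left_mono MQ) auto
    also have "\<dots> = \<epsilon> * norm v" using M(1) by simp
    finally show ?thesis .
  qed
  then show thesis by (intro that[of "Suc k"]) auto
qed

lemma flow_along_cycle_linear_approximation: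
  assumes "0 < \<eta>"
  obtains \<delta> where "0 < \<delta>" "\<And>y a. y \<in> \<Gamma> \<Longrightarrow> \<bar>a\<bar> < \<delta> \<Longrightarrow> norm (\<psi> a y - y - a *\<^sub>R f y) \<le> \<eta> * \<bar>a\<bar>"
proof -
  have "uniformly_continuous_on {-1..T + 1} (\<lambda>s. f (\<psi> s p))"
    by (intro compact_uniformly_continuous continuous_on_compose2[OF continuous_f[of UNIV]] continuous_flow_time) auto
  then obtain d where d: "0 < d" "\<And>s s'. s \<in> {-1..T + 1} \<Longrightarrow> s' \<in> {-1..T + 1} \<Longrightarrow> dist s' s < d \<Longrightarrow>
      dist (f (\<psi> s' p)) (f (\<psi> s p)) < \<eta>"
    using assms unfolding uniformly_continuous_on_def by metis
  have "norm (\<psi> a y - y - a *\<^sub>R f y) \<le> \<eta> * \<bar>a\<bar>" if y: "y \<in> \<Gamma>" and a: "\<bar>a\<bar> < min d 1" for y a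
  proof -
    obtain \<sigma> where \<sigma>: "\<sigma> \<in> {0..T}" "y = \<psi> \<sigma> p" using y[unfolded cycle_eq_image] by auto
    have "norm (\<psi> a y - \<psi> 0 y - (a - 0) *\<^sub>R f (\<psi> 0 y)) \<le> norm (a - 0) * \<eta>"
    proof (rule vector_differentiable_bound_linearization[where S = "closed_segment 0 a" and f' = "\<lambda>s. f (\<psi> s y)"])
      fix s assume "s \<in> closed_segment 0 a"
      then have s: "\<bar>s\<bar> \<le> \<bar>a\<bar>" by (auto simp: closed_segment_eq_real_ivl split: if_splits)
      show "((\<lambda>t. \<psi> t y) has_vector_derivative f (\<psi> s y)) (at s within closed_segment 0 a)"
        using flow_has_vector_derivative by (rule has_vector_derivative_at_within)
      have "dist (f (\<psi> (s + \<sigma>) p)) (f (\<psi> \<sigma> p)) < \<eta>"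
        using s a \<sigma> by (intro d(2)) (auto simp: dist_real_def)
      then show "norm (f (\<psi> s y) - f (\<psi> 0 y)) \<le> \<eta>"
        by (simp add: \<sigma>(2) flow_add dist_norm)
    qed auto
    then show ?thesis by (simp add: mult.commute)
  qed
  then show thesis using d(1) by (intro that[of "min d 1"]) auto
qed

lemma short_time_infdist:
  obtains M where "1 \<le> M"
    "\<And>x s. infdist x \<Gamma> \<le> 1 \<Longrightarrow> 0 \<le> s \<Longrightarrow> s \<le> \<tau> \<Longrightarrow> infdist (\<psi> s x) \<Gamma> \<le> M * infdist x \<Gamma>"
proof -
  define C where "C = {x. infdist x \<Gamma> \<le> 1}"
  have "compact C" unfolding C_def by (intro compact_infdist_le cycle_nonempty compact_cycle) simp
  then obtain M where M: "0 < M" "\<And>s x v. 0 \<le> s \<Longrightarrow> s \<le> \<tau> \<Longrightarrow> x \<in> C \<Longrightarrow> norm (D\<psi> s x v) \<le> M * norm v"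
    using D\<psi>_bounded_on_compact[of C \<tau>] by metis
  have "infdist (\<psi> s x) \<Gamma> \<le> max M 1 * infdist x \<Gamma>" if x: "infdist x \<Gamma> \<le> 1" and s: "0 \<le> s" "s \<le> \<tau>" for x s
  proof -
    obtain y where y: "y \<in> \<Gamma>" "infdist x \<Gamma> = dist x y"
      using infdist_attains_inf[OF closed_cycle cycle_nonempty] by metis
    have "norm (\<psi> s x - \<psi> s y) \<le> M * norm (x - y)"
    proof (rule differentiable_bound[of "cball y 1" "\<psi> s" "\<lambda>z. blinfun_apply (D\<psi> s z)"])
      show "(\<psi> s has_derivative blinfun_apply (D\<psi> s z)) (at z within cball y 1)" for z
        using flow_has_derivative[OF s(1)] by (rule has_derivative_at_withinI)
      show "onorm (blinfun_apply (D\<psi> s z)) \<le> M" if "z \<in> cball y 1" for z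
      proof (rule onorm_bound)
        have "z \<in> C" using that y(1) by (auto simp: C_def dist_commute intro: infdist_le2)
        then show "norm (D\<psi> s z v) \<le> M * norm v" for v using M(2) s by blast
      qed (use M in simp)
      show "x \<in> cball y 1" using x y by (simp add: dist_commute)
    qed auto
    then have "infdist (\<psi> s x) \<Gamma> \<le> M * infdist x \<Gamma>"
      using infdist_le[OF flow_in_cycle[OF y(1)], of "\<psi> s x" s] y(2) by (simp add: dist_norm)
    also have "\<dots> \<le> max M 1 * infdist x \<Gamma>" by (intro mult_right_mono infdist_nonneg) simp
    finally show ?thesis .
  qed
  then show thesis by (intro that[of "max M 1"]) auto
qed

text \<open>
  Let \<open>y\<close> be a point of the cycle nearest to \<open>x\<close>. To first order the return map moves \<open>x\<close> to
  \<open>y\<close> plus a strongly contracted transverse displacement plus a multiple \<open>a\<close> of \<open>f y\<close>, and up to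
  another first-order error the latter only shifts the base point to \<open>\<psi> a y\<close>, which is still on the
  cycle. The three contributions to the new distance are \<open>1/4 + 1/8 + 1/8\<close> of the old one.
\<close>

lemma return_map_halves:
  obtains \<tau> \<delta> where "0 < \<tau>" "0 < \<delta>"
    "\<And>x. infdist x \<Gamma> \<le> \<delta> \<Longrightarrow> f x \<noteq> 0"
    "\<And>x v. infdist x \<Gamma> \<le> \<delta> \<Longrightarrow> norm (Q\<psi> \<tau> x v) \<le> norm v / 2"
    "\<And>x. infdist x \<Gamma> \<le> \<delta> \<Longrightarrow> infdist (\<psi> \<tau> x) \<Gamma> \<le> infdist x \<Gamma> / 2"
proof -
  \<comment> \<open>the dimension makes the sum over the basis, which bounds the operator norm near the cycle, small\<close>
  define \<epsilon> where "\<epsilon> = 1 / (4 * real DIM('a))"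
  have \<epsilon>: "0 < \<epsilon>" "\<epsilon> \<le> 1 / 4" using DIM_positive[where 'a = 'a] by (simp_all add: \<epsilon>_def divide_simps)
  obtain k where k: "0 < k" "\<And>y v. y \<in> \<Gamma> \<Longrightarrow> norm (Q\<psi> (real k * T) y v) \<le> \<epsilon> * norm v"
    using return_map_contracts_on_cycle[OF \<epsilon>(1)] by metis
  define \<tau> where "\<tau> = real k * T"
  have \<tau>: "0 < \<tau>" "\<And>y. y \<in> \<Gamma> \<Longrightarrow> \<psi> \<tau> y = y"
    using k(1) T_pos flow_periods_cycle by (simp_all add: \<tau>_def)
  have Q: "norm (Q\<psi> \<tau> y v) \<le> \<epsilon> * norm v" if "y \<in> \<Gamma>" for y v
    using k(2)[OF that] by (simp add: \<tau>_def)

  define q where "q y = (\<Sum>e\<in>Basis. norm (Q\<psi> \<tau> y e))" for y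
  define U where "U = {y. f y \<noteq> 0}"
  have "open U" unfolding U_def by (intro open_Collect_neq continuous_f continuous_on_const)
  have "continuous_on U q"
    unfolding q_def Q\<psi>_def normal_part_def
    using \<tau>(1) by (intro continuous_intros continuous_on_along continuous_flow_at continuous_D\<psi>_at
        continuous_on_compose2[OF continuous_f[of UNIV]]) (auto simp: U_def f_flow_eq_0_iff)
  then have "open (U \<inter> q -` {..<1/2})"
    using \<open>open U\<close> by (simp add: continuous_on_open_vimage Int_commute)
  moreover have "\<Gamma> \<subseteq> U \<inter> q -` {..<1/2}"
  proof
    fix y assume y: "y \<in> \<Gamma>"
    have "q y \<le> (\<Sum>e\<in>(Basis :: 'a set). \<epsilon>)"
      unfolding q_def using Q[OF y] by (intro sum_mono) (metis mult.right_neutral norm_Basis)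
    also have "\<dots> < 1 / 2" by (simp add: \<epsilon>_def)
    finally show "y \<in> U \<inter> q -` {..<1/2}" using f_cycle[OF y] by (simp add: U_def)
  qed
  ultimately obtain \<delta>1 where \<delta>1: "0 < \<delta>1" "{x. infdist x \<Gamma> \<le> \<delta>1} \<subseteq> U \<inter> q -` {..<1/2}"
    using compact_in_open_separated[OF cycle_nonempty compact_cycle] by metis
  have nbhd: "f x \<noteq> 0" "norm (Q\<psi> \<tau> x v) \<le> norm v / 2" if "infdist x \<Gamma> \<le> \<delta>1" for x v
  proof -
    have x: "f x \<noteq> 0" "q x < 1 / 2" using \<delta>1(2) that by (auto simp: U_def)
    then show "f x \<noteq> 0" by simp
    have "norm (Q\<psi> \<tau> x v) \<le> q x * norm v"
      unfolding q_def by (rule linear_norm_le_Basis[OF linear_Q\<psi>])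
    also have "\<dots> \<le> 1 / 2 * norm v" using x by (intro mult_right_mono) auto
    finally show "norm (Q\<psi> \<tau> x v) \<le> norm v / 2" by simp
  qed

  obtain M where M: "0 < M" "\<And>x v. x \<in> \<Gamma> \<Longrightarrow> norm (D\<psi> \<tau> x v) \<le> M * norm v"
    using D\<psi>_bounded_on_compact[OF compact_cycle, of \<tau>] \<tau>(1) by (metis less_imp_le order_refl)
  have "continuous_on \<Gamma> (\<lambda>y. 1 / norm (f y))"
    by (intro continuous_intros continuous_f) (auto dest: f_cycle)
  then obtain m where m: "0 < m" "\<And>y. y \<in> \<Gamma> \<Longrightarrow> norm (1 / norm (f y)) \<le> m"
    using compact_cycle by (rule continuous_imp_bounded_on_compact) blast
  \<comment> \<open>the phase shift \<open>a\<close> below is at most \<open>M * m\<close> times the distance\<close>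
  define \<eta> where "\<eta> = 1 / (8 * M * m)"
  have \<eta>: "0 < \<eta>" using M m by (simp add: \<eta>_def)
  obtain \<delta>2 where \<delta>2: "0 < \<delta>2" "\<And>y a. y \<in> \<Gamma> \<Longrightarrow> \<bar>a\<bar> < \<delta>2 \<Longrightarrow> norm (\<psi> a y - y - a *\<^sub>R f y) \<le> \<eta> * \<bar>a\<bar>"
    using flow_along_cycle_linear_approximation[OF \<eta>] by metis
  obtain \<delta>3 where \<delta>3: "0 < \<delta>3" "\<And>y x. y \<in> \<Gamma> \<Longrightarrow> norm (x - y) < \<delta>3 \<Longrightarrow>
      norm (\<psi> \<tau> x - \<psi> \<tau> y - D\<psi> \<tau> y (x - y)) \<le> 1 / 8 * norm (x - y)"
    using uniform_linear_approximation[OF flow_has_derivative continuous_D\<psi>_at compact_cycle, of \<tau> "1/8"] \<tau>(1)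
    by (metis less_imp_le zero_less_divide_1_iff zero_less_numeral)
  define \<delta> where "\<delta> = min \<delta>1 (min (\<delta>3 / 2) (\<delta>2 / (2 * M * m)))"
  have \<delta>: "0 < \<delta>" "\<delta> \<le> \<delta>1" "\<delta> < \<delta>3" "M * m * \<delta> < \<delta>2"
  proof -
    show "0 < \<delta>" using \<delta>1 \<delta>2 \<delta>3 M m by (simp add: \<delta>_def)
    show "\<delta> \<le> \<delta>1" by (simp add: \<delta>_def)
    show "\<delta> < \<delta>3" using \<delta>3 by (auto simp: \<delta>_def min_less_iff_disj)
    have "M * m * \<delta> \<le> M * m * (\<delta>2 / (2 * M * m))" using M m by (intro mult_left_mono) (auto simp: \<delta>_def)
    also have "\<dots> < \<delta>2" using M m \<delta>2 by simp
    finally show "M * m * \<delta> < \<delta>2" .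
  qed
  have "infdist (\<psi> \<tau> x) \<Gamma> \<le> infdist x \<Gamma> / 2" if x: "infdist x \<Gamma> \<le> \<delta>" for x
  proof -
    obtain y where y: "y \<in> \<Gamma>" "infdist x \<Gamma> = dist x y"
      using infdist_attains_inf[OF closed_cycle cycle_nonempty] by metis
    define u where "u = x - y"
    have u: "infdist x \<Gamma> = norm u" "norm u \<le> \<delta>" using x y by (simp_all add: u_def dist_norm)
    define a where "a = along y (D\<psi> \<tau> y u)"
    have "\<bar>a\<bar> \<le> norm (D\<psi> \<tau> y u) * norm (1 / norm (f y))"
      using norm_along_le[OF f_cycle[OF y(1)]] by (simp add: a_def)
    also have "\<dots> \<le> (M * norm u) * m" using M m y(1) by (intro mult_mono) auto
    finally have a: "\<bar>a\<bar> \<le> M * m * norm u" by (simp add: ac_simps)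
    also have "\<dots> \<le> M * m * \<delta>" using u M m by (intro mult_left_mono) auto
    finally have a2: "\<bar>a\<bar> < \<delta>2" using \<delta>(4) by simp
    have "D\<psi> \<tau> y u = Q\<psi> \<tau> y u + a *\<^sub>R f y"
      using normal_decomposition[of "D\<psi> \<tau> y u" y] y(1) by (simp add: a_def Q\<psi>_def \<tau>(2))
    then have "\<psi> \<tau> x - \<psi> a y = Q\<psi> \<tau> y u + (\<psi> \<tau> x - \<psi> \<tau> y - D\<psi> \<tau> y u) - (\<psi> a y - y - a *\<^sub>R f y)"
      using y(1) by (simp add: \<tau>(2))
    also have "norm \<dots> \<le> norm (Q\<psi> \<tau> y u) + norm (\<psi> \<tau> x - \<psi> \<tau> y - D\<psi> \<tau> y u) + norm (\<psi> a y - y - a *\<^sub>R f y)"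
      by (meson norm_triangle_ineq norm_triangle_ineq4 add_right_mono order_trans)
    also have "norm (Q\<psi> \<tau> y u) \<le> 1 / 4 * norm u"
      using Q[OF y(1), of u] mult_right_mono[OF \<epsilon>(2) norm_ge_zero[of u]] by linarith
    also have "norm (\<psi> \<tau> x - \<psi> \<tau> y - D\<psi> \<tau> y u) \<le> 1 / 8 * norm u"
      unfolding u_def using u \<delta>(3) by (intro \<delta>3(2) y(1)) (simp add: u_def)
    also have "norm (\<psi> a y - y - a *\<^sub>R f y) \<le> \<eta> * \<bar>a\<bar>" by (rule \<delta>2(2)[OF y(1) a2])
    also have "\<eta> * \<bar>a\<bar> \<le> \<eta> * (M * m * norm u)" using a \<eta> by (intro mult_left_mono) auto
    also have "\<dots> = 1 / 8 * norm u" using M m by (simp add: \<eta>_def)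
    finally have "norm (\<psi> \<tau> x - \<psi> a y) \<le> norm u / 2" by simp
    moreover have "infdist (\<psi> \<tau> x) \<Gamma> \<le> dist (\<psi> \<tau> x) (\<psi> a y)"
      by (rule infdist_le[OF flow_in_cycle[OF y(1)]])
    ultimately show ?thesis using u by (simp add: dist_norm)
  qed
  with nbhd \<delta> \<tau>(1) show thesis by (intro that[of \<tau> \<delta>]) auto
qed

end

section \<open>Orbital stability and the basin\<close>

context attracting_cycle
begin

lemma basin_eventually_close:
  assumes "x \<in> basin \<psi> \<Gamma>" "0 < \<rho>"
  obtains t where "0 \<le> t" "infdist (\<psi> t x) \<Gamma> < \<rho>"
proof -
  have "((\<lambda>t. infdist (\<psi> t x) \<Gamma>) \<longlongrightarrow> 0) at_top" using assms(1) by (simp add: basin_def)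
  from tendstoD[OF this assms(2)] obtain N where "\<And>t. t \<ge> N \<Longrightarrow> infdist (\<psi> t x) \<Gamma> < \<rho>"
    by (auto simp: eventually_at_top_linorder infdist_nonneg)
  then show thesis using that[of "max N 0"] by simp
qed

lemma basin_if_flow_in_basin:
  assumes "\<psi> t x \<in> basin \<psi> \<Gamma>"
  shows "x \<in> basin \<psi> \<Gamma>"
proof -
  have "((\<lambda>s. infdist (\<psi> s (\<psi> t x)) \<Gamma>) \<longlongrightarrow> 0) at_top" using assms by (simp add: basin_def)
  moreover have "filterlim (\<lambda>s. - t + s) at_top at_top"
    by (rule filterlim_tendsto_add_at_top[OF tendsto_const filterlim_ident])
  ultimately have "((\<lambda>s. infdist (\<psi> (- t + s) (\<psi> t x)) \<Gamma>) \<longlongrightarrow> 0) at_top"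
    by (rule filterlim_compose)
  then show ?thesis by (simp add: basin_def flip: flow_add)
qed

lemma flow_in_basin: "x \<in> basin \<psi> \<Gamma> \<Longrightarrow> \<psi> t x \<in> basin \<psi> \<Gamma>"
  by (rule basin_if_flow_in_basin[of "- t"]) (simp flip: flow_add)

text \<open>
  Halving at multiples of \<open>\<tau>\<close> and the bound for shorter times keep a trajectory that starts within
  \<open>\<rho>\<close> inside the \<open>\<delta>\<close>-neighbourhood forever and let its distance from the cycle decay
  exponentially.
\<close>

lemma orbital_stability:
  obtains \<tau> \<delta> \<rho> where "0 < \<tau>" "0 < \<delta>" "0 < \<rho>"
    "\<And>x. infdist x \<Gamma> \<le> \<delta> \<Longrightarrow> f x \<noteq> 0"
    "\<And>x v. infdist x \<Gamma> \<le> \<delta> \<Longrightarrow> norm (Q\<psi> \<tau> x v) \<le> norm v / 2"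
    "\<And>x t. infdist x \<Gamma> < \<rho> \<Longrightarrow> 0 \<le> t \<Longrightarrow> infdist (\<psi> t x) \<Gamma> \<le> \<delta>"
    "\<And>x. infdist x \<Gamma> < \<rho> \<Longrightarrow> x \<in> basin \<psi> \<Gamma>"
proof -
  obtain \<tau> \<delta> where \<delta>: "0 < \<tau>" "0 < \<delta>"
    "\<And>x. infdist x \<Gamma> \<le> \<delta> \<Longrightarrow> f x \<noteq> 0"
    "\<And>x v. infdist x \<Gamma> \<le> \<delta> \<Longrightarrow> norm (Q\<psi> \<tau> x v) \<le> norm v / 2"
    "\<And>x. infdist x \<Gamma> \<le> \<delta> \<Longrightarrow> infdist (\<psi> \<tau> x) \<Gamma> \<le> infdist x \<Gamma> / 2"
    using return_map_halves by metis
  obtain M where M: "1 \<le> M"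
    "\<And>x s. infdist x \<Gamma> \<le> 1 \<Longrightarrow> 0 \<le> s \<Longrightarrow> s \<le> \<tau> \<Longrightarrow> infdist (\<psi> s x) \<Gamma> \<le> M * infdist x \<Gamma>"
    using short_time_infdist by metis
  define \<rho> where "\<rho> = min \<delta> 1 / M"
  have \<rho>: "0 < \<rho>" "\<rho> \<le> \<delta>" "\<rho> \<le> 1" "M * \<rho> \<le> \<delta>"
  proof -
    define m where "m = min \<delta> 1"
    have m: "0 < m" "m \<le> \<delta>" "m \<le> 1" using \<delta>(2) by (simp_all add: m_def)
    have "m / M \<le> m" using M(1) m(1) mult_left_mono[of 1 M m] by (simp add: divide_le_eq)
    then show "0 < \<rho>" "\<rho> \<le> \<delta>" "\<rho> \<le> 1" "M * \<rho> \<le> \<delta>"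
      using m M(1) by (simp_all add: \<rho>_def flip: m_def)
  qed
  have iter: "infdist (\<psi> (real k * \<tau>) x) \<Gamma> \<le> (1/2) ^ k * infdist x \<Gamma>" if x: "infdist x \<Gamma> < \<rho>" for x k
  proof (induction k)
    case (Suc k)
    have "(1/2) ^ k * infdist x \<Gamma> \<le> 1 * infdist x \<Gamma>"
      by (intro mult_right_mono infdist_nonneg power_le_one) auto
    then have "infdist (\<psi> (real k * \<tau>) x) \<Gamma> \<le> \<delta>" using Suc x \<rho> by linarith
    from \<delta>(5)[OF this] Suc
    have "infdist (\<psi> (\<tau> + real k * \<tau>) x) \<Gamma> \<le> (1/2) ^ Suc k * infdist x \<Gamma>"
      by (simp add: flow_add)
    then show ?case by (simp add: algebra_simps)
  qed simp
  have decay: "infdist (\<psi> t x) \<Gamma> \<le> M * \<rho> * (1/2) ^ k"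
    if x: "infdist x \<Gamma> < \<rho>" and t: "t = s + real k * \<tau>" "0 \<le> s" "s \<le> \<tau>" for x t k s
  proof -
    have le: "(1/2) ^ k * infdist x \<Gamma> \<le> (1/2) ^ k * \<rho>" using x by (intro mult_left_mono) auto
    also have "\<dots> \<le> 1 * \<rho>" using \<rho>(1) by (intro mult_right_mono power_le_one) auto
    finally have "infdist (\<psi> (real k * \<tau>) x) \<Gamma> \<le> 1" using iter[OF x, of k] \<rho>(3) by linarith
    from M(2)[OF this t(2,3)] have "infdist (\<psi> t x) \<Gamma> \<le> M * infdist (\<psi> (real k * \<tau>) x) \<Gamma>"
      by (simp add: t(1) flow_add)
    also have "\<dots> \<le> M * ((1/2) ^ k * \<rho>)"
      using M(1) by (intro mult_left_mono[OF order_trans[OF iter[OF x] le]]) simp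
    finally show ?thesis by (simp add: ac_simps)
  qed
  have stay: "infdist (\<psi> t x) \<Gamma> \<le> \<delta>" if x: "infdist x \<Gamma> < \<rho>" "0 \<le> t" for x t
  proof -
    obtain k s where t: "t = s + real k * \<tau>" "0 \<le> s" "s \<le> \<tau>"
      using time_in_periods[OF \<delta>(1) x(2)] by metis
    have "infdist (\<psi> t x) \<Gamma> \<le> M * \<rho> * (1/2) ^ k" using decay[OF x(1) t] .
    also have "\<dots> \<le> M * \<rho> * 1" using M(1) \<rho>(1) by (intro mult_left_mono power_le_one) auto
    finally show ?thesis using \<rho>(4) by linarith
  qed
  have "x \<in> basin \<psi> \<Gamma>" if x: "infdist x \<Gamma> < \<rho>" for x
  proof -
    define c where "c = ln 2 / \<tau>"
    have c: "0 < c" using \<delta>(1) by (simp add: c_def)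
    have bd: "infdist (\<psi> t x) \<Gamma> \<le> M * \<rho> * (2 * exp (- c * t))" if t0: "0 \<le> t" for t
    proof -
      obtain k s where t: "t = s + real k * \<tau>" "0 \<le> s" "s \<le> \<tau>" "(1/2) ^ k \<le> 2 * exp (- c * t)"
        unfolding c_def using time_in_periods[OF \<delta>(1) t0] by metis
      have "infdist (\<psi> t x) \<Gamma> \<le> M * \<rho> * (1/2) ^ k" using decay[OF x t(1-3)] .
      also have "\<dots> \<le> M * \<rho> * (2 * exp (- c * t))" using M(1) \<rho>(1) t(4) by (intro mult_left_mono) auto
      finally show ?thesis .
    qed
    have "filterlim (\<lambda>t. - (c * t)) at_bot at_top"
      using c by (simp add: filterlim_uminus_at_top[symmetric] filterlim_tendsto_pos_mult_at_top[OF tendsto_const _ filterlim_ident])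
    then have "((\<lambda>t. exp (- (c * t))) \<longlongrightarrow> 0) at_top" by (rule filterlim_compose[OF exp_at_bot])
    then have "((\<lambda>t. M * \<rho> * (2 * exp (- c * t))) \<longlongrightarrow> M * \<rho> * (2 * 0)) at_top"
      by (intro tendsto_intros) simp
    then have lim: "((\<lambda>t. M * \<rho> * (2 * exp (- c * t))) \<longlongrightarrow> 0) at_top" by simp
    have "((\<lambda>t. infdist (\<psi> t x) \<Gamma>) \<longlongrightarrow> 0) at_top"
      by (rule tendsto_sandwich[OF _ _ tendsto_const lim])
        (use bd in \<open>auto simp: infdist_nonneg eventually_at_top_linorder\<close>)
    then show ?thesis by (simp add: basin_def)
  qed
  with \<delta> \<rho> stay show thesis by (intro that[of \<tau> \<delta> \<rho>]) auto
qed

lemma f_basin: "x \<in> basin \<psi> \<Gamma> \<Longrightarrow> f x \<noteq> 0"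
proof -
  assume x: "x \<in> basin \<psi> \<Gamma>"
  obtain \<delta> where \<delta>: "0 < \<delta>" "\<And>x. infdist x \<Gamma> \<le> \<delta> \<Longrightarrow> f x \<noteq> 0"
    using orbital_stability by metis
  obtain t where "infdist (\<psi> t x) \<Gamma> < \<delta>" using basin_eventually_close[OF x \<delta>(1)] by metis
  then have "f (\<psi> t x) \<noteq> 0" using \<delta>(2) by simp
  then show "f x \<noteq> 0" by (simp add: f_flow_eq_0_iff)
qed

text \<open>
  The rate \<open>c\<close> is the same for the whole basin, while the constant and the compact set \<open>C\<close> swept by
  the trajectories depend on \<open>x0\<close>. All points close to \<open>x0\<close> enter the neighbourhood of the cycle
  by the same time \<open>t0\<close>; the bounded time before contributes a bounded factor.
\<close>

lemma transverse_contraction_near_basin_points: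
  obtains c where "0 < c"
    "\<And>x0. x0 \<in> basin \<psi> \<Gamma> \<Longrightarrow> locally_contracting (basin \<psi> \<Gamma>) c x0"
proof -
  obtain \<tau> \<delta> \<rho> where *: "0 < \<tau>" "0 < \<delta>" "0 < \<rho>"
    "\<And>x. infdist x \<Gamma> \<le> \<delta> \<Longrightarrow> f x \<noteq> 0"
    "\<And>x v. infdist x \<Gamma> \<le> \<delta> \<Longrightarrow> norm (Q\<psi> \<tau> x v) \<le> norm v / 2"
    "\<And>x t. infdist x \<Gamma> < \<rho> \<Longrightarrow> 0 \<le> t \<Longrightarrow> infdist (\<psi> t x) \<Gamma> \<le> \<delta>"
    "\<And>x. infdist x \<Gamma> < \<rho> \<Longrightarrow> x \<in> basin \<psi> \<Gamma>"
    using orbital_stability by metis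
  define c where "c = ln 2 / \<tau>"
  have c: "0 < c" using *(1) by (simp add: c_def)
  define N where "N = {x. infdist x \<Gamma> \<le> \<delta>}"
  have cN: "compact N" unfolding N_def by (intro compact_infdist_le cycle_nonempty compact_cycle *(2))
  obtain M where M: "0 < M" "\<And>s x v. 0 \<le> s \<Longrightarrow> s \<le> \<tau> \<Longrightarrow> x \<in> N \<Longrightarrow> norm (D\<psi> s x v) \<le> M * norm v"
    using D\<psi>_bounded_on_compact[OF cN, of \<tau>] by metis
  have near: "norm (Q\<psi> t x v) \<le> M * (2 * exp (- c * t)) * norm v" if x: "infdist x \<Gamma> < \<rho>" and t0: "0 \<le> t" for x t v
  proof -
    obtain k s where t: "t = s + real k * \<tau>" "0 \<le> s" "s \<le> \<tau>" "(1/2) ^ k \<le> 2 * exp (- c * t)"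
      unfolding c_def using time_in_periods[OF *(1) t0] by metis
    have iter: "norm (Q\<psi> (real k * \<tau>) x v) \<le> (1/2) ^ k * norm v" for k
    proof (induction k)
      case 0
      then show ?case using norm_normal_part_le by (simp add: Q\<psi>_def)
    next
      case (Suc k)
      have "Q\<psi> (\<tau> + real k * \<tau>) x v = Q\<psi> \<tau> (\<psi> (real k * \<tau>) x) (Q\<psi> (real k * \<tau>) x v)"
        using *(1) by (intro Q\<psi>_add) auto
      also have "norm \<dots> \<le> norm (Q\<psi> (real k * \<tau>) x v) / 2"
        using *(1) by (intro *(5,6) x) auto
      finally show ?case using Suc by (simp add: algebra_simps)
    qed
    have "Q\<psi> t x v = Q\<psi> s (\<psi> (real k * \<tau>) x) (Q\<psi> (real k * \<tau>) x v)"
      unfolding t(1) using *(1) t(2) by (intro Q\<psi>_add) auto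
    also have "norm \<dots> \<le> M * norm (Q\<psi> (real k * \<tau>) x v)"
      using *(6)[OF x, of "real k * \<tau>"] *(1) by (intro order_trans[OF norm_Q\<psi>_le M(2)] t(2,3)) (simp add: N_def)
    also have "\<dots> \<le> M * ((1/2) ^ k * norm v)" using iter M(1) by (intro mult_left_mono) auto
    also have "\<dots> \<le> M * (2 * exp (- c * t) * norm v)"
      using M(1) t(4) by (intro mult_left_mono mult_right_mono) auto
    finally show ?thesis by (simp add: ac_simps)
  qed
  have "locally_contracting (basin \<psi> \<Gamma>) c x0"
    if x0: "x0 \<in> basin \<psi> \<Gamma>" for x0
  proof -
    obtain t0 where t0: "0 \<le> t0" "infdist (\<psi> t0 x0) \<Gamma> < \<rho>" using basin_eventually_close[OF x0 *(3)] by metis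
    have "open {x. infdist (\<psi> t0 x) \<Gamma> < \<rho>}"
      using t0(1) by (intro open_Collect_less continuous_intros continuous_flow_at)
    then obtain d where d: "0 < d" "\<And>x. x \<in> cball x0 d \<Longrightarrow> infdist (\<psi> t0 x) \<Gamma> < \<rho>"
      using t0(2) unfolding open_contains_cball by (metis (mono_tags, lifting) mem_Collect_eq subset_iff)
    have bas: "x \<in> basin \<psi> \<Gamma>" if "x \<in> cball x0 d" for x
      using basin_if_flow_in_basin *(7) d(2)[OF that] by blast
    define C where "C = N \<union> (\<lambda>(t, x). \<psi> t x) ` ({0..t0} \<times> cball x0 d)"
    have C1: "compact C"
      unfolding C_def
      by (intro compact_Un cN compact_continuous_image compact_Times compact_Icc compact_cball
          continuous_on_subset[OF continuous_flow]) auto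
    have C2: "\<forall>x\<in>C. f x \<noteq> 0"
      unfolding C_def using *(4) bas f_basin by (auto simp: N_def f_flow_eq_0_iff)
    obtain M0 where M0: "0 < M0" "\<And>s x v. 0 \<le> s \<Longrightarrow> s \<le> t0 \<Longrightarrow> x \<in> cball x0 d \<Longrightarrow> norm (D\<psi> s x v) \<le> M0 * norm v"
      using D\<psi>_bounded_on_compact[OF compact_cball, of t0 x0 d] by metis
    define B where "B = M0 * exp (c * t0) * (1 + 2 * M)"
    have B: "0 < B" using M M0 by (simp add: B_def add_pos_pos)
    have main: "\<psi> t x \<in> C \<and> (\<forall>v. norm (Q\<psi> t x v) \<le> B * exp (- c * t) * norm v)"
      if x: "x \<in> ball x0 d" and t: "0 \<le> t" for x t
    proof (cases "t \<le> t0")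
      case True
      have "norm (Q\<psi> t x v) \<le> B * exp (- c * t) * norm v" for v
      proof -
        have "norm (Q\<psi> t x v) \<le> M0 * norm v" using True t x by (intro order_trans[OF norm_Q\<psi>_le M0(2)]) auto
        also have "M0 \<le> B * exp (- c * t)"
        proof -
          have "M0 * 1 \<le> M0 * (exp (c * (t0 - t)) * (1 + 2 * M))"
            using M0 M True c by (intro mult_left_mono) (auto intro!: mult_ge1_I)
          also have "\<dots> = B * exp (- c * t)"
            by (simp add: B_def algebra_simps exp_diff exp_minus divide_inverse)
          finally show ?thesis by simp
        qed
        then have "M0 * norm v \<le> B * exp (- c * t) * norm v" by (rule mult_right_mono) simp
        finally show ?thesis .
      qed
      moreover have "\<psi> t x \<in> C" using True t x by (auto simp: C_def)
      ultimately show ?thesis by blast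
    next
      case False
      have near_x: "infdist (\<psi> t0 x) \<Gamma> < \<rho>" using x d(2)[of x] by simp
      have "norm (Q\<psi> t x v) \<le> B * exp (- c * t) * norm v" for v
      proof -
        have "Q\<psi> (t - t0 + t0) x v = Q\<psi> (t - t0) (\<psi> t0 x) (Q\<psi> t0 x v)"
          using False t0 by (intro Q\<psi>_add) auto
        then have "norm (Q\<psi> t x v) \<le> M * (2 * exp (- c * (t - t0))) * norm (Q\<psi> t0 x v)"
          using near[OF near_x, of "t - t0"] False by simp
        also have "norm (Q\<psi> t0 x v) \<le> M0 * norm v" using t0(1) x by (intro order_trans[OF norm_Q\<psi>_le M0(2)]) auto
        then have "M * (2 * exp (- c * (t - t0))) * norm (Q\<psi> t0 x v) \<le> M * (2 * exp (- c * (t - t0))) * (M0 * norm v)"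
          using M(1) by (intro mult_left_mono) auto
        also have "\<dots> = M0 * exp (c * t0) * (2 * M) * (exp (- c * t) * norm v)"
          by (simp add: algebra_simps exp_diff exp_minus divide_inverse)
        also have "\<dots> \<le> B * (exp (- c * t) * norm v)"
          using M0(1) M(1) by (intro mult_right_mono) (auto simp: B_def)
        finally show ?thesis by (simp add: mult.assoc)
      qed
      moreover have "\<psi> t x \<in> N"
        using *(6)[OF near_x, of "t - t0"] False by (simp add: N_def flip: flow_add)
      then have "\<psi> t x \<in> C" by (simp add: C_def)
      ultimately show ?thesis by blast
    qed
    have "ball x0 d \<subseteq> basin \<psi> \<Gamma>" using bas by auto
    with d(1) B C1 C2 main show ?thesis
      unfolding locally_contracting_def by (intro exI[of _ d] exI[of _ B] exI[of _ C] conjI ballI) simp_all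
  qed
  with c show thesis by (rule that)
qed

lemma open_basin: "open (basin \<psi> \<Gamma>)"
proof -
  obtain c where "\<And>x0. x0 \<in> basin \<psi> \<Gamma> \<Longrightarrow> locally_contracting (basin \<psi> \<Gamma>) c x0"
    by (rule transverse_contraction_near_basin_points) blast
  then show ?thesis unfolding open_contains_ball locally_contracting_def by blast
qed

end

section \<open>The differential of the asymptotic phase\<close>

text \<open>
  What the construction of the invariant covector and of the adapted metric uses of the basin: forward
  invariance, and transverse contraction at a rate common to all its points.
\<close>

locale transversally_contracting = complete_C1_flow f \<psi> Df
  for f :: "'a::euclidean_space \<Rightarrow> 'a" and \<psi> Df +
  fixes X :: "'a set" and c :: real
  assumes c_pos: "0 < c" and forward_invariant: "\<And>x t. x \<in> X \<Longrightarrow> 0 \<le> t \<Longrightarrow> \<psi> t x \<in> X"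
    and contraction: "\<And>x0. x0 \<in> X \<Longrightarrow> locally_contracting X c x0"
begin

lemma f_nonzero: "x \<in> X \<Longrightarrow> f x \<noteq> 0"
  using contraction[of x] unfolding locally_contracting_def by (metis centre_in_ball flow_0 order_refl)

definition flow_component :: "real \<Rightarrow> 'a \<Rightarrow> 'a \<Rightarrow> real" where
  "flow_component t x v = along (\<psi> t x) (D\<psi> t x v)"

text \<open>
  The differential of the asymptotic phase, obtained as a limit of transported coefficients.
\<close>

definition phase :: "'a \<Rightarrow> 'a \<Rightarrow> real" where
  "phase x v = lim (\<lambda>n. flow_component (real n) x v)"

lemma linear_flow_component: "linear (flow_component t x)"
  unfolding flow_component_def by (rule linearI)
    (simp_all add: linear_add[OF linear_along] linear_cmul[OF linear_along] blinfun.add_right blinfun.scaleR_right)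

lemma D\<psi>_decomposition: "D\<psi> t x v = Q\<psi> t x v + flow_component t x v *\<^sub>R f (\<psi> t x)"
  unfolding Q\<psi>_def flow_component_def by (rule normal_decomposition)

text \<open>
  The coefficient along the flow changes only through the transverse part of the vector, since the
  tangential part is transported to a multiple of \<open>f\<close> with the same coefficient.
\<close>

lemma flow_component_add:
  assumes "x \<in> X" "0 \<le> s" "0 \<le> t"
  shows "flow_component (t + s) x v = flow_component t x v + flow_component s (\<psi> t x) (Q\<psi> t x v)"
proof -
  have "D\<psi> (s + t) x v = D\<psi> s (\<psi> t x) (Q\<psi> t x v) + flow_component t x v *\<^sub>R f (\<psi> s (\<psi> t x))"
    using D\<psi>_f[OF assms(2)]
    by (simp add: D\<psi>_add[OF assms(2,3)] D\<psi>_decomposition[of t x v] blinfun.add_right blinfun.scaleR_right)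
  moreover have "f (\<psi> s (\<psi> t x)) \<noteq> 0" using f_nonzero[OF assms(1)] by (simp add: f_flow_eq_0_iff)
  ultimately show ?thesis
    by (simp add: flow_component_def flow_add add.commute[of t] linear_add[OF linear_along] linear_cmul[OF linear_along] along_f)
qed

text \<open>
  By \<open>flow_component_add\<close>, the change during a time of at most one is bounded by the transverse part,
  which decays like \<open>exp (- c * t)\<close>. Summing the geometric series over unit steps gives the
  bound for all times.
\<close>

lemma flow_component_cauchy:
  assumes "x0 \<in> X"
  obtains d K where "0 < d" "0 < K" "ball x0 d \<subseteq> X"
    "\<And>x t s v. x \<in> ball x0 d \<Longrightarrow> 0 \<le> t \<Longrightarrow> 0 \<le> s \<Longrightarrow> \<bar>flow_component (t + s) x v - flow_component t x v\<bar> \<le> K * exp (- c * t) * norm v"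
    "\<And>x t v. x \<in> ball x0 d \<Longrightarrow> 0 \<le> t \<Longrightarrow> norm (Q\<psi> t x v) \<le> K * exp (- c * t) * norm v"
    "\<And>x t. x \<in> ball x0 d \<Longrightarrow> 0 \<le> t \<Longrightarrow> norm (f (\<psi> t x)) \<le> K"
proof -
  obtain d B C where B': "0 < d \<and> 0 < B \<and> compact C \<and> ball x0 d \<subseteq> X \<and> (\<forall>x\<in>C. f x \<noteq> 0) \<and>
       (\<forall>x\<in>ball x0 d. \<forall>t\<ge>0. \<psi> t x \<in> C \<and> (\<forall>v. norm (Q\<psi> t x v) \<le> B * exp (- c * t) * norm v))"
    using contraction[OF assms] unfolding locally_contracting_def by (elim exE) (rule that)
  have B: "0 < d" "0 < B" "compact C" "ball x0 d \<subseteq> X" "\<And>x. x \<in> C \<Longrightarrow> f x \<noteq> 0"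
    "\<And>x t. x \<in> ball x0 d \<Longrightarrow> 0 \<le> t \<Longrightarrow> \<psi> t x \<in> C"
    "\<And>x t v. x \<in> ball x0 d \<Longrightarrow> 0 \<le> t \<Longrightarrow> norm (Q\<psi> t x v) \<le> B * exp (- c * t) * norm v"
    using B' by simp_all
  obtain M where M: "0 < M" "\<And>s x v. 0 \<le> s \<Longrightarrow> s \<le> 1 \<Longrightarrow> x \<in> C \<Longrightarrow> norm (D\<psi> s x v) \<le> M * norm v"
    using D\<psi>_bounded_on_compact[OF B(3), of 1] by metis
  have "continuous_on C (\<lambda>y. 1 / norm (f y))"
    by (intro continuous_intros continuous_f) (auto dest: B(5))
  then obtain m where m: "0 < m" "\<And>y. y \<in> C \<Longrightarrow> norm (1 / norm (f y)) \<le> m"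
    using B(3) by (rule continuous_imp_bounded_on_compact) blast
  obtain F where F: "0 < F" "\<And>y. y \<in> C \<Longrightarrow> norm (f y) \<le> F"
    using continuous_imp_bounded_on_compact[OF continuous_f B(3)] by metis
  define K1 where "K1 = M * B * m"
  have K1: "0 < K1" using M B m by (simp add: K1_def)
  have q: "0 < exp (- c)" "exp (- c) < 1" using c_pos by simp_all
  \<comment> \<open>the sum of the geometric series, in the form in which the induction over unit steps uses it\<close>
  define K where "K = K1 / (1 - exp (- c))"
  have K: "K * exp (- c) + K1 = K" "K1 \<le> K"
    using q K1 by (simp_all add: K_def field_simps)
  have step: "\<bar>flow_component (t + s) x v - flow_component t x v\<bar> \<le> K1 * exp (- c * t) * norm v"
    if x: "x \<in> ball x0 d" and t: "0 \<le> t" and s: "0 \<le> s" "s \<le> 1" for x t s v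
  proof -
    have xX: "x \<in> X" using x B(4) by blast
    have inC: "\<psi> s (\<psi> t x) \<in> C" using B(6)[OF x, of "s + t"] t s by (simp add: flow_add)
    have "\<bar>flow_component (t + s) x v - flow_component t x v\<bar> = \<bar>along (\<psi> s (\<psi> t x)) (D\<psi> s (\<psi> t x) (Q\<psi> t x v))\<bar>"
      by (simp add: flow_component_add[OF xX s(1) t]) (simp add: flow_component_def)
    also have "\<dots> \<le> norm (D\<psi> s (\<psi> t x) (Q\<psi> t x v)) * norm (1 / norm (f (\<psi> s (\<psi> t x))))"
      using norm_along_le[OF B(5)[OF inC]] by simp
    also have "\<dots> \<le> (M * norm (Q\<psi> t x v)) * m"
      using M m(1) by (intro mult_mono M(2) m(2) inC s B(6)[OF x t]) auto
    also have "\<dots> \<le> (M * (B * exp (- c * t) * norm v)) * m"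
      using M(1) m(1) B(7)[OF x t] by (intro mult_right_mono mult_left_mono) auto
    finally show ?thesis by (simp add: K1_def ac_simps)
  qed
  have steps: "\<bar>flow_component (t + s) x v - flow_component t x v\<bar> \<le> K * exp (- c * t) * norm v"
    if x: "x \<in> ball x0 d" and "0 \<le> t" "0 \<le> s" "s \<le> real k + 1" for x t s v k
    using that(2-4)
  proof (induction k arbitrary: t s)
    case 0
    then have "\<bar>flow_component (t + s) x v - flow_component t x v\<bar> \<le> K1 * exp (- c * t) * norm v"
      using x by (intro step) auto
    also have "\<dots> \<le> K * exp (- c * t) * norm v" using K(2) by (intro mult_right_mono) auto
    finally show ?case .
  next
    case (Suc k)
    show ?case
    proof (cases "s \<le> 1")
      case True
      then have "\<bar>flow_component (t + s) x v - flow_component t x v\<bar> \<le> K1 * exp (- c * t) * norm v"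
        using x Suc.prems by (intro step) auto
      also have "\<dots> \<le> K * exp (- c * t) * norm v" using K(2) by (intro mult_right_mono) auto
      finally show ?thesis .
    next
      case False
      have "\<bar>flow_component ((t + 1) + (s - 1)) x v - flow_component (t + 1) x v\<bar> \<le> K * exp (- c * (t + 1)) * norm v"
        using False Suc.prems by (intro Suc.IH) auto
      moreover have "\<bar>flow_component (t + 1) x v - flow_component t x v\<bar> \<le> K1 * exp (- c * t) * norm v"
        using x Suc.prems by (intro step) auto
      ultimately have "\<bar>flow_component (t + s) x v - flow_component t x v\<bar>
          \<le> K * exp (- c * (t + 1)) * norm v + K1 * exp (- c * t) * norm v"
        by simp
      also have "\<dots> = (K * exp (- c) + K1) * exp (- c * t) * norm v"
        by (simp add: algebra_simps exp_add[symmetric])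
      finally show ?thesis by (simp only: K(1))
    qed
  qed
  define K' where "K' = K + B + F"
  have K': "0 < K'" "K \<le> K'" "B \<le> K'" "F \<le> K'" using K K1 B F by (simp_all add: K'_def)
  have "\<bar>flow_component (t + s) x v - flow_component t x v\<bar> \<le> K' * exp (- c * t) * norm v"
    if "x \<in> ball x0 d" "0 \<le> t" "0 \<le> s" for x t s v
  proof -
    have "\<bar>flow_component (t + s) x v - flow_component t x v\<bar> \<le> K * exp (- c * t) * norm v"
      using that by (intro steps[of _ _ _ "nat \<lceil>s\<rceil>"]) (auto, linarith)
    also have "\<dots> \<le> K' * exp (- c * t) * norm v" using K' by (intro mult_right_mono) auto
    finally show ?thesis .
  qed
  moreover have "norm (Q\<psi> t x v) \<le> K' * exp (- c * t) * norm v" if "x \<in> ball x0 d" "0 \<le> t" for x t v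
  proof -
    have "norm (Q\<psi> t x v) \<le> B * exp (- c * t) * norm v" using that by (rule B(7))
    also have "\<dots> \<le> K' * exp (- c * t) * norm v" using K' by (intro mult_right_mono) auto
    finally show ?thesis .
  qed
  moreover have "norm (f (\<psi> t x)) \<le> K'" if "x \<in> ball x0 d" "0 \<le> t" for x t
    using F(2)[OF B(6)[OF that]] K' by simp
  ultimately show thesis using that[OF B(1) K'(1) B(4)] by blast
qed

lemma exp_decay_tendsto: "((\<lambda>t. K * exp (- c * t) * r) \<longlongrightarrow> 0) at_top"
proof -
  have "filterlim (\<lambda>t. - (c * t)) at_bot at_top"
    using c_pos by (simp add: filterlim_uminus_at_top[symmetric] filterlim_tendsto_pos_mult_at_top[OF tendsto_const _ filterlim_ident])
  then have "((\<lambda>t. exp (- (c * t))) \<longlongrightarrow> 0) at_top" by (rule filterlim_compose[OF exp_at_bot])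
  then have "((\<lambda>t. K * exp (- c * t) * r) \<longlongrightarrow> K * 0 * r) at_top"
    by (intro tendsto_intros) simp
  then show ?thesis by simp
qed

lemma phase_approximation:
  assumes "x0 \<in> X"
  obtains d K where "0 < d" "0 < K" "ball x0 d \<subseteq> X"
    "\<And>x t v. x \<in> ball x0 d \<Longrightarrow> 0 \<le> t \<Longrightarrow> \<bar>flow_component t x v - phase x v\<bar> \<le> K * exp (- c * t) * norm v"
    "\<And>x t v. x \<in> ball x0 d \<Longrightarrow> 0 \<le> t \<Longrightarrow> norm (Q\<psi> t x v) \<le> K * exp (- c * t) * norm v"
    "\<And>x t. x \<in> ball x0 d \<Longrightarrow> 0 \<le> t \<Longrightarrow> norm (f (\<psi> t x)) \<le> K"
proof -
  obtain d K where K: "0 < d" "0 < K" "ball x0 d \<subseteq> X"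
    "\<And>x t s v. x \<in> ball x0 d \<Longrightarrow> 0 \<le> t \<Longrightarrow> 0 \<le> s \<Longrightarrow> \<bar>flow_component (t + s) x v - flow_component t x v\<bar> \<le> K * exp (- c * t) * norm v"
    "\<And>x t v. x \<in> ball x0 d \<Longrightarrow> 0 \<le> t \<Longrightarrow> norm (Q\<psi> t x v) \<le> K * exp (- c * t) * norm v"
    "\<And>x t. x \<in> ball x0 d \<Longrightarrow> 0 \<le> t \<Longrightarrow> norm (f (\<psi> t x)) \<le> K"
    using flow_component_cauchy[OF assms] by metis
  have "\<bar>flow_component t x v - phase x v\<bar> \<le> K * exp (- c * t) * norm v" if x: "x \<in> ball x0 d" and t: "0 \<le> t" for x t v
  proof -
    have later: "\<bar>flow_component t x v - flow_component s x v\<bar> \<le> K * exp (- c * t) * norm v" if "0 \<le> t" "t \<le> s" for t s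
      using K(4)[OF x, of t "s - t" v] that by (simp add: abs_minus_commute)
    have "Cauchy (\<lambda>n. flow_component (real n) x v)"
    proof (rule CauchyI')
      fix e :: real assume "0 < e"
      have "\<forall>\<^sub>F t in at_top. dist (K * exp (- c * t) * norm v) 0 < e"
        by (rule tendstoD[OF exp_decay_tendsto \<open>0 < e\<close>])
      then obtain N where N: "\<And>t. t \<ge> N \<Longrightarrow> K * exp (- c * t) * norm v < e"
        unfolding eventually_at_top_linorder by (auto simp: abs_less_iff)
      have "dist (flow_component (real m) x v) (flow_component (real n) x v) < e" if "nat \<lceil>N\<rceil> \<le> m" "m < n" for m n
        using later[of "real m" "real n"] N[of "real m"] that unfolding dist_real_def by simp
      then show "\<exists>M. \<forall>m\<ge>M. \<forall>n>m. dist (flow_component (real m) x v) (flow_component (real n) x v) < e" by blast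
    qed
    then have "(\<lambda>n. flow_component (real n) x v) \<longlonglongrightarrow> phase x v"
      unfolding phase_def by (simp add: Cauchy_convergent_iff convergent_LIMSEQ_iff)
    then have lim: "(\<lambda>n. \<bar>flow_component t x v - flow_component (real n) x v\<bar>) \<longlonglongrightarrow> \<bar>flow_component t x v - phase x v\<bar>"
      by (intro tendsto_intros)
    have "\<forall>\<^sub>F n in sequentially. \<bar>flow_component t x v - flow_component (real n) x v\<bar> \<le> K * exp (- c * t) * norm v"
      using eventually_ge_at_top[of "nat \<lceil>t\<rceil>"]
    proof (rule eventually_mono)
      fix n assume "nat \<lceil>t\<rceil> \<le> n"
      then have "t \<le> real n" by linarith
      then show "\<bar>flow_component t x v - flow_component (real n) x v\<bar> \<le> K * exp (- c * t) * norm v" by (rule later[OF t])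
    qed
    then show ?thesis by (rule tendsto_upperbound[OF lim]) simp
  qed
  with K show thesis by (intro that[of d K]) auto
qed

lemma flow_component_tendsto:
  assumes "x \<in> X"
  shows "((\<lambda>t. flow_component t x v) \<longlongrightarrow> phase x v) at_top"
proof -
  obtain d K where K: "0 < d"
    "\<And>y t v. y \<in> ball x d \<Longrightarrow> 0 \<le> t \<Longrightarrow> \<bar>flow_component t y v - phase y v\<bar> \<le> K * exp (- c * t) * norm v"
    using phase_approximation[OF assms] by metis
  have "((\<lambda>t. flow_component t x v - phase x v) \<longlongrightarrow> 0) at_top"
    by (rule Lim_null_comparison[OF eventually_mono[OF eventually_ge_at_top[of 0]] exp_decay_tendsto[of K "norm v"]])
      (use K in simp)
  then show ?thesis by (simp add: LIM_zero_iff)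
qed

lemma linear_phase: "x \<in> X \<Longrightarrow> linear (phase x)"
proof (rule linearI)
  fix u v assume x: "x \<in> X"
  have "((\<lambda>t. flow_component t x (u + v)) \<longlongrightarrow> phase x u + phase x v) at_top"
    unfolding linear_add[OF linear_flow_component] by (intro tendsto_add flow_component_tendsto x)
  with flow_component_tendsto[OF x] show "phase x (u + v) = phase x u + phase x v"
    by (rule tendsto_unique[OF trivial_limit_at_top_linorder])
next
  fix r v assume x: "x \<in> X"
  have "((\<lambda>t. flow_component t x (r *\<^sub>R v)) \<longlongrightarrow> r *\<^sub>R phase x v) at_top"
    unfolding linear_cmul[OF linear_flow_component] by (intro tendsto_scaleR tendsto_const flow_component_tendsto x)
  with flow_component_tendsto[OF x] show "phase x (r *\<^sub>R v) = r *\<^sub>R phase x v"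
    by (rule tendsto_unique[OF trivial_limit_at_top_linorder])
qed

lemma phase_f:
  assumes "x \<in> X"
  shows "phase x (f x) = 1"
proof -
  have "flow_component t x (f x) = 1" if "0 \<le> t" for t
    using D\<psi>_f[OF that] f_nonzero[OF assms] by (simp add: flow_component_def along_f f_flow_eq_0_iff)
  then have "((\<lambda>t. flow_component t x (f x)) \<longlongrightarrow> 1) at_top"
    by (intro tendsto_eventually) (auto simp: eventually_at_top_linorder)
  with flow_component_tendsto[OF assms] show ?thesis
    by (rule tendsto_unique[OF trivial_limit_at_top_linorder])
qed

text \<open>
  Moving the starting point along the orbit merely shifts the time in the limit that defines the
  covector.
\<close>

lemma phase_invariant:
  assumes "x \<in> X" "0 \<le> t"
  shows "phase (\<psi> t x) (D\<psi> t x v) = phase x v"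
proof -
  have "filterlim (\<lambda>s. t + s) at_top at_top"
    by (rule filterlim_tendsto_add_at_top[OF tendsto_const filterlim_ident])
  then have "((\<lambda>s. flow_component (t + s) x v) \<longlongrightarrow> phase x v) at_top"
    by (rule filterlim_compose[OF flow_component_tendsto[OF assms(1)]])
  moreover have "\<forall>\<^sub>F s in at_top. flow_component (t + s) x v = flow_component s (\<psi> t x) (D\<psi> t x v)"
    using eventually_ge_at_top[of 0]
    by (rule eventually_mono) (simp add: flow_component_def add.commute[of t] flow_add D\<psi>_add assms)
  ultimately have "((\<lambda>s. flow_component s (\<psi> t x) (D\<psi> t x v)) \<longlongrightarrow> phase x v) at_top"
    by (rule Lim_transform_eventually)
  with flow_component_tendsto[OF forward_invariant[OF assms]] show ?thesis
    by (rule tendsto_unique[OF trivial_limit_at_top_linorder])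
qed

lemma continuous_phase_vector: "continuous_on X (\<lambda>x. phase x v)"
proof -
  have "continuous_on (ball x0 d) (\<lambda>x. phase x v)"
    if K: "ball x0 d \<subseteq> X"
      "\<And>x t v. x \<in> ball x0 d \<Longrightarrow> 0 \<le> t \<Longrightarrow> \<bar>flow_component t x v - phase x v\<bar> \<le> K * exp (- c * t) * norm v" for x0 d K
  proof (rule uniform_limit_theorem)
    have "f (\<psi> (real n) x) \<noteq> 0" if "x \<in> ball x0 d" for n x
      using f_nonzero K(1) that by (auto simp: f_flow_eq_0_iff)
    then show "\<forall>\<^sub>F n in sequentially. continuous_on (ball x0 d) (\<lambda>x. flow_component (real n) x v)"
      unfolding flow_component_def
      by (intro always_eventually allI continuous_on_along continuous_flow_at continuous_intros continuous_D\<psi>_at) auto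
    show "uniform_limit (ball x0 d) (\<lambda>n x. flow_component (real n) x v) (\<lambda>x. phase x v) sequentially"
    proof (rule uniform_limitI)
      fix e :: real assume e: "0 < e"
      have "(\<lambda>n. K * exp (- c * real n) * norm v) \<longlonglongrightarrow> 0"
        by (rule filterlim_compose[OF exp_decay_tendsto filterlim_real_sequentially])
      from tendstoD[OF this e]
      show "\<forall>\<^sub>F n in sequentially. \<forall>x\<in>ball x0 d. dist (flow_component (real n) x v) (phase x v) < e"
      proof (rule eventually_mono, intro ballI)
        fix n x assume n: "dist (K * exp (- c * real n) * norm v) 0 < e" and x: "x \<in> ball x0 d"
        have "\<bar>flow_component (real n) x v - phase x v\<bar> \<le> K * exp (- c * real n) * norm v"
          using K(2)[OF x] by simp
        with n show "dist (flow_component (real n) x v) (phase x v) < e"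
          unfolding dist_real_def by linarith
      qed
    qed
  qed simp
  then have "continuous (at x0) (\<lambda>x. phase x v)" if "x0 \<in> X" for x0
    using phase_approximation[OF that] by (metis centre_in_ball continuous_on_eq_continuous_at open_ball)
  then show ?thesis by (simp add: continuous_at_imp_continuous_on)
qed

text \<open>
  The projection along the vector field onto the kernel of the covector \<open>phase x\<close>; unlike the orthogonal
  projection, it commutes with the flow.
\<close>

definition stable_part :: "'a \<Rightarrow> 'a \<Rightarrow> 'a" where
  "stable_part x v = v - phase x v *\<^sub>R f x"

lemma linear_stable_part: "x \<in> X \<Longrightarrow> linear (stable_part x)"
  unfolding stable_part_def
  by (rule linearI) (simp_all add: linear_add[OF linear_phase] linear_cmul[OF linear_phase] algebra_simps)

lemma D\<psi>_stable_part:
  assumes "x \<in> X" "0 \<le> t"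
  shows "D\<psi> t x (stable_part x v) = stable_part (\<psi> t x) (D\<psi> t x v)"
  by (simp add: stable_part_def phase_invariant[OF assms] blinfun.diff_right blinfun.scaleR_right D\<psi>_f[OF assms(2)])

text \<open>
  The transported stable part is the transverse part plus the vector field times the error of the
  phase approximation, and both decay.
\<close>

lemma D\<psi>_stable_part_decay:
  assumes "x0 \<in> X"
  obtains d E where "0 < d" "0 < E" "ball x0 d \<subseteq> X"
    "\<And>x t v. x \<in> ball x0 d \<Longrightarrow> 0 \<le> t \<Longrightarrow> norm (D\<psi> t x (stable_part x v)) \<le> E * exp (- c * t) * norm v"
proof -
  obtain d K where K: "0 < d" "0 < K" "ball x0 d \<subseteq> X"
    "\<And>x t v. x \<in> ball x0 d \<Longrightarrow> 0 \<le> t \<Longrightarrow> \<bar>flow_component t x v - phase x v\<bar> \<le> K * exp (- c * t) * norm v"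
    "\<And>x t v. x \<in> ball x0 d \<Longrightarrow> 0 \<le> t \<Longrightarrow> norm (Q\<psi> t x v) \<le> K * exp (- c * t) * norm v"
    "\<And>x t. x \<in> ball x0 d \<Longrightarrow> 0 \<le> t \<Longrightarrow> norm (f (\<psi> t x)) \<le> K"
    using phase_approximation[OF assms] by metis
  have "norm (D\<psi> t x (stable_part x v)) \<le> (K + K * K) * exp (- c * t) * norm v"
    if x: "x \<in> ball x0 d" and t: "0 \<le> t" for x t v
  proof -
    have "x \<in> X" using K(3) x by blast
    then have "D\<psi> t x (stable_part x v) = Q\<psi> t x v + (flow_component t x v - phase x v) *\<^sub>R f (\<psi> t x)"
      by (simp add: stable_part_def blinfun.diff_right blinfun.scaleR_right D\<psi>_f[OF t] D\<psi>_decomposition[of t x v] algebra_simps)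
    also have "norm \<dots> \<le> norm (Q\<psi> t x v) + \<bar>flow_component t x v - phase x v\<bar> * norm (f (\<psi> t x))"
      using norm_triangle_ineq[of "Q\<psi> t x v"] by (metis norm_scaleR)
    also have "\<dots> \<le> K * exp (- c * t) * norm v + (K * exp (- c * t) * norm v) * K"
      using K(2) by (intro add_mono mult_mono K(4-6) x t) auto
    finally show ?thesis by (simp add: algebra_simps)
  qed
  with K(1-3) show thesis by (intro that[of d "K + K * K"]) (auto simp: add_pos_pos)
qed

end

section \<open>A metric adapted to the flow\<close>

context transversally_contracting
begin

definition stable_integrand :: "'a \<Rightarrow> 'a \<Rightarrow> 'a \<Rightarrow> real \<Rightarrow> real" where
  "stable_integrand x v w t =
     indicator {0..} t *\<^sub>R (exp (c * t) * (D\<psi> t x (stable_part x v) \<bullet> D\<psi> t x (stable_part x w)))"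

text \<open>
  The squared length decays like \<open>exp (- 2 * c * t)\<close>, so the weight \<open>exp (c * t)\<close> leaves an
  integrable function. The weight turns a shift of time into decay of the form.
\<close>

definition stable_form :: "'a \<Rightarrow> 'a \<Rightarrow> 'a \<Rightarrow> real" where
  "stable_form x v w = (\<integral>t. stable_integrand x v w t \<partial>lborel)"

lemma continuous_D\<psi>_time: "continuous_on {0..} (\<lambda>t. D\<psi> t x)"
  using continuous_on_compose2[OF continuous_D\<psi>, of "{0..}" "\<lambda>t. (t, x)"]
  by (simp add: continuous_on_Pair image_subset_iff)

lemma stable_integrand_measurable [measurable]: "stable_integrand x v w \<in> borel_measurable lborel"
proof -
  have "(\<lambda>t. indicator {0..} t *\<^sub>R (exp (c * t) * (D\<psi> t x (stable_part x v) \<bullet> D\<psi> t x (stable_part x w))))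
      \<in> borel_measurable borel"
    by (intro borel_measurable_continuous_on_indicator continuous_intros continuous_D\<psi>_time) auto
  then show ?thesis by (simp add: stable_integrand_def[abs_def])
qed

lemma integrable_exp_decay: "integrable lborel (\<lambda>t. indicator {0..} t *\<^sub>R exp (- c * t))"
proof (rule integrableI_nn_integral_finite)
  have "(\<integral>\<^sup>+t. ennreal (exp (- c * t)) * indicator {0..} t \<partial>lborel) = ennreal (0 - (- 1 / c) * exp (- c * 0) * 1)"
  proof (rule nn_integral_FTC_atLeast)
    show "((\<lambda>t. (- 1 / c) * exp (- c * t) * 1) has_real_derivative exp (- c * t)) (at t)" for t
      using c_pos by (auto intro!: derivative_eq_intros)
  qed (use exp_decay_tendsto[of "- 1 / c" 1] in auto)
  moreover have "ennreal (indicator {0..} t *\<^sub>R exp (- c * t)) = ennreal (exp (- c * t)) * indicator {0..} t" for t :: real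
    by (simp split: split_indicator)
  ultimately show "(\<integral>\<^sup>+t. ennreal (indicator {0..} t *\<^sub>R exp (- c * t)) \<partial>lborel) = ennreal (0 - (- 1 / c) * exp (- c * 0) * 1)"
    by simp
qed auto

lemma stable_integrand_bound:
  assumes "x0 \<in> X"
  obtains d E where "0 < d" "ball x0 d \<subseteq> X"
    "\<And>x v w t. x \<in> ball x0 d \<Longrightarrow>
       norm (stable_integrand x v w t) \<le> E * norm v * norm w * (indicator {0..} t *\<^sub>R exp (- c * t))"
proof -
  obtain d E where E: "0 < d" "0 < E" "ball x0 d \<subseteq> X"
    "\<And>x t v. x \<in> ball x0 d \<Longrightarrow> 0 \<le> t \<Longrightarrow> norm (D\<psi> t x (stable_part x v)) \<le> E * exp (- c * t) * norm v"
    using D\<psi>_stable_part_decay[OF assms] by metis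
  have "norm (stable_integrand x v w t) \<le> (E * E) * norm v * norm w * (indicator {0..} t *\<^sub>R exp (- c * t))"
    if x: "x \<in> ball x0 d" for x v w t
  proof (cases "0 \<le> t")
    case True
    have "norm (stable_integrand x v w t) = exp (c * t) * \<bar>D\<psi> t x (stable_part x v) \<bullet> D\<psi> t x (stable_part x w)\<bar>"
      using True by (simp add: stable_integrand_def abs_mult)
    also have "\<dots> \<le> exp (c * t) * (norm (D\<psi> t x (stable_part x v)) * norm (D\<psi> t x (stable_part x w)))"
      by (intro mult_left_mono Cauchy_Schwarz_ineq2) simp
    also have "\<dots> \<le> exp (c * t) * ((E * exp (- c * t) * norm v) * (E * exp (- c * t) * norm w))"
      using E(2) by (intro mult_left_mono mult_mono E(4)[OF x True]) auto
    also have "\<dots> = (E * E) * norm v * norm w * ((exp (c * t) * exp (- c * t)) * exp (- c * t))" by (simp only: ac_simps)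
    also have "exp (c * t) * exp (- c * t) = 1" by (simp add: exp_minus)
    finally show ?thesis using True by simp
  qed (simp add: stable_integrand_def)
  with E show thesis by (intro that[of d "E * E"]) auto
qed

lemma integrable_stable_integrand:
  assumes "x \<in> X"
  shows "integrable lborel (stable_integrand x v w)"
proof -
  obtain d E where E: "0 < d" "\<And>y v w t. y \<in> ball x d \<Longrightarrow>
       norm (stable_integrand y v w t) \<le> E * norm v * norm w * (indicator {0..} t *\<^sub>R exp (- c * t))"
    using stable_integrand_bound[OF assms] by metis
  have "integrable lborel (\<lambda>t. E * norm v * norm w * (indicator {0..} t *\<^sub>R exp (- c * t)))"
    by (intro integrable_mult_right integrable_exp_decay)
  then show ?thesis
  proof (rule Bochner_Integration.integrable_bound)
    show "AE t in lborel. norm (stable_integrand x v w t)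
        \<le> norm (E * norm v * norm w * (indicator {0..} t *\<^sub>R exp (- c * t)))"
      using E(1) by (intro AE_I2 order_trans[OF E(2)]) auto
  qed simp
qed

lemma bilinear_stable_form:
  assumes "x \<in> X"
  shows "bilinear (stable_form x)"
proof -
  note lin = linear_add[OF linear_stable_part[OF assms]] linear_cmul[OF linear_stable_part[OF assms]]
  have "stable_integrand x (u + v) w = (\<lambda>t. stable_integrand x u w t + stable_integrand x v w t)"
    "stable_integrand x w (u + v) = (\<lambda>t. stable_integrand x w u t + stable_integrand x w v t)"
    "stable_integrand x (r *\<^sub>R v) w = (\<lambda>t. r * stable_integrand x v w t)"
    "stable_integrand x w (r *\<^sub>R v) = (\<lambda>t. r * stable_integrand x w v t)" for u v w r
    by (simp_all add: fun_eq_iff stable_integrand_def lin blinfun.add_right blinfun.scaleR_right inner_add_left inner_add_right algebra_simps)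
  then show ?thesis
    unfolding bilinear_def linear_iff stable_form_def
    using integrable_stable_integrand[OF assms] by simp
qed

lemma stable_form_commute: "stable_form x v w = stable_form x w v"
  by (simp add: stable_form_def stable_integrand_def inner_commute)

lemma stable_integrand_nonneg: "0 \<le> stable_integrand x v v t"
  by (simp add: stable_integrand_def)

lemma stable_form_nonneg: "0 \<le> stable_form x v v"
  unfolding stable_form_def by (intro Bochner_Integration.integral_nonneg) (rule stable_integrand_nonneg)

text \<open>
  The integrand is nonnegative and continuous, and its value at time zero is the squared length of the
  stable part.
\<close>

lemma stable_form_pos:
  assumes "x \<in> X" "stable_part x v \<noteq> 0"
  shows "0 < stable_form x v v"
proof -
  define k where "k t = exp (c * t) * (D\<psi> t x (stable_part x v) \<bullet> D\<psi> t x (stable_part x v))" for t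
  define r where "r = stable_part x v \<bullet> stable_part x v"
  have r: "0 < r" using assms(2) by (simp add: r_def)
  have "continuous_on {0..} k"
    unfolding k_def by (intro continuous_intros continuous_D\<psi>_time)
  then obtain \<epsilon> where \<epsilon>: "0 < \<epsilon>" "\<And>t. 0 \<le> t \<Longrightarrow> dist t 0 < \<epsilon> \<Longrightarrow> dist (k t) (k 0) < r / 2"
    unfolding continuous_on_iff using r by (metis atLeast_iff half_gt_zero order_refl)
  have k0: "k 0 = r" by (simp add: k_def r_def)
  have k: "r / 2 \<le> k t" if "0 \<le> t" "t < \<epsilon>" for t
    using \<epsilon>(2)[of t] that unfolding k0 dist_real_def by linarith
  have "r / 2 * (\<epsilon> / 2) = (\<integral>t. r / 2 * indicator {0..\<epsilon>/2} t \<partial>lborel)"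
    using \<epsilon>(1) by simp
  also have "\<dots> \<le> stable_form x v v"
    unfolding stable_form_def
  proof (rule integral_mono)
    show "r / 2 * indicator {0..\<epsilon>/2} t \<le> stable_integrand x v v t" for t
    proof (cases "t \<in> {0..\<epsilon>/2}")
      case True
      then have "r / 2 \<le> k t" using \<epsilon>(1) by (intro k) auto
      then show ?thesis using True by (simp add: stable_integrand_def k_def)
    qed (use stable_integrand_nonneg in simp)
    show "integrable lborel (\<lambda>t. r / 2 * indicator {0..\<epsilon>/2} t)"
      by (intro integrable_mult_right integrable_real_indicator) (auto simp: emeasure_lborel_Icc_eq)
  qed (rule integrable_stable_integrand[OF assms(1)])
  finally show ?thesis using r \<epsilon>(1) by (smt (verit) divide_pos_pos mult_pos_pos)
qed

text \<open>
  Flowing for a time \<open>s\<close> cuts off the initial piece \<open>{0..s}\<close> of the integral and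
  multiplies the rest by \<open>exp (- c * s)\<close>.
\<close>

lemma stable_form_decay:
  assumes "x \<in> X" "0 \<le> s"
  shows "stable_form (\<psi> s x) (D\<psi> s x v) (D\<psi> s x v) \<le> exp (- c * s) * stable_form x v v"
proof -
  have "stable_integrand (\<psi> s x) (D\<psi> s x v) (D\<psi> s x v) t \<le> exp (- c * s) * stable_integrand x v v (s + 1 * t)" for t
  proof (cases "0 \<le> t")
    case True
    have "D\<psi> (t + s) x (stable_part x v) = D\<psi> t (\<psi> s x) (stable_part (\<psi> s x) (D\<psi> s x v))"
      by (simp only: D\<psi>_add[OF True assms(2)] D\<psi>_stable_part[OF assms])
    moreover have "exp (- c * s) * exp (c * (s + t)) = exp (c * t)"
      by (simp add: exp_add[symmetric] algebra_simps)
    ultimately show ?thesis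
      using assms True by (simp add: stable_integrand_def add.commute[of s] mult.assoc[symmetric])
  qed (use stable_integrand_nonneg in \<open>simp add: stable_integrand_def\<close>)
  then have "stable_form (\<psi> s x) (D\<psi> s x v) (D\<psi> s x v) \<le> (\<integral>t. exp (- c * s) * stable_integrand x v v (s + 1 * t) \<partial>lborel)"
    unfolding stable_form_def
    by (intro integral_mono integrable_mult_right lborel_integrable_real_affine integrable_stable_integrand
        forward_invariant assms) auto
  also have "\<dots> = exp (- c * s) * stable_form x v v"
    unfolding stable_form_def
    using lborel_integral_real_affine[of 1 "stable_integrand x v v" s] by simp
  finally show ?thesis .
qed

lemma continuous_stable_part_D\<psi>:
  assumes "0 \<le> t"
  shows "continuous_on X (\<lambda>x. D\<psi> t x (stable_part x v))"
  unfolding stable_part_def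
  by (intro continuous_intros continuous_D\<psi>_at[OF assms] continuous_phase_vector continuous_f)

text \<open>
  Dominated convergence, with the dominating function that is common to all points near \<open>x0\<close>.
\<close>

lemma continuous_stable_form: "continuous_on X (\<lambda>x. stable_form x v w)"
proof -
  have "continuous (at x0) (\<lambda>x. stable_form x v w)" if x0: "x0 \<in> X" for x0
  proof -
    obtain d E where E: "0 < d" "ball x0 d \<subseteq> X" "\<And>y v w t. y \<in> ball x0 d \<Longrightarrow>
       norm (stable_integrand y v w t) \<le> E * norm v * norm w * (indicator {0..} t *\<^sub>R exp (- c * t))"
      using stable_integrand_bound[OF x0] by metis
    have "continuous_on (ball x0 d) (\<lambda>x. stable_form x v w)"
      unfolding continuous_on_sequentially
    proof (intro ballI allI impI, elim conjE)
      fix u :: "nat \<Rightarrow> 'a" and x assume x: "x \<in> ball x0 d" and u: "\<forall>n. u n \<in> ball x0 d" "u \<longlonglongrightarrow> x"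
      have "(\<lambda>n. \<integral>t. stable_integrand (u n) v w t \<partial>lborel) \<longlonglongrightarrow> (\<integral>t. stable_integrand x v w t \<partial>lborel)"
      proof (rule integral_dominated_convergence)
        show "integrable lborel (\<lambda>t. E * norm v * norm w * (indicator {0..} t *\<^sub>R exp (- c * t)))"
          by (intro integrable_mult_right integrable_exp_decay)
        show "AE t in lborel. norm (stable_integrand (u n) v w t) \<le> E * norm v * norm w * (indicator {0..} t *\<^sub>R exp (- c * t))" for n
          using E(3)[of "u n"] u(1) by (intro AE_I2) blast
        show "AE t in lborel. (\<lambda>n. stable_integrand (u n) v w t) \<longlonglongrightarrow> stable_integrand x v w t"
        proof (intro AE_I2)
          fix t :: real
          show "(\<lambda>n. stable_integrand (u n) v w t) \<longlonglongrightarrow> stable_integrand x v w t"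
          proof (cases "0 \<le> t")
            case True
            have "continuous_on (ball x0 d) (\<lambda>x. stable_integrand x v w t)"
              unfolding stable_integrand_def
              using True E(2) by (intro continuous_intros continuous_on_subset[OF continuous_stable_part_D\<psi>])
            then show ?thesis
              using x u unfolding continuous_on_sequentially o_def by blast
          qed (simp add: stable_integrand_def)
        qed
      qed simp_all
      then show "((\<lambda>x. stable_form x v w) \<circ> u) \<longlonglongrightarrow> stable_form x v w"
        by (simp add: stable_form_def o_def)
    qed
    then show ?thesis using E(1) by (simp add: continuous_on_eq_continuous_at)
  qed
  then show ?thesis by (simp add: continuous_at_imp_continuous_on)
qed

definition adapted_metric :: "'a \<Rightarrow> 'a \<Rightarrow> 'a \<Rightarrow> real" where
  "adapted_metric x v w = phase x v * phase x w + stable_form x v w"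

lemma bilinear_adapted_metric:
  assumes "x \<in> X"
  shows "bilinear (adapted_metric x)"
proof -
  have "bilinear (\<lambda>v w. phase x v * phase x w)"
    unfolding bilinear_def linear_iff
    by (simp add: linear_add[OF linear_phase[OF assms]] linear_cmul[OF linear_phase[OF assms]] algebra_simps)
  with bilinear_stable_form[OF assms] show ?thesis
    unfolding adapted_metric_def bilinear_def linear_iff by (simp add: algebra_simps)
qed

lemma adapted_metric_commute: "adapted_metric x v w = adapted_metric x w v"
  by (simp add: adapted_metric_def stable_form_commute[of x v w])

lemma adapted_metric_pos:
  assumes "x \<in> X" "v \<noteq> 0"
  shows "0 < adapted_metric x v v"
proof (cases "stable_part x v = 0")
  case True
  then have "phase x v \<noteq> 0" using assms(2) by (auto simp: stable_part_def)
  then show ?thesis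
    using stable_form_nonneg[of x v] by (simp add: adapted_metric_def add_pos_nonneg flip: power2_eq_square)
next
  case False
  then show ?thesis
    using stable_form_pos[OF assms(1)] by (simp add: adapted_metric_def add_nonneg_pos)
qed

lemma adapted_metric_f:
  assumes "x \<in> X"
  shows "adapted_metric x (f x) v = phase x v"
proof -
  have "stable_part x (f x) = 0" by (simp add: stable_part_def phase_f[OF assms])
  then have "stable_form x (f x) v = 0" by (simp add: stable_form_def stable_integrand_def)
  then show ?thesis by (simp add: adapted_metric_def phase_f[OF assms])
qed

lemma continuous_adapted_metric: "continuous_on X (\<lambda>x. adapted_metric x v w)"
  unfolding adapted_metric_def by (intro continuous_intros continuous_phase_vector continuous_stable_form)

end

section \<open>Powers of a diagonalizable matrix\<close>

lemma det_mat_polyX_minus_diagonal: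
  fixes z :: "'n::finite \<Rightarrow> 'a::comm_ring_1"
  shows "det (mat [:0, 1:] - map_matrix (\<lambda>a. [:a:]) (\<chi> i j. if i = j then z i else 0) :: 'a poly^'n^'n)
    = (\<Prod>i\<in>UNIV. [:- z i, 1:])"
  by (subst det_diagonal) (auto simp: mat_def)

text \<open>
  Take determinants in \<open>(X - A) P = P (X - D)\<close>, where the columns of \<open>P\<close> are the eigenvectors and
  \<open>D\<close> is diagonal; the determinant of \<open>P\<close> is a nonzero constant and cancels.
\<close>

lemma charpoly_eq_prod_eigenvalues:
  fixes A P :: "'a::field^'n^'n"
  assumes "invertible P" and eig: "\<And>i. A *v column i P = z i *s column i P"
  shows "charpoly A = (\<Prod>i\<in>UNIV. [:- z i, 1:])"
proof -
  let ?C = "map_matrix (\<lambda>a. [:a:])"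
  define D where "D = (\<chi> i j. if i = j then z i else 0)"
  have C_mult: "?C (X ** Y) = ?C X ** ?C Y" for X Y :: "'a^'n^'n"
  proof -
    have const_sum: "(\<Sum>k\<in>S. [:h k:]) = [:\<Sum>k\<in>S. h k:]" for h :: "'n \<Rightarrow> 'a" and S
      by (induction S rule: infinite_finite_induct) auto
    show ?thesis by (simp add: vec_eq_iff matrix_matrix_mult_def const_sum mult.commute)
  qed
  have AP: "A ** P = P ** D"
  proof -
    have "(A ** P) $ i $ j = (P ** D) $ i $ j" for i j
    proof -
      have "(A ** P) $ i $ j = (A *v column j P) $ i"
        by (simp add: matrix_matrix_mult_def matrix_vector_mult_def column_def)
      also have "\<dots> = (P ** D) $ i $ j"
        by (simp only: eig) (simp add: matrix_matrix_mult_def D_def column_def if_distrib mult.commute cong: if_cong)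
      finally show ?thesis .
    qed
    then show ?thesis by (simp add: vec_eq_iff)
  qed
  have X_comm: "mat [:0, 1:] ** ?C P = ?C P ** mat [:0, 1:]"
    by (simp add: vec_eq_iff matrix_matrix_mult_def mat_def if_distrib if_distribR mult.commute cong: if_cong)
  have diff_mult: "(X - Y) ** Z = X ** Z - Y ** Z" "Z ** (X - Y) = Z ** X - Z ** Y" for X Y Z :: "'a poly^'n^'n"
    by (simp_all add: vec_eq_iff matrix_matrix_mult_def algebra_simps sum_subtractf)
  have "(mat [:0, 1:] - ?C A) ** ?C P = ?C P ** (mat [:0, 1:] - ?C D)"
    by (simp only: diff_mult X_comm C_mult[symmetric] AP)
  then have "charpoly A * det (?C P) = det (?C P) * charpoly D"
    unfolding charpoly_def by (metis det_mul)
  moreover have "det (?C P) \<noteq> 0"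
  proof -
    obtain Q where "P ** Q = mat 1" using \<open>invertible P\<close> by (auto simp: invertible_def)
    then have "?C P ** ?C Q = mat 1"
      by (simp add: vec_eq_iff mat_def flip: C_mult)
    then have "det (?C P) * det (?C Q) = 1" by (metis det_I det_mul)
    then show ?thesis by auto
  qed
  ultimately have "charpoly A = charpoly D" by simp
  then show ?thesis
    unfolding charpoly_def D_def by (simp add: det_mat_polyX_minus_diagonal)
qed

lemma order_prod_linear_factors_ge_2:
  fixes z :: "'n::finite \<Rightarrow> 'a::field"
  assumes "i \<noteq> j" "z i = a" "z j = a"
  shows "order a (\<Prod>i\<in>UNIV. [:- z i, 1:]) \<ge> 2"
proof -
  have "(\<Prod>i\<in>UNIV. [:- z i, 1:]) = [:- z i, 1:] * ([:- z j, 1:] * (\<Prod>i\<in>UNIV - {i} - {j}. [:- z i, 1:]))"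
    using assms(1) by (simp add: prod.remove[of UNIV i] prod.remove[of "UNIV - {i}" j])
  then have "[:- a, 1:] ^ 2 dvd (\<Prod>i\<in>UNIV. [:- z i, 1:])"
    by (simp only: assms(2,3) power2_eq_square mult.assoc[symmetric] dvd_triv_left)
  moreover have "(\<Prod>i\<in>UNIV. [:- z i, 1:]) \<noteq> 0" by simp
  ultimately show ?thesis by (simp only: order_divides) simp
qed

text \<open>
  As one is a simple root of the characteristic polynomial, it belongs to exactly one vector of the
  eigenvector basis, which must be proportional to \<open>w\<close>. All other coordinates are multiplied by powers
  of numbers in the open unit disc. The limit is real, so the real part of the
  complex coefficient of \<open>w\<close> serves.
\<close>

lemma diagonalizable_power_limit:
  fixes A :: "real^'n^'n" and w v :: "real^'n"
  defines "M \<equiv> map_matrix complex_of_real A"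
  assumes B: "vec.independent B" "card B = CARD('n)" "\<forall>b\<in>B. \<exists>z. eigvec M z b"
    and ord: "order 1 (charpoly M) = 1"
    and small: "\<And>z b. eigvec M z b \<Longrightarrow> z \<noteq> 1 \<Longrightarrow> cmod z < 1"
    and w: "A *v w = w" "w \<noteq> 0"
  shows "\<exists>c. (\<lambda>k. ((*v) A ^^ k) v) \<longlonglongrightarrow> c *\<^sub>R w"
proof -
  have finB: "finite B" using B(2) card_ge_0_finite by force
  then obtain \<beta> where \<beta>: "bij_betw \<beta> (UNIV :: 'n set) B"
    using finite_same_card_bij[of "UNIV :: 'n set" B] B(2) by auto
  define z where "z i = (SOME z. eigvec M z (\<beta> i))" for i
  have eig: "eigvec M (z i) (\<beta> i)" for i
  proof -
    have "\<beta> i \<in> B" using \<beta> by (rule bij_betw_apply) simp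
    with B(3) have "\<exists>z. eigvec M z (\<beta> i)" by blast
    then show ?thesis unfolding z_def by (rule someI_ex)
  qed
  define P where "P = (\<chi> i j. \<beta> j $ i)"
  have col: "column i P = \<beta> i" for i by (simp add: P_def column_def vec_eq_iff)
  have indep: "\<forall>i. c i = 0" if "(\<Sum>i\<in>UNIV. c i *s \<beta> i) = 0" for c
  proof -
    have "(\<Sum>b\<in>B. c (inv_into UNIV \<beta> b) *s b) = (\<Sum>i\<in>UNIV. c i *s \<beta> i)"
      using \<beta> by (subst sum.reindex_bij_betw[OF \<beta>, symmetric]) (simp add: bij_betw_inv_into_left)
    with that have "(\<Sum>b\<in>B. c (inv_into UNIV \<beta> b) *s b) = 0" by simp
    then have "\<And>b. b \<in> B \<Longrightarrow> c (inv_into UNIV \<beta> b) = 0"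
      using B(1) vec.dependent_finite[OF finB] by auto
    then show ?thesis using \<beta> by (metis UNIV_I bij_betw_apply bij_betw_inv_into_left)
  qed
  have "invertible P"
    unfolding invertible_left_inverse matrix_left_invertible_independent_columns col using indep by blast
  then obtain Q where PQ: "P ** Q = mat 1" by (auto simp: invertible_def)
  have expand: "\<exists>c. u = (\<Sum>i\<in>UNIV. c i *s \<beta> i)" for u
  proof -
    have "u = P *v (Q *v u)" by (simp add: matrix_vector_mul_assoc PQ)
    then show ?thesis unfolding matrix_mult_sum[of P] col by blast
  qed
  have uniq: "i = j" if "z i = 1" "z j = 1" for i j
  proof (rule ccontr)
    assume "i \<noteq> j"
    have "charpoly M = (\<Prod>i\<in>UNIV. [:- z i, 1:])"
      using eig by (intro charpoly_eq_prod_eigenvalues[OF \<open>invertible P\<close>]) (simp add: col eigvec_def)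
    then show False using order_prod_linear_factors_ge_2[OF \<open>i \<noteq> j\<close>, of z 1] that ord by simp
  qed
  define cx where "cx u = (\<chi> i. complex_of_real (u $ i))" for u :: "real^'n"
  have M_cx: "M *v cx u = cx (A *v u)" for u
    by (simp add: M_def cx_def matrix_vector_mult_def vec_eq_iff)
  have M_pow: "((*v) M ^^ k) (\<Sum>i\<in>UNIV. c i *s \<beta> i) = (\<Sum>i\<in>UNIV. (c i * z i ^ k) *s \<beta> i)" for k c
  proof (induction k)
    case (Suc k)
    have "M *v (\<Sum>i\<in>S. a i *s \<beta> i) = (\<Sum>i\<in>S. (a i * z i) *s \<beta> i)" for a S
      by (induction S rule: infinite_finite_induct)
        (use eig in \<open>simp_all add: matrix_vector_right_distrib vector_scalar_commute eigvec_def\<close>)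
    with Suc show ?case by (simp add: mult.assoc mult.left_commute mult.commute)
  qed simp
  have M_pow_cx: "((*v) M ^^ k) (cx u) = cx (((*v) A ^^ k) u)" for k u
    by (induction k) (simp_all add: M_cx)
  obtain c where c: "cx w = (\<Sum>i\<in>UNIV. c i *s \<beta> i)" using expand by blast
  have "cx w = (\<Sum>i\<in>UNIV. (c i * z i) *s \<beta> i)"
    using M_pow[of 1 c] M_pow_cx[of 1 w] w(1) by (simp add: c[symmetric])
  then have "(\<Sum>i\<in>UNIV. (c i * (z i - 1)) *s \<beta> i) = 0"
    using c by (simp add: algebra_simps sum_subtractf vector_sub_rdistrib)
  then have cz: "c i = 0 \<or> z i = 1" for i using indep by fastforce
  have "cx w \<noteq> 0" using w(2) by (simp add: cx_def vec_eq_iff)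
  then have "\<exists>i. c i \<noteq> 0" using c by (metis (no_types, lifting) sum.neutral vector_smult_lzero)
  then obtain i where i: "c i \<noteq> 0" "z i = 1" using cz by blast
  have zlt: "cmod (z j) < 1" if "j \<noteq> i" for j
    using uniq[of i j] i that small[OF eig] by blast
  have w_i: "cx w = c i *s \<beta> i"
  proof -
    have "c j = 0" if "j \<noteq> i" for j using cz[of j] uniq[of i j] i that by blast
    then have "(\<Sum>j\<in>UNIV. c j *s \<beta> j) = (\<Sum>j\<in>{i}. c j *s \<beta> j)"
      by (intro sum.mono_neutral_right) auto
    then show ?thesis by (simp add: c)
  qed
  obtain d where d: "cx v = (\<Sum>i\<in>UNIV. d i *s \<beta> i)" using expand by blast
  have "(\<lambda>k. ((*v) A ^^ k) v $ l) \<longlonglongrightarrow> (Re (d i / c i) *\<^sub>R w) $ l" for l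
  proof -
    have "(\<lambda>k. \<Sum>j\<in>UNIV. d j * z j ^ k * \<beta> j $ l) \<longlonglongrightarrow> (\<Sum>j\<in>UNIV. if j = i then d i * \<beta> i $ l else 0)"
    proof (rule tendsto_sum)
      fix j
      show "(\<lambda>k. d j * z j ^ k * \<beta> j $ l) \<longlonglongrightarrow> (if j = i then d i * \<beta> i $ l else 0)"
      proof (cases "j = i")
        case False
        have "(\<lambda>k. d j * z j ^ k * \<beta> j $ l) \<longlonglongrightarrow> d j * 0 * \<beta> j $ l"
          using zlt[OF False] by (intro tendsto_intros LIMSEQ_power_zero) simp
        with False show ?thesis by simp
      qed (simp add: i)
    qed
    moreover have "(\<Sum>j\<in>UNIV. if j = i then d i * \<beta> i $ l else 0) = d i / c i * complex_of_real (w $ l)"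
      using arg_cong[OF w_i, of "\<lambda>x. x $ l"] i by (simp add: cx_def)
    moreover have "(\<Sum>j\<in>UNIV. d j * z j ^ k * \<beta> j $ l) = complex_of_real (((*v) A ^^ k) v $ l)" for k
    proof -
      have "cx (((*v) A ^^ k) v) = (\<Sum>j\<in>UNIV. (d j * z j ^ k) *s \<beta> j)"
        using M_pow[of k d] M_pow_cx[of k v] by (simp add: d[symmetric])
      from arg_cong[OF this, of "\<lambda>x. x $ l"] show ?thesis by (simp add: cx_def)
    qed
    ultimately have "(\<lambda>k. complex_of_real (((*v) A ^^ k) v $ l)) \<longlonglongrightarrow> d i / c i * complex_of_real (w $ l)"
      by simp
    moreover have "Re (u * complex_of_real r) = Re u * r" for u r by simp
    ultimately show ?thesis using tendsto_Re by (fastforce simp del: times_divide_eq_left)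
  qed
  then show ?thesis by (intro exI vec_tendstoI)
qed

section \<open>Strict differential positivity\<close>

context transversally_contracting
begin

text \<open>
  In terms of the invariant covector \<open>l\<close>, the cone of opening \<open>\<kappa>\<close> is
  \<open>stable_form x v v \<le> (\<kappa>\<^sup>2 - 1) * l\<^sup>2\<close> with \<open>0 \<le> l\<close>. The flow shrinks the left-hand side by
  \<open>exp (- c * t)\<close> and leaves the right-hand side alone.
\<close>

lemma adapted_cone_flow:
  assumes "x \<in> X" "0 \<le> t" "0 < \<kappa>" "0 < \<mu>" "exp (- c * t) * (\<kappa>\<^sup>2 - 1) \<le> \<mu>\<^sup>2 - 1"
    and v: "sqrt (adapted_metric x v v) \<le> \<kappa> * adapted_metric x (f x) v"
  shows "sqrt (adapted_metric (\<psi> t x) (D\<psi> t x v) (D\<psi> t x v)) \<le> \<mu> * adapted_metric (\<psi> t x) (f (\<psi> t x)) (D\<psi> t x v)"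
proof -
  define l where "l = phase x v"
  have nn: "0 \<le> adapted_metric x v v" by (simp add: adapted_metric_def stable_form_nonneg)
  have v': "sqrt (adapted_metric x v v) \<le> \<kappa> * l"
    using v by (simp add: adapted_metric_f[OF assms(1)] l_def)
  then have "0 \<le> \<kappa> * l" using nn real_sqrt_ge_zero order_trans by blast
  then have l: "0 \<le> l" using assms(3) by (simp add: zero_le_mult_iff)
  have "adapted_metric x v v \<le> (\<kappa> * l)\<^sup>2" using v' by (rule sqrt_le_D)
  then have "stable_form x v v \<le> (\<kappa>\<^sup>2 - 1) * l\<^sup>2"
    by (simp add: adapted_metric_def l_def power2_eq_square algebra_simps)
  then have "exp (- c * t) * stable_form x v v \<le> exp (- c * t) * (\<kappa>\<^sup>2 - 1) * l\<^sup>2"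
    by (simp add: mult.assoc)
  also have "\<dots> \<le> (\<mu>\<^sup>2 - 1) * l\<^sup>2" using assms(5) by (intro mult_right_mono) auto
  finally have "stable_form (\<psi> t x) (D\<psi> t x v) (D\<psi> t x v) \<le> (\<mu>\<^sup>2 - 1) * l\<^sup>2"
    using stable_form_decay[OF assms(1,2), of v] by linarith
  then have "adapted_metric (\<psi> t x) (D\<psi> t x v) (D\<psi> t x v) \<le> (\<mu> * l)\<^sup>2"
    by (simp add: adapted_metric_def phase_invariant[OF assms(1,2)] l_def power2_eq_square algebra_simps)
  then have "sqrt (adapted_metric (\<psi> t x) (D\<psi> t x v) (D\<psi> t x v)) \<le> \<mu> * l"
    using l assms(4) by (intro real_le_lsqrt) auto
  then show ?thesis
    by (simp add: adapted_metric_f[OF forward_invariant[OF assms(1,2)]] phase_invariant[OF assms(1,2)] l_def)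
qed

end

lemma C1_blinfun_derivative:
  fixes f :: "'a::euclidean_space \<Rightarrow> 'b::real_normed_vector"
  assumes "Ck_on (Suc 0) f UNIV"
  shows "(f has_derivative blinfun_apply (Blinfun (frechet_derivative f (at x)))) (at x)"
    and "continuous_on UNIV (\<lambda>x. Blinfun (frechet_derivative f (at x)))"
proof -
  have der: "(f has_derivative frechet_derivative f (at x)) (at x)" for x
    using assms by (simp add: frechet_derivative_works[symmetric])
  have app: "blinfun_apply (Blinfun (frechet_derivative f (at x))) = frechet_derivative f (at x)" for x
    by (rule bounded_linear_Blinfun_apply[OF has_derivative_bounded_linear[OF der]])
  show "(f has_derivative blinfun_apply (Blinfun (frechet_derivative f (at x)))) (at x)"
    unfolding app by (rule der)
  show "continuous_on UNIV (\<lambda>x. Blinfun (frechet_derivative f (at x)))"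
    by (rule continuous_on_blinfun_componentwise) (use assms in \<open>simp add: app\<close>)
qed

theorem proposition4:
  fixes f :: "real^'n \<Rightarrow> real^'n"
    and \<psi> :: "real \<Rightarrow> real^'n \<Rightarrow> real^'n"
    and \<Gamma> :: "(real^'n) set"
    and T :: real
    and g :: "real^'n \<Rightarrow> real^'n \<Rightarrow> real^'n \<Rightarrow> real"
  assumes "Ck_on 2 f UNIV"
    and "complete_flow f \<psi>"
    and "stable_hyperbolic_limit_cycle \<psi> \<Gamma> T"
    and "independent_monodromy_eigenvectors \<psi> \<Gamma> T"
    and "riemannian_metric_on (basin \<psi> \<Gamma>) g"
  shows "strictly_differentially_positive \<psi> (basin \<psi> \<Gamma>) g"
proof -
  have C1: "Ck_on (Suc 0) f UNIV"
    using assms(1) unfolding numeral_2_eq_2 by (rule Ck_on_Suc_imp)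
  define Df where "Df x = Blinfun (frechet_derivative f (at x))" for x
  interpret complete_C1_flow f \<psi> Df
  proof
    show "(f has_derivative blinfun_apply (Df x)) (at x)" for x
      unfolding Df_def by (rule C1_blinfun_derivative(1)[OF C1])
    show "continuous_on UNIV Df"
      unfolding Df_def by (rule C1_blinfun_derivative(2)[OF C1])
  qed (rule assms(2))

  have "limit_cycle \<psi> \<Gamma> T"
    using assms(3) unfolding stable_hyperbolic_limit_cycle_def by blast
  then obtain p where p: "0 < T" "\<Gamma> = range (\<lambda>t. \<psi> t p)" "\<psi> T p = p" "\<And>t. 0 < t \<Longrightarrow> t < T \<Longrightarrow> \<psi> t p \<noteq> p"
    unfolding limit_cycle_def by blast
  have p_in: "p \<in> \<Gamma>" unfolding p(2) by (rule range_eqI[of _ _ 0]) simp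
  have f_p: "f p \<noteq> 0" using flow_equilibrium[of p "T / 2"] p(1) p(4)[of "T / 2"] by auto

  have differential: "flow_differential \<psi> t x = blinfun_apply (D\<psi> t x)" if "0 \<le> t" for t x
    using frechet_derivative_at[OF flow_has_derivative[OF that]] by simp
  define A where "A = jacobian (\<psi> T) (at p)"
  have A: "(*v) A = blinfun_apply (D\<psi> T p)"
    using p(1) by (simp add: fun_eq_iff A_def jacobian_def differential matrix_works
        bounded_linear.linear[OF blinfun.bounded_linear_right])
  have M: "monodromy_matrix \<psi> T p = map_matrix complex_of_real A"
    by (simp add: monodromy_matrix_def A_def)
  have mon: "\<exists>k. (\<lambda>j. (blinfun_apply (D\<psi> T p) ^^ j) v) \<longlonglongrightarrow> k *\<^sub>R f p" for v
  proof -
    obtain B where B: "vec.independent B" "card B = CARD('n)"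
      "\<forall>b\<in>B. \<exists>z. eigvec (map_matrix complex_of_real A) z b"
      using assms(4) p_in unfolding independent_monodromy_eigenvectors_def M[symmetric] by blast
    have "order 1 (charpoly (monodromy_matrix \<psi> T p)) = 1 \<and>
        (\<forall>z. floquet_multiplier \<psi> T p z \<and> z \<noteq> 1 \<longrightarrow> cmod z < 1)"
      using assms(3) p_in unfolding stable_hyperbolic_limit_cycle_def by blast
    then have ord: "order 1 (charpoly (map_matrix complex_of_real A)) = 1"
      and small: "\<And>z b. eigvec (map_matrix complex_of_real A) z b \<Longrightarrow> z \<noteq> 1 \<Longrightarrow> cmod z < 1"
      unfolding floquet_multiplier_def M by blast+
    have Af: "A *v f p = f p" using D\<psi>_f[of T p] p(1,3) by (simp add: A)
    show ?thesis
      unfolding A[symmetric] by (rule diagonalizable_power_limit[OF B ord small Af f_p])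
  qed
  interpret attracting_cycle f \<psi> Df \<Gamma> p T
    by (unfold_locales; (fact p(1) | fact p(2) | fact p(3) | fact f_p | rule mon))

  obtain c where c: "0 < c"
    "\<And>x0. x0 \<in> basin \<psi> \<Gamma> \<Longrightarrow> locally_contracting (basin \<psi> \<Gamma>) c x0"
    by (rule transverse_contraction_near_basin_points) blast
  interpret transversally_contracting f \<psi> Df "basin \<psi> \<Gamma>" c
    by (unfold_locales; (fact c(1) | rule c(2), assumption | rule flow_in_basin, assumption))
  interpret metric_with_axis "basin \<psi> \<Gamma>" adapted_metric f
  proof
    show "continuous_on (basin \<psi> \<Gamma>) (\<lambda>x. adapted_metric x (f x) v)" for v
      by (rule continuous_on_eq[OF continuous_phase_vector]) (simp add: adapted_metric_f)
  qed (simp_all add: open_basin bilinear_adapted_metric adapted_metric_pos continuous_adapted_metric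
      adapted_metric_f phase_f adapted_metric_commute[of _ v w for v w])

  have cone_flow: "flow_differential \<psi> t x ` axis_cone \<kappa> x \<subseteq> axis_cone \<mu> (\<psi> t x)"
    if "x \<in> basin \<psi> \<Gamma>" "0 \<le> t" "0 < \<kappa>" "0 < \<mu>" "exp (- c * t) * (\<kappa>\<^sup>2 - 1) \<le> \<mu>\<^sup>2 - 1" for x t \<kappa> \<mu>
    using adapted_cone_flow[OF that] by (auto simp: differential[OF that(2)] axis_cone_def)
  \<comment> \<open>The openings 2 and 3/2 bound the form by 3 and 5/4 times the squared covector, so a
    contraction of the form by the factor 1/3 is more than enough.\<close>
  have decay: "exp (- c * t) * 3 \<le> 1" if "ln 3 / c \<le> t" for t
  proof -
    have "ln 3 \<le> c * t" using that c(1) by (simp add: field_simps)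
    then have "exp (ln 3) \<le> exp (c * t)" by (simp only: exp_le_cancel_iff)
    then show ?thesis by (simp add: exp_minus field_simps)
  qed
  have "differentially_positive \<psi> (basin \<psi> \<Gamma>) (axis_cone 2)"
    unfolding differentially_positive_def
    using c(1) by (intro ballI allI impI cone_flow) auto
  moreover have "flow_differential \<psi> t x ` axis_cone 2 x \<subseteq> axis_cone (3/2) (\<psi> t x)"
    if "x \<in> basin \<psi> \<Gamma>" "ln 3 / c \<le> t" for x t
  proof (rule cone_flow[OF that(1)])
    have "0 < ln 3 / c" using c(1) by simp
    with that(2) show "0 \<le> t" by linarith
    show "exp (- c * t) * (2\<^sup>2 - 1) \<le> (3/2)\<^sup>2 - 1" using decay[OF that(2)] by (simp add: power2_eq_square)
  qed auto
  ultimately have "strictly_differentially_positive_wrt \<psi> (basin \<psi> \<Gamma>) g (axis_cone 2)"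
    unfolding strictly_differentially_positive_wrt_def
    using c(1) axis_cone_subset_interior[of _ "3/2" 2]
    by (intro conjI exI[of _ "ln 3 / c"] exI[of _ "axis_cone (3/2)"] cone_field_axis_cone
        linearly_equivalent_axis_cones smoothly_represented_axis_cones assms(5)) auto
  then show ?thesis
    unfolding strictly_differentially_positive_def using cone_field_axis_cone[of 2] by auto
qed

end
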